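(* $\#\mathsf{RP}_1\subseteq\mathsf{FPRAS}'\subseteq\#\mathsf{RP}_2$.
   Context: $\#\mathsf{P}$ is the class of functions $f=acc_M$ counting accepting paths of nondeterministic polynomial-time Turing machines (NPTMs) $M$. For an NPTM $M$, $p_M$ is the polynomial such that on inputs of length $n$, $M$ makes $p_M(n)$ binary nondeterministic choices; $\mathcal{MR}$ is the set of NPTMs $M$ such that for all $x$ either $acc_M(x)=0$ or $acc_M(x)>\frac12\cdot 2^{p_M(|x|)}$. $\#\mathsf{RP}_1=\{f\in\#\mathsf{P}\mid \exists M\in\mathcal{MR}\ \forall x: f(x)=acc_M(x)\}$. $\#\mathsf{RP}_2=\{f\in\#\mathsf{P}: \{x: f(x)>0\}\in\mathsf{RP}\}$. $\mathsf{FPRAS}$ is the class of $f\in\#\mathsf{P}$ for which there is a randomized algorithm that on input $x$, $\epsilon>0$, $\delta>0$ returns $\widehat{f(x)}$ with $\Pr[(1-\epsilon)f(x)\le\widehat{f(x)}\le(1+\epsilon)f(x)]\ge1-\delta$ in time polynomial in $|x|,\epsilon^{-1},\log\delta^{-1}$; $\mathsf{FPRAS}'$ is the class of $f\in\mathsf{FPRAS}$ having such an algorithm that additionally returns $0$ with probability $1$ whenever $f(x)=0$. *)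

theory Defs
  imports "HOL-Probability.Probability_Mass_Function" "HOL-Computational_Algebra.Polynomial"
begin

section \<open>Multi-tape Turing machines with binary choices\<close>

datatype 'a sym = Blank | Bit bool | Point | Slash | Aux 'a

datatype dir = Move_L | Stay | Move_R

text \<open>An action consists of the next state and, for each tape, the symbol written and the head move.\<close>

type_synonym ('q, 'a) action = "'q \<times> ('a sym \<times> dir) list"

text \<open>A machine determines, from its state and the scanned symbols, either a single action or
  an explicit binary choice. The two branches of a choice always count as different computation
  paths, whether or not their actions differ.\<close>

datatype ('q, 'a) transition =
    Det "('q, 'a) action"
  | Choice "('q, 'a) action" "('q, 'a) action"

record ('q, 'a) tm =
  tapes :: nat
  states :: "'q set"
  alphabet :: "'a sym set"
  start :: 'q
  accept :: 'q
  reject :: 'q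
  delta :: "'q \<Rightarrow> 'a sym list \<Rightarrow> ('q, 'a) transition"

fun actions :: "('q, 'a) transition \<Rightarrow> ('q, 'a) action set" where
  "actions (Det a) = {a}"
| "actions (Choice a b) = {a, b}"

definition wf_tm :: "('q, 'a) tm \<Rightarrow> bool" where
  "wf_tm M \<longleftrightarrow>
     finite (states M) \<and> finite (alphabet M) \<and>
     {start M, accept M, reject M} \<subseteq> states M \<and> accept M \<noteq> reject M \<and>
     {Blank, Bit False, Bit True, Point, Slash} \<subseteq> alphabet M \<and>
     (\<forall>q \<in> states M. \<forall>ss. length ss = tapes M \<and> set ss \<subseteq> alphabet M \<longrightarrow>
        (\<forall>(q', acts) \<in> actions (delta M q ss).
           q' \<in> states M \<and> length acts = tapes M \<and> fst ` set acts \<subseteq> alphabet M))"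

text \<open>Tapes are infinite in both directions; a tape is its content together with the head position.\<close>

type_synonym 'a tape = "(int \<Rightarrow> 'a sym) \<times> int"
type_synonym ('q, 'a) config = "'q \<times> 'a tape list"

fun act_tape :: "'a sym \<times> dir \<Rightarrow> 'a tape \<Rightarrow> 'a tape" where
  "act_tape (s, d) (t, h) =
     (t(h := s), case d of Move_L \<Rightarrow> h - 1 | Stay \<Rightarrow> h | Move_R \<Rightarrow> h + 1)"

fun apply_action :: "('q, 'a) action \<Rightarrow> ('q, 'a) config \<Rightarrow> ('q, 'a) config" where
  "apply_action (q', acts) (q, ts) = (q', map2 act_tape acts ts)"

definition halted :: "('q, 'a) tm \<Rightarrow> ('q, 'a) config \<Rightarrow> bool" where
  "halted M c \<longleftrightarrow> fst c = accept M \<or> fst c = reject M"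

definition transition_at :: "('q, 'a) tm \<Rightarrow> ('q, 'a) config \<Rightarrow> ('q, 'a) transition" where
  "transition_at M c = delta M (fst c) (map (\<lambda>(t, h). t h) (snd c))"

definition init_config :: "('q, 'a) tm \<Rightarrow> (int \<Rightarrow> 'a sym) list \<Rightarrow> ('q, 'a) config" where
  "init_config M ins =
     (start M, map (\<lambda>t. (t, 0)) (ins @ replicate (tapes M - length ins) (\<lambda>_. Blank)))"

text \<open>\<open>comp_path M c bs t c'\<close>: from \<open>c\<close> the machine can reach \<open>c'\<close> in exactly \<open>t\<close> steps, and
  \<open>bs\<close> lists the outcomes of the binary choices made on the way.\<close>

inductive comp_path ::
  "('q, 'a) tm \<Rightarrow> ('q, 'a) config \<Rightarrow> bool list \<Rightarrow> nat \<Rightarrow> ('q, 'a) config \<Rightarrow> bool"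
  for M :: "('q, 'a) tm" where
  refl: "comp_path M c [] 0 c"
| det: "\<not> halted M c \<Longrightarrow> transition_at M c = Det a \<Longrightarrow>
    comp_path M (apply_action a c) bs t c' \<Longrightarrow> comp_path M c bs (Suc t) c'"
| choice: "\<not> halted M c \<Longrightarrow> transition_at M c = Choice a0 a1 \<Longrightarrow>
    comp_path M (apply_action (if b then a1 else a0) c) bs t c' \<Longrightarrow>
    comp_path M c (b # bs) (Suc t) c'"

text \<open>Transitions are total, so a bound on the length of all paths means that every path halts.\<close>

definition halts_within :: "('q, 'a) tm \<Rightarrow> ('q, 'a) config \<Rightarrow> nat \<Rightarrow> bool" where
  "halts_within M c T \<longleftrightarrow> (\<forall>bs t c'. comp_path M c bs t c' \<longrightarrow> t \<le> T)"


section \<open>Counting classes\<close>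

definition word_tape :: "'a sym list \<Rightarrow> int \<Rightarrow> 'a sym" where
  "word_tape w i = (if 0 \<le> i \<and> i < int (length w) then w ! nat i else Blank)"

definition input_config :: "('q, 'a) tm \<Rightarrow> bool list \<Rightarrow> ('q, 'a) config" where
  "input_config M x = init_config M [word_tape (map Bit x)]"

definition is_polynomial :: "(nat \<Rightarrow> nat) \<Rightarrow> bool" where
  "is_polynomial p \<longleftrightarrow> (\<exists>P :: real poly. \<forall>n. real (p n) = poly P (real n))"

text \<open>\<open>nptm M p\<close>: \<open>M\<close> is a nondeterministic polynomial-time machine and \<open>p\<close> is its \<open>p\<^sub>M\<close>, i.e. on
  inputs of length \<open>n\<close> every computation path of \<open>M\<close> makes exactly \<open>p n\<close> binary choices.\<close>

definition nptm :: "(nat, nat) tm \<Rightarrow> (nat \<Rightarrow> nat) \<Rightarrow> bool" where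
  "nptm M p \<longleftrightarrow>
     wf_tm M \<and> tapes M \<ge> 1 \<and> is_polynomial p \<and>
     (\<exists>T. is_polynomial T \<and> (\<forall>x. halts_within M (input_config M x) (T (length x)))) \<and>
     (\<forall>x bs t c. comp_path M (input_config M x) bs t c \<and> halted M c \<longrightarrow> length bs = p (length x))"

definition acc :: "('q, 'a) tm \<Rightarrow> bool list \<Rightarrow> nat" where
  "acc M x = card {bs. \<exists>t c. comp_path M (input_config M x) bs t c \<and> fst c = accept M}"

definition sharpP :: "(bool list \<Rightarrow> nat) set" where
  "sharpP = {f. \<exists>M p. nptm M p \<and> (\<forall>x. f x = acc M x)}"

definition MR :: "((nat, nat) tm \<times> (nat \<Rightarrow> nat)) set" where
  "MR = {(M, p). nptm M p \<and>
     (\<forall>x. acc M x = 0 \<or> real (acc M x) > 1/2 * 2 ^ p (length x))}"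

definition RP :: "bool list set set" where
  "RP = {L. \<exists>M p. nptm M p \<and>
     (\<forall>x. (x \<in> L \<longrightarrow> real (acc M x) \<ge> 1/2 * 2 ^ p (length x)) \<and> (x \<notin> L \<longrightarrow> acc M x = 0))}"

definition sharpRP1 :: "(bool list \<Rightarrow> nat) set" where
  "sharpRP1 = {f \<in> sharpP. \<exists>(M, p) \<in> MR. \<forall>x. f x = acc M x}"

definition sharpRP2 :: "(bool list \<Rightarrow> nat) set" where
  "sharpRP2 = {f \<in> sharpP. {x. f x > 0} \<in> RP}"


section \<open>Randomized approximation\<close>

text \<open>Reading the choices as fair coin flips gives the distribution of the configuration after \<open>t\<close>
  steps (halted computations stay put) and, for a machine whose running time is bounded, the
  distribution of its final configuration.\<close>

fun run :: "('q, 'a) tm \<Rightarrow> nat \<Rightarrow> ('q, 'a) config \<Rightarrow> ('q, 'a) config pmf" where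
  "run M 0 c = return_pmf c"
| "run M (Suc t) c =
     (if halted M c then return_pmf c
      else case transition_at M c of
        Det a \<Rightarrow> run M t (apply_action a c)
      | Choice a0 a1 \<Rightarrow>
          bind_pmf (bernoulli_pmf (1/2)) (\<lambda>b. run M t (apply_action (if b then a1 else a0) c)))"

definition outcome :: "('q, 'a) tm \<Rightarrow> ('q, 'a) config \<Rightarrow> ('q, 'a) config pmf" where
  "outcome M c = run M (LEAST T. halts_within M c T) c"

text \<open>The accuracy parameters are arbitrary positive reals, so each is supplied on a tape of its
  own as its (in general infinite) binary expansion: the integer part without leading zeros (hence
  no digit at all if the number is below 1), starting at cell 0, then the binary point, then the
  fractional digits. A machine can thus find the order of magnitude of \<open>\<epsilon>\<close> in time
  logarithmic in \<open>1/\<epsilon>\<close>, and time bounds need not account for the length of an encoding.\<close>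

definition binary_digit :: "real \<Rightarrow> int \<Rightarrow> bool" where
  "binary_digit r k \<longleftrightarrow> odd \<lfloor>r / 2 powi k\<rfloor>"

definition real_tape :: "real \<Rightarrow> int \<Rightarrow> 'a sym" where
  "real_tape r i =
     (let m = int (LEAST m. r < 2 ^ m) in
      if i < 0 then Blank
      else if i < m then Bit (binary_digit r (m - 1 - i))
      else if i = m then Point
      else Bit (binary_digit r (m - i)))"

definition approx_config ::
  "('q, 'a) tm \<Rightarrow> bool list \<Rightarrow> real \<Rightarrow> real \<Rightarrow> ('q, 'a) config" where
  "approx_config M x \<epsilon> \<delta> = init_config M [word_tape (map Bit x), real_tape \<epsilon>, real_tape \<delta>]"

definition binary_value :: "bool list \<Rightarrow> nat" where
  "binary_value bs = horner_sum of_bool 2 (rev bs)"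

text \<open>Results are nonnegative rationals, written on tape 3 from cell 0 as numerator and
  denominator in binary (most significant bit first).\<close>

definition returns :: "('q, 'a) config \<Rightarrow> real \<Rightarrow> bool" where
  "returns c r \<longleftrightarrow>
     (\<exists>us vs. (let w = map Bit us @ Slash # map Bit vs in
         \<forall>i \<in> {0..int (length w)}. fst (snd c ! 3) i = word_tape w i) \<and>
       binary_value vs \<noteq> 0 \<and> r = real (binary_value us) / real (binary_value vs))"

text \<open>\<open>\<delta>\<close> may exceed 1, so \<open>log \<delta>\<^sup>-\<^sup>1\<close> is truncated at 0 in the time bound. As the three
  quantities are nonnegative, being bounded by a polynomial in them is the same as being bounded
  by a univariate polynomial in their sum.\<close>

definition approximates :: "(nat, nat) tm \<Rightarrow> (bool list \<Rightarrow> nat) \<Rightarrow> bool" where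
  "approximates M f \<longleftrightarrow>
     wf_tm M \<and> tapes M \<ge> 4 \<and>
     (\<exists>P :: real poly. \<forall>x \<epsilon> \<delta>. \<epsilon> > 0 \<and> \<delta> > 0 \<longrightarrow>
        (\<exists>T. halts_within M (approx_config M x \<epsilon> \<delta>) T \<and>
             real T \<le> poly P (real (length x) + 1 / \<epsilon> + max 0 (log 2 (1 / \<delta>))))) \<and>
     (\<forall>x \<epsilon> \<delta>. \<epsilon> > 0 \<and> \<delta> > 0 \<longrightarrow>
        measure_pmf.prob (outcome M (approx_config M x \<epsilon> \<delta>))
          {c. \<exists>r. returns c r \<and> (1 - \<epsilon>) * real (f x) \<le> r \<and> r \<le> (1 + \<epsilon>) * real (f x)}
        \<ge> 1 - \<delta>)"

definition FPRAS :: "(bool list \<Rightarrow> nat) set" where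
  "FPRAS = {f \<in> sharpP. \<exists>M. approximates M f}"

definition FPRAS' :: "(bool list \<Rightarrow> nat) set" where
  "FPRAS' = {f \<in> FPRAS. \<exists>M. approximates M f \<and>
     (\<forall>x \<epsilon> \<delta>. \<epsilon> > 0 \<and> \<delta> > 0 \<and> f x = 0 \<longrightarrow>
        measure_pmf.prob (outcome M (approx_config M x \<epsilon> \<delta>)) {c. returns c 0} = 1)}"

end

theory Submission
  imports Defs "HOL-Library.Countable" "HOL-Probability.Hoeffding"
begin

text \<open>For the first inclusion let \<open>M\<close> accept with probability \<open>q\<close>, where \<open>q = 0\<close> or \<open>q > 1/2\<close>. Run \<open>M\<close>
  \<open>k\<close> times and return \<open>X 2\<^sup>p / k\<close>, where \<open>X\<close> is the number of accepting runs. If \<open>j\<close> and \<open>J\<close> are the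
  indices of the first cells with digit 1 on the tapes of \<open>\<epsilon>\<close> and \<open>\<delta>\<close>, then \<open>2\<^sup>-\<^sup>j \<le> \<epsilon>\<close> and \<open>2\<^sup>-\<^sup>J \<le> \<delta>\<close>,
  and \<open>k = (J + 1) 4\<^bsup>j + 1\<^esup>\<close> runs suffice by Hoeffding's inequality. This \<open>k\<close> is easy to count to: every
  overflow of a binary counter with \<open>2 j + 2\<close> digits advances the head on the tape of \<open>\<delta>\<close> by one
  cell. Between two runs the tapes of \<open>M\<close> are restored as in Bennett's reversible simulation, by
  undoing a logged history step by step; hence no cell has to be searched for and erased.

  For the second inclusion run the approximation scheme with \<open>\<epsilon> = \<delta> = 1/2\<close> and accept if the
  numerator it returns contains a digit 1. All computation paths must make the same number of choices,
  so a clock that runs for \<open>(n + 2)\<^sup>d - 1\<close> ticks drives the simulation, with one choice per tick, used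
  or not. The infinite expansions of \<open>\<epsilon>\<close> and \<open>\<delta>\<close> are written down beforehand, one digit per
  tick, which is as far as the simulation can see.\<close>

section \<open>Computation paths\<close>

text \<open>The sampler is given no machine that computes \<open>p\<close>, yet its answer contains
  the factor 2^p. It therefore runs \<open>M\<close> once more after sampling and prints a digit 0
  for every binary choice. All paths of \<open>M\<close> make exactly p choices, so this appends p
  zeros to the numerator. A full run thus consumes K p + p random bits, the last p of which do not
  affect the answer. The gap between 0 and 1/2 serves twice. For q = 0 no run ever accepts, so the
  answer 0 is certain. For q \<ge> 1/2 an additive error of q / 2^j is a relative error of 2^-j, and
  a number of runs of order 4^j, polynomial in 1 / \<epsilon>, controls it. For both machines it is
  enough to exhibit one halting path for each choice string of the right length.
  \<open>complete_paths\<close> turns this into a time bound, the number of choices on every halting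
  path and the output distribution, so that counting accepting paths and estimating probabilities
  become statements about uniform bit strings.\<close>

declare split_paired_All [simp del] split_paired_Ex [simp del]

lemma comp_path_trans:
  "comp_path M c bs t c' \<Longrightarrow> comp_path M c' bs' t' c'' \<Longrightarrow>
    comp_path M c (bs @ bs') (t + t') c''"
  by (induction rule: comp_path.induct) (auto intro: comp_path.intros)

lemma comp_path_halted:
  "comp_path M c bs t c' \<Longrightarrow> halted M c \<Longrightarrow> bs = [] \<and> t = 0 \<and> c' = c"
  by (auto elim: comp_path.cases)

lemma comp_path_det:
  assumes "\<not> halted M c" "transition_at M c = Det a"
  shows "comp_path M c bs t c' \<longleftrightarrow>
    (bs = [] \<and> t = 0 \<and> c' = c) \<or> (\<exists>t'. t = Suc t' \<and> comp_path M (apply_action a c) bs t' c')"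
  using assms by (auto elim: comp_path.cases intro: comp_path.intros)

lemma comp_path_choice:
  assumes "\<not> halted M c" "transition_at M c = Choice a0 a1"
  shows "comp_path M c bs t c' \<longleftrightarrow>
    (bs = [] \<and> t = 0 \<and> c' = c) \<or>
    (\<exists>b bs' t'. bs = b # bs' \<and> t = Suc t' \<and>
      comp_path M (apply_action (if b then a1 else a0) c) bs' t' c')"
    (is "?l \<longleftrightarrow> ?r")
proof
  assume ?l
  then show ?r
  proof cases
    case (choice b0 b1 b bs' t')
    then show ?thesis using assms by (metis transition.inject(2))
  qed (use assms in simp_all)
next
  assume ?r
  then show ?l
  proof (elim disjE exE conjE)
    fix b bs' t'
    assume "bs = b # bs'" "t = Suc t'" "comp_path M (apply_action (if b then a1 else a0) c) bs' t' c'"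
    then show ?l using comp_path.choice[OF assms] by metis
  qed (simp add: comp_path.refl)
qed

text \<open>The recursion follows the coin flips of \<open>run\<close>; by \<open>pmf_bits\<close>
  this is the uniform distribution on the strings of length \<open>n\<close>.\<close>

primrec bits :: "nat \<Rightarrow> bool list pmf" where
  "bits 0 = return_pmf []"
| "bits (Suc n) = bind_pmf (bernoulli_pmf (1/2)) (\<lambda>b. map_pmf (Cons b) (bits n))"

text \<open>The bits determine the computation, so halting paths labelled by all strings of length
  \<open>n\<close> leave no room for others: every path is an initial part of one of them.\<close>

lemma complete_paths:
  assumes "\<And>bs. length bs = n \<Longrightarrow> \<exists>t\<le>T. comp_path M c bs t (F bs) \<and> halted M (F bs)"
  shows "halts_within M c T"
    and "comp_path M c bs t c' \<Longrightarrow> halted M c' \<Longrightarrow> length bs = n \<and> c' = F bs"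
    and "T \<le> T' \<Longrightarrow> run M T' c = map_pmf F (bits n)"
proof -
  have "halts_within M c T \<and>
    (\<forall>bs t c'. comp_path M c bs t c' \<longrightarrow> halted M c' \<longrightarrow> length bs = n \<and> c' = F bs) \<and>
    (\<forall>T'. T \<le> T' \<longrightarrow> run M T' c = map_pmf F (bits n))"
    using assms
  proof (induction T arbitrary: n c F)
    case 0
    have *: "halted M c \<and> n = 0 \<and> F [] = c"
    proof -
      obtain bs :: "bool list" where bs: "length bs = n" using Ex_list_of_length by blast
      then have "comp_path M c bs 0 (F bs)" "halted M (F bs)"
        using "0"[of bs] by auto
      then show ?thesis using bs by (auto elim: comp_path.cases)
    qed
    have "run M T' c = return_pmf c" for T'
      using * by (cases T') auto
    then show ?case
      using * by (auto simp: halts_within_def dest: comp_path_halted)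
  next
    case (Suc T)
    show ?case
    proof (cases "halted M c")
      case True
      \<comment> \<open>No path leaves a halted configuration, so the sample string
        \<open>replicate n True\<close> must be empty.\<close>
      have *: "n = 0 \<and> F [] = c"
        using Suc.prems[of "replicate n True"] True by (auto dest: comp_path_halted)
      have "run M T' c = return_pmf c" for T'
        using True by (cases T') auto
      then show ?thesis
        using * True by (auto simp: halts_within_def dest: comp_path_halted)
    next
      case nh: False
      show ?thesis
      proof (cases "transition_at M c")
        case (Det a)
        note path = comp_path_det[OF nh Det]
        have "\<exists>t\<le>T. comp_path M (apply_action a c) bs t (F bs) \<and> halted M (F bs)"
          if "length bs = n" for bs
          using Suc.prems[OF that] nh unfolding path by auto
        note IH = Suc.IH[of n "apply_action a c" F, OF this]
        have "run M T' c = map_pmf F (bits n)" if "Suc T \<le> T'" for T'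
          using that IH nh Det by (cases T') auto
        then show ?thesis
          using IH nh by (auto simp: halts_within_def path)
      next
        case (Choice a0 a1)
        note path = comp_path_choice[OF nh Choice]
        have "n \<noteq> 0"
        proof
          assume "n = 0"
          then show False
            using Suc.prems[of "[]"] nh unfolding path by auto
        qed
        then obtain n' where n: "n = Suc n'" by (cases n) auto
        have "\<exists>t\<le>T. comp_path M (apply_action (if b then a1 else a0) c) bs t (F (b # bs)) \<and>
            halted M (F (b # bs))"
          if "length bs = n'" for b bs
          using Suc.prems[of "b # bs"] that nh n unfolding path by auto
        \<comment> \<open>After the choice \<open>b\<close> the remaining string has length
          \<open>n'\<close> and the end is \<open>F (b # bs)\<close>; this is why \<open>n\<close>
          and \<open>F\<close> vary in the induction.\<close>
        note IH = Suc.IH[of n' "apply_action (if b then a1 else a0) c" "\<lambda>bs. F (b # bs)" for b, OF this]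
        have "run M T' c = map_pmf F (bits n)" if "Suc T \<le> T'" for T'
        proof -
          obtain T'' where T'': "T' = Suc T''" "T \<le> T''"
            using \<open>Suc T \<le> T'\<close> by (cases T') auto
          have "run M T'' (apply_action (if b then a1 else a0) c) = map_pmf (\<lambda>bs. F (b # bs)) (bits n')"
            for b using IH[of b] T'' by blast
          then show ?thesis
            using nh Choice n by (simp add: T'' map_bind_pmf pmf.map_comp o_def)
        qed
        moreover have "halts_within M c (Suc T)"
          using IH nh by (fastforce simp: halts_within_def path)
        moreover have "length bs = n \<and> c' = F bs" if "comp_path M c bs t c'" "halted M c'" for bs t c'
          using that IH nh n unfolding path by fastforce
        ultimately show ?thesis by blast
      qed
    qed
  qed
  then show "halts_within M c T"
    and "comp_path M c bs t c' \<Longrightarrow> halted M c' \<Longrightarrow> length bs = n \<and> c' = F bs"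
    and "T \<le> T' \<Longrightarrow> run M T' c = map_pmf F (bits n)"
    by blast+
qed

lemma acc_eq_card:
  assumes F: "\<And>bs. length bs = n \<Longrightarrow>
    \<exists>t\<le>T. comp_path M (input_config M x) bs t (F bs) \<and> halted M (F bs)"
  shows "acc M x = card {bs. fst (F bs) = accept M \<and> length bs = n}"
proof -
  have "{bs. \<exists>t c. comp_path M (input_config M x) bs t c \<and> fst c = accept M} =
    {bs. fst (F bs) = accept M \<and> length bs = n}" (is "?A = ?B")
  proof (intro set_eqI iffI)
    fix bs assume "bs \<in> ?A"
    then obtain t c where *: "comp_path M (input_config M x) bs t c" "fst c = accept M" by blast
    then have "halted M c" by (simp add: halted_def)
    with complete_paths(2)[of n T M "input_config M x" F, OF F *(1)] show "bs \<in> ?B" using *(2) by auto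
  qed (use F in blast)
  then show ?thesis by (simp add: acc_def)
qed

text \<open>Transitions are total, so a computation that follows given bits ends only by halting,
  here within \<open>T\<close> steps. Deterministic steps read no bit, so in general only a prefix
  is used.\<close>

lemma halting_prefix_exists:
  assumes "halts_within M c T" "T \<le> length bs"
  shows "\<exists>k t c'. k \<le> length bs \<and> t \<le> T \<and> comp_path M c (take k bs) t c' \<and> halted M c'"
  using assms
proof (induction T arbitrary: c bs)
  case 0
  have "halted M c"
  proof (rule ccontr)
    assume nh: "\<not> halted M c"
    have "\<exists>bs c'. comp_path M c bs 1 c'"
    proof (cases "transition_at M c")
      case (Det a)
      then show ?thesis using comp_path.det[OF nh Det comp_path.refl] by auto
    next
      case (Choice a0 a1)
      then show ?thesis using comp_path.choice[OF nh Choice comp_path.refl] by auto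
    qed
    then show False using "0" by (fastforce simp: halts_within_def)
  qed
  then show ?case by (auto intro!: exI[of _ 0] comp_path.refl)
next
  case (Suc T)
  show ?case
  proof (cases "halted M c")
    case True
    then show ?thesis by (auto intro!: exI[of _ 0] comp_path.refl)
  next
    case nh: False
    show ?thesis
    proof (cases "transition_at M c")
      case (Det a)
      have "halts_within M (apply_action a c) T"
        using Suc.prems(1) by (auto simp: halts_within_def comp_path_det[OF nh Det])
      with Suc.IH[of "apply_action a c" bs] Suc.prems(2) obtain k t c' where
        "k \<le> length bs" "t \<le> T" "comp_path M (apply_action a c) (take k bs) t c'" "halted M c'"
        by auto
      then show ?thesis
        using nh Det by (intro exI[of _ k] exI[of _ "Suc t"] exI[of _ c']) (auto intro: comp_path.intros)
    next
      case (Choice a0 a1)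
      obtain b bs' where bs: "bs = b # bs'" using Suc.prems by (cases bs) auto
      let ?c = "apply_action (if b then a1 else a0) c"
      have "halts_within M ?c T"
        unfolding halts_within_def
      proof (intro allI impI)
        fix bs t c' assume "comp_path M ?c bs t c'"
        then have "comp_path M c (b # bs) (Suc t) c'"
          using nh Choice by (auto intro: comp_path.intros)
        then show "t \<le> T" using Suc.prems(1) by (fastforce simp: halts_within_def)
      qed
      with Suc.IH[of ?c bs'] Suc.prems(2) bs obtain k t c' where
        "k \<le> length bs'" "t \<le> T" "comp_path M ?c (take k bs') t c'" "halted M c'"
        by auto
      then show ?thesis
        using nh Choice bs
        by (intro exI[of _ "Suc k"] exI[of _ "Suc t"] exI[of _ c']) (auto intro: comp_path.intros)
    qed
  qed
qed

text \<open>Padded with \<open>T\<close> further bits, \<open>bs\<close> is long enough for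
  \<open>halting_prefix_exists\<close>. The halting prefix has exactly \<open>n\<close> bits by
  assumption, so it is \<open>bs\<close> itself. This turns the condition of \<open>nptm\<close> on
  halting paths into the existence of a path for every string.\<close>

lemma nptm_paths_complete:
  assumes "halts_within M c T"
    and "\<And>bs t c'. comp_path M c bs t c' \<Longrightarrow> halted M c' \<Longrightarrow> length bs = n"
    and "length bs = n"
  shows "\<exists>t\<le>T. \<exists>c'. comp_path M c bs t c' \<and> halted M c'"
proof -
  obtain k t c' where k: "k \<le> length (bs @ replicate T True)" "t \<le> T"
    and p: "comp_path M c (take k (bs @ replicate T True)) t c'" and h: "halted M c'"
    using halting_prefix_exists[OF assms(1), of "bs @ replicate T True"] by auto
  have "length (take k (bs @ replicate T True)) = n"
    using assms(2)[OF p h] .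
  then have "take k (bs @ replicate T True) = bs" using k(1) assms(3) by auto
  then show ?thesis using p h k(2) by metis
qed

text \<open>\<open>outcome\<close> refers to the least time bound; this allows any known bound in
  its place.\<close>

lemma run_stable:
  assumes "halts_within M c T" "T \<le> T'"
  shows "run M T' c = run M T c"
  using assms
proof (induction T arbitrary: c T')
  case 0
  have "halted M c"
    using halting_prefix_exists[OF "0"(1), of "[]"] by (auto elim: comp_path.cases)
  then show ?case by (cases T') auto
next
  case (Suc T)
  obtain T'' where T'': "T' = Suc T''" "T \<le> T''"
    using Suc.prems(2) by (cases T') auto
  show ?case
  proof (cases "halted M c")
    case True
    then show ?thesis by (simp add: T'')
  next
    case nh: False
    have *: "halts_within M (apply_action a c) T"
      if "comp_path M c bs 1 (apply_action a c)" for a bs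
      unfolding halts_within_def
    proof (intro allI impI)
      fix bs' t c' assume "comp_path M (apply_action a c) bs' t c'"
      from comp_path_trans[OF that this] have "1 + t \<le> Suc T"
        using Suc.prems(1) unfolding halts_within_def by blast
      then show "t \<le> T" by simp
    qed
    show ?thesis
    proof (cases "transition_at M c")
      case (Det a)
      have "comp_path M c [] 1 (apply_action a c)"
        using nh Det by (auto simp: comp_path_det intro: comp_path.refl)
      from Suc.IH[OF *[OF this] T''(2)] show ?thesis by (simp add: T'' nh Det)
    next
      case (Choice a0 a1)
      have "comp_path M c [b] 1 (apply_action (if b then a1 else a0) c)" for b
        using nh Choice by (auto simp: comp_path_choice intro: comp_path.refl)
      from Suc.IH[OF *[OF this] T''(2)] show ?thesis by (simp add: T'' nh Choice)
    qed
  qed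
qed

lemma outcome_eq_run:
  assumes "halts_within M c T"
  shows "outcome M c = run M T c"
  unfolding outcome_def
  by (rule run_stable[symmetric]) (use assms in \<open>auto intro: LeastI Least_le\<close>)

section \<open>Uniform bit strings and the binomial distribution\<close>

lemma finite_bit_lists: "finite {bs :: bool list. length bs = n}"
  using finite_lists_length_eq[of "UNIV :: bool set" n] by simp

lemma card_bit_lists: "card {bs :: bool list. length bs = n} = 2 ^ n"
  using card_lists_length_eq[of "UNIV :: bool set" n] by simp

lemma pmf_bits: "pmf (bits n) bs = (if length bs = n then 1 / 2 ^ n else 0)"
proof (induction n arbitrary: bs)
  case 0
  then show ?case by (auto simp: pmf_return indicator_def)
next
  case (Suc n)
  show ?case
  proof (cases bs)
    case Nil
    have "pmf (map_pmf ((#) b) (bits n)) [] = 0" for b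
      by (auto simp: pmf_eq_0_set_pmf)
    then show ?thesis by (simp add: pmf_bind Nil)
  next
    case (Cons b bs')
    have "pmf (map_pmf ((#) c) (bits n)) (b # bs') = (if c = b then pmf (bits n) bs' else 0)" for c
      by (auto simp: pmf_map_inj' pmf_eq_0_set_pmf)
    then show ?thesis by (cases b) (simp_all add: pmf_bind Cons Suc)
  qed
qed

lemma set_bits: "set_pmf (bits n) = {bs. length bs = n}"
  by (auto simp: set_pmf_eq pmf_bits)

lemma prob_bits: "measure_pmf.prob (bits n) A = card {bs \<in> A. length bs = n} / 2 ^ n"
proof -
  have "bits n = pmf_of_set {bs. length bs = n}"
    by (rule pmf_eqI)
       (subst pmf_of_set, auto simp: pmf_bits finite_bit_lists card_bit_lists indicator_def Ex_list_of_length)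
  then show ?thesis
    using card_bit_lists[of n]
    by (simp add: measure_pmf_of_set finite_bit_lists Ex_list_of_length Int_def conj_commute)
qed

lemma bits_add: "bits (m + n) = bind_pmf (bits m) (\<lambda>u. map_pmf ((@) u) (bits n))"
proof (induction m)
  case 0
  have "(@) [] = (id :: bool list \<Rightarrow> bool list)" by auto
  then show ?case by (simp add: bind_return_pmf)
next
  case (Suc m)
  have "(@) (b # u) = (\<lambda>v :: bool list. b # u @ v)" for b u by auto
  then show ?case
    by (simp add: Suc bind_assoc_pmf map_bind_pmf bind_map_pmf pmf.map_comp o_def)
qed

text \<open>The string is cut into \<open>k\<close> blocks of \<open>p\<close> bits, one per run of
  a machine; with \<open>A\<close> the accepting choice strings this counts the accepting
  runs.\<close>

fun hits :: "bool list set \<Rightarrow> nat \<Rightarrow> nat \<Rightarrow> bool list \<Rightarrow> nat" where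
  "hits A p 0 bs = 0"
| "hits A p (Suc k) bs = of_bool (take p bs \<in> A) + hits A p k (drop p bs)"

lemma map_bits_bernoulli:
  "map_pmf (\<lambda>u. u \<in> A) (bits p) = bernoulli_pmf (card {bs \<in> A. length bs = p} / 2 ^ p)"
    (is "?l = bernoulli_pmf ?q")
proof -
  have q: "0 \<le> ?q" "?q \<le> 1"
    unfolding prob_bits[symmetric] by auto
  have T: "pmf ?l True = ?q"
    by (simp add: pmf_map vimage_def prob_bits)
  have "pmf ?l False = 1 - ?q"
  proof -
    have "pmf ?l False = measure_pmf.prob (bits p) (UNIV - A)"
      by (simp add: pmf_map vimage_def Compl_eq_Diff_UNIV[symmetric] Compl_eq)
    also have "\<dots> = 1 - ?q"
      by (subst measure_pmf.prob_compl[of A, simplified]) (simp_all add: prob_bits)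
    finally show ?thesis .
  qed
  then show ?thesis
    using T q by (intro pmf_eqI) (case_tac i, simp_all)
qed

text \<open>Disjoint blocks of a uniform string are independent, and each lies in \<open>A\<close>
  with the same probability.\<close>

lemma hits_binomial:
  "map_pmf (hits A p k) (bits (k * p)) = binomial_pmf k (card {bs \<in> A. length bs = p} / 2 ^ p)"
    (is "_ = binomial_pmf k ?q")
proof (induction k)
  case 0
  have "hits A p 0 = (\<lambda>_. 0)" by auto
  then show ?case by (simp add: prob_bits[symmetric] binomial_pmf_0)
next
  case (Suc k)
  have q: "?q \<in> {0..1}"
    unfolding prob_bits[symmetric] by auto
  have "map_pmf (hits A p (Suc k)) (bits (Suc k * p)) =
      bind_pmf (bits p) (\<lambda>u. map_pmf (\<lambda>v. hits A p (Suc k) (u @ v)) (bits (k * p)))"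
    by (simp add: bits_add map_bind_pmf pmf.map_comp o_def)
  also have "\<dots> = bind_pmf (bits p) (\<lambda>u. map_pmf (\<lambda>v. of_bool (u \<in> A) + hits A p k v) (bits (k * p)))"
    by (intro bind_pmf_cong HOL.refl map_pmf_cong) (auto simp: set_bits)
  also have "\<dots> = bind_pmf (map_pmf (\<lambda>u. u \<in> A) (bits p))
      (\<lambda>b. map_pmf (\<lambda>j. of_bool b + j) (map_pmf (hits A p k) (bits (k * p))))"
    by (simp add: bind_map_pmf pmf.map_comp o_def)
  also have "\<dots> = binomial_pmf (Suc k) ?q"
    unfolding map_bits_bernoulli Suc binomial_pmf_Suc[OF q]
    by (simp add: map_pmf_def of_bool_def cong: bind_pmf_cong)
  finally show ?case .
qed

section \<open>Renaming states to natural numbers\<close>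

instance sym :: (countable) countable by countable_datatype
instance dir :: countable by countable_datatype

text \<open>The classes refer to machines whose states are natural numbers, whereas the machines
  built below have structured states. As \<open>to_nat\<close> is injective, the renaming preserves
  paths and halting; tapes are not touched.\<close>

definition enc_tm :: "('q::countable, 'a) tm \<Rightarrow> (nat, 'a) tm" where
  "enc_tm M = \<lparr>tapes = tapes M, states = to_nat ` states M, alphabet = alphabet M,
     start = to_nat (start M), accept = to_nat (accept M), reject = to_nat (reject M),
     delta = (\<lambda>q ss. map_transition to_nat id (delta M (from_nat q) ss))\<rparr>"

lemma halted_enc: "halted (enc_tm M) (to_nat q, ts) \<longleftrightarrow> halted M (q, ts)"
  by (simp add: halted_def enc_tm_def)

lemma transition_at_enc:
  "transition_at (enc_tm M) (to_nat q, ts) = map_transition to_nat id (transition_at M (q, ts))"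
  by (simp add: transition_at_def enc_tm_def)

lemma comp_path_enc:
  "comp_path M c bs t c' \<Longrightarrow>
    comp_path (enc_tm M) (to_nat (fst c), snd c) bs t (to_nat (fst c'), snd c')"
proof (induction rule: comp_path.induct)
  case (refl c)
  then show ?case by (rule comp_path.refl)
next
  case (det c a bs t c')
  have *: "apply_action (map_prod to_nat (map (map_prod (map_sym id) id)) a) (to_nat (fst c), snd c) =
      (to_nat (fst (apply_action a c)), snd (apply_action a c))"
    by (cases a, cases c) (simp add: sym.map_id0 map_prod.id)
  show ?case
    apply (rule comp_path.det)
    using det.hyps halted_enc[of M "fst c" "snd c"] transition_at_enc[of M "fst c" "snd c"] apply auto[2]
    using det.IH * by simp
next
  case (choice c a0 a1 b bs t c')
  have *: "apply_action (map_prod to_nat (map (map_prod (map_sym id) id)) a) (to_nat (fst c), snd c) =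
      (to_nat (fst (apply_action a c)), snd (apply_action a c))" for a
    by (cases a, cases c) (simp add: sym.map_id0 map_prod.id)
  show ?case
    apply (rule comp_path.choice)
    using choice.hyps halted_enc[of M "fst c" "snd c"] transition_at_enc[of M "fst c" "snd c"] apply auto[2]
    using choice.IH * by (cases b) simp_all
qed

lemma enc_paths:
  assumes "\<exists>t\<le>T. comp_path M c bs t c' \<and> halted M c'"
  shows "\<exists>t\<le>T. comp_path (enc_tm M) (to_nat (fst c), snd c) bs t (to_nat (fst c'), snd c') \<and>
    halted (enc_tm M) (to_nat (fst c'), snd c')"
  using assms comp_path_enc[of M c bs _ c'] by (auto simp: halted_enc)

lemma wf_enc:
  assumes "wf_tm M"
  shows "wf_tm (enc_tm M)"
proof -
  have *: "\<exists>a\<in>actions tr. a' = map_prod to_nat id a"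
    if "a' \<in> actions (map_transition to_nat id tr)" for a' and tr :: "('a, 'b) transition"
    using that by (cases tr) (auto simp: sym.map_id0 map_prod.id)
  show ?thesis
    using assms unfolding wf_tm_def
    apply (auto simp: enc_tm_def)
    apply (drule *, fastforce)+
    done
qed

section \<open>Tapes\<close>

text \<open>\<open>zt h L R\<close> is a tape with head at cell \<open>h\<close>: \<open>R\<close> lists the cells from the head to the
  right, \<open>L\<close> those left of the head, nearest first, and all other cells are blank.\<close>

definition cells :: "'a sym list \<Rightarrow> nat \<Rightarrow> 'a sym" where
  "cells w i = (if i < length w then w ! i else Blank)"

definition zt :: "int \<Rightarrow> 'a sym list \<Rightarrow> 'a sym list \<Rightarrow> 'a tape" where
  "zt h L R = (\<lambda>i. if h \<le> i then cells R (nat (i - h)) else cells L (nat (h - 1 - i)), h)"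

definition hdb :: "'a sym list \<Rightarrow> 'a sym" where
  "hdb w = (case w of [] \<Rightarrow> Blank | s # _ \<Rightarrow> s)"

lemma hdb_simps [simp]: "hdb [] = Blank" "hdb (s # w) = s"
  by (simp_all add: hdb_def)

definition scan :: "'a tape \<Rightarrow> 'a sym" where
  "scan t = fst t (snd t)"

lemma cells_Cons: "cells (s # w) i = (if i = 0 then s else cells w (i - 1))"
  by (auto simp: cells_def nth_Cons')

lemma cells_Nil [simp]: "cells [] i = Blank"
  by (simp add: cells_def)

lemma cells_tl: "cells (tl w) i = cells w (Suc i)"
  by (auto simp: cells_def nth_tl)

lemma cells_0: "cells w 0 = hdb w"
  by (cases w) (auto simp: cells_def)

lemma cells_snoc_Blank [simp]: "cells (w @ [Blank]) = cells w"
  by (auto simp: cells_def nth_append)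

lemma scan_zt [simp]: "scan (zt h L R) = hdb R"
  by (simp add: scan_def zt_def cells_0)

lemma act_zt:
  "act_tape (s, Stay) (zt h L R) = zt h L (s # tl R)"
  "act_tape (s, Move_R) (zt h L R) = zt (h + 1) (s # L) (tl R)"
  "act_tape (s, Move_L) (zt h L R) = zt (h - 1) (tl L) (hdb L # s # tl R)"
  by (auto simp: zt_def cells_Cons cells_tl cells_0[symmetric] fun_eq_iff nat_diff_distrib
      intro!: arg_cong[where f = "cells _"])

lemma zt_snoc_Blank: "zt h L (R @ [Blank]) = zt h L R" "zt h (L @ [Blank]) R = zt h L R"
  by (auto simp: zt_def)

lemma zt_Blank [simp]:
  "zt h L [Blank] = zt h L []" "zt h [Blank] R = zt h [] R" "zt h L [s, Blank] = zt h L [s]"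
  using zt_snoc_Blank[of h L "[]"] zt_snoc_Blank(2)[of h "[]" R] zt_snoc_Blank[of h L "[s]"] by auto

definition stay :: "'a sym \<Rightarrow> 'a sym \<times> dir" where
  "stay s = (s, Stay)"

lemma act_stay_scan [simp]: "act_tape (stay (scan t)) t = t"
  by (cases t) (simp add: stay_def scan_def)

lemma act_move_scan: "act_tape (scan t, Move_R) t = (fst t, snd t + 1)"
  by (cases t) (simp add: scan_def)

lemma map2_act_stay_scan [simp]: "map2 act_tape (map stay (map scan ts)) ts = ts"
  by (induction ts) simp_all

lemma transition_at_scan: "transition_at M (q, ts) = delta M q (map scan ts)"
proof -
  have "map (\<lambda>(t, h). t h) ts = map scan ts" by (auto simp: scan_def)
  then show ?thesis by (simp only: transition_at_def fst_conv snd_conv)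
qed

lemma wf_tm_action:
  assumes "wf_tm M" "q \<in> states M" "length ss = tapes M" "set ss \<subseteq> alphabet M"
    "(q', as) \<in> actions (delta M q ss)"
  shows "q' \<in> states M \<and> length as = tapes M \<and> fst ` set as \<subseteq> alphabet M"
  using assms unfolding wf_tm_def by (auto 0 3 dest!: bspec)

text \<open>The invariant under which the guards of \<open>phase_step\<close> and
  \<open>stage_step\<close> succeed: both consult \<open>delta M\<close> only at a state and symbols
  of \<open>M\<close>, since it is arbitrary elsewhere.\<close>

definition config_ok :: "('q, 'a) tm \<Rightarrow> ('q, 'a) config \<Rightarrow> bool" where
  "config_ok M c \<longleftrightarrow> fst c \<in> states M \<and> length (snd c) = tapes M \<and>
     (\<forall>t \<in> set (snd c). range (fst t) \<subseteq> alphabet M)"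

lemma config_ok_scan: "config_ok M c \<Longrightarrow> set (map scan (snd c)) \<subseteq> alphabet M"
  by (auto simp: config_ok_def scan_def)

lemma config_ok_action:
  assumes "wf_tm M" "config_ok M c" "a \<in> actions (transition_at M c)"
  shows "config_ok M (apply_action a c)" "length (snd a) = length (snd c)"
    "fst a \<in> states M" "fst ` set (snd a) \<subseteq> alphabet M"
proof -
  obtain q ts q' as where c: "c = (q, ts)" and a: "a = (q', as)" by (cases c, cases a)
  have *: "q' \<in> states M \<and> length as = tapes M \<and> fst ` set as \<subseteq> alphabet M"
    using wf_tm_action[OF assms(1), of q "map scan ts" q' as] assms config_ok_scan[OF assms(2)]
    by (auto simp: c a transition_at_scan config_ok_def)
  have **: "range (fst (act_tape x t)) \<subseteq> alphabet M" if "(x, t) \<in> set (zip as ts)" for x t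
  proof -
    have "fst x \<in> alphabet M" using that * by (auto dest: set_zip_leftD)
    moreover have "range (fst t) \<subseteq> alphabet M"
      using that assms(2) by (auto simp: config_ok_def c dest: set_zip_rightD)
    ultimately show ?thesis by (cases x, cases t) auto
  qed
  have "\<forall>t \<in> set (map2 act_tape as ts). range (fst t) \<subseteq> alphabet M"
  proof
    fix t assume "t \<in> set (map2 act_tape as ts)"
    then obtain x t' where "(x, t') \<in> set (zip as ts)" "t = act_tape x t'"
      by (auto simp del: act_tape.simps)
    then show "range (fst t) \<subseteq> alphabet M" using ** by simp
  qed
  then show "config_ok M (apply_action a c)"
    using * assms(2) by (auto simp: config_ok_def c a simp del: act_tape.simps)
  show "length (snd a) = length (snd c)" "fst a \<in> states M" "fst ` set (snd a) \<subseteq> alphabet M"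
    using * assms(2) by (auto simp: c a config_ok_def)
qed

lemma word_tape_alphabet:
  assumes "wf_tm M"
  shows "word_tape (map Bit x) i \<in> alphabet M"
proof -
  have "Bit b \<in> alphabet M" "Blank \<in> alphabet M" for b
    using assms by (cases b; auto simp: wf_tm_def)+
  then show ?thesis by (auto simp: word_tape_def)
qed

lemma real_tape_alphabet:
  assumes "wf_tm M"
  shows "real_tape r i \<in> alphabet M"
proof -
  have "Bit b \<in> alphabet M" "Blank \<in> alphabet M" "Point \<in> alphabet M" for b
    using assms by (cases b; auto simp: wf_tm_def)+
  then show ?thesis by (auto simp: real_tape_def Let_def)
qed

lemma config_ok_init:
  assumes "wf_tm M" "length ins \<le> tapes M" "\<And>t i. t \<in> set ins \<Longrightarrow> t i \<in> alphabet M"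
  shows "config_ok M (init_config M ins)"
proof -
  have "Blank \<in> alphabet M" "start M \<in> states M" using assms(1) by (auto simp: wf_tm_def)
  then show ?thesis using assms(2,3) by (auto simp: config_ok_def init_config_def)
qed

declare act_tape.simps [simp del]

lemma act_stay_Blank [simp]: "act_tape (stay Blank) (zt h L []) = zt h L []"
  by (simp add: stay_def act_zt)

lemma zt_blank: "zt h [] [] = (\<lambda>_. Blank, h)"
  by (auto simp: zt_def)

text \<open>A time bound \<open>P\<close> need not be monotone, but the dominating function is;
  hence an upper bound \<open>y\<close> may replace the argument \<open>u\<close>.\<close>

lemma poly_growth:
  fixes P :: "real poly"
  shows "\<exists>C e. C \<ge> 0 \<and> (\<forall>u y. 0 \<le> u \<longrightarrow> u \<le> y \<longrightarrow> poly P u \<le> C * (1 + y) ^ e)"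
proof -
  have "\<exists>C e. C \<ge> 0 \<and> (\<forall>u y. 0 \<le> u \<longrightarrow> u \<le> y \<longrightarrow> \<bar>poly P u\<bar> \<le> C * (1 + y) ^ e)"
  proof (induction P)
    case 0
    show ?case by (intro exI[of _ 0]) auto
  next
    case (pCons a P)
    then obtain C e where C: "C \<ge> 0" "\<And>u y. 0 \<le> u \<Longrightarrow> u \<le> y \<Longrightarrow> \<bar>poly P u\<bar> \<le> C * (1 + y) ^ e"
      by blast
    have "\<bar>poly (pCons a P) u\<bar> \<le> (\<bar>a\<bar> + C) * (1 + y) ^ Suc e" if "0 \<le> u" "u \<le> y" for u y
    proof -
      have "\<bar>poly (pCons a P) u\<bar> \<le> \<bar>a\<bar> + u * \<bar>poly P u\<bar>"
        using that by (simp add: abs_mult abs_triangle_ineq[THEN order_trans])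
      also have "\<dots> \<le> \<bar>a\<bar> * (1 + y) ^ Suc e + (1 + y) * (C * (1 + y) ^ e)"
      proof (rule add_mono)
        show "\<bar>a\<bar> \<le> \<bar>a\<bar> * (1 + y) ^ Suc e"
          using that mult_left_mono[of 1 "(1 + y) ^ Suc e" "\<bar>a\<bar>"] one_le_power[of "1 + y" "Suc e"] by simp
        show "u * \<bar>poly P u\<bar> \<le> (1 + y) * (C * (1 + y) ^ e)"
          using that C by (intro mult_mono) auto
      qed
      finally show ?thesis by (simp add: algebra_simps)
    qed
    then show ?case using C(1) by (intro exI[of _ "\<bar>a\<bar> + C"] exI[of _ "Suc e"]) auto
  qed
  then show ?thesis by (meson abs_le_D1)
qed

abbreviation keep :: "'a tape \<Rightarrow> 'a sym \<times> dir" where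
  "keep t \<equiv> stay (scan t)"

abbreviation idle :: "'a tape list \<Rightarrow> ('a sym \<times> dir) list" where
  "idle ts \<equiv> map stay (map scan ts)"

section \<open>The sampling machine\<close>

text \<open>The tape order of the sampler: tape 0 is the input and also tape 0 of \<open>M\<close>;
  the inserted tapes hold \<epsilon> (1), \<delta> (2) and the result (3), as
  \<open>approx_config\<close> and \<open>returns\<close> prescribe, then the log (4) and the
  counter (5). The other tapes of \<open>M\<close> come last.\<close>

definition pack :: "'x list \<Rightarrow> 'x list \<Rightarrow> 'x list" where
  "pack ms u = hd ms # u @ tl ms"

lemma map2_pack:
  assumes "length as = length ms" "length au = length u" "ms \<noteq> []"
  shows "map2 f (pack as au) (pack ms u) = pack (map2 f as ms) (map2 f au u)"
  using assms by (cases as; cases ms) (simp_all add: pack_def zip_append)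

lemma length_pack: "ms \<noteq> [] \<Longrightarrow> length (pack ms u) = length ms + length u"
  by (cases ms) (simp_all add: pack_def)

lemma set_pack: "ms \<noteq> [] \<Longrightarrow> set (pack ms u) = set ms \<union> set u"
  by (cases ms) (auto simp: pack_def)

text \<open>A log entry records for every tape of the simulated machine the symbol it overwrote and the
  direction in which it moved.\<close>

type_synonym entry = "(nat sym \<times> dir) list"

text \<open>Codes may coincide with symbols of \<open>M\<close> or with codes of digits. This is
  harmless, as log and counter have tapes of their own.\<close>

definition ent :: "entry \<Rightarrow> nat sym" where
  "ent e = Aux (to_nat e)"

definition dec_ent :: "nat sym \<Rightarrow> entry" where
  "dec_ent s = (case s of Aux n \<Rightarrow> from_nat n | _ \<Rightarrow> [])"

lemma dec_ent [simp]: "dec_ent (ent e) = e" and ent_not_Blank [simp]: "ent e \<noteq> Blank"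
  by (simp_all add: ent_def dec_ent_def)

text \<open>A counter cell \<open>(x, d, m)\<close> holds a digit of the number of accepting runs, a digit of the
  number of all runs, and a mark of the cells whose overflow advances the head on the tape
  of \<open>\<delta>\<close>.\<close>

type_synonym digit = "bool \<times> bool \<times> bool"

definition dig :: "digit \<Rightarrow> nat sym" where
  "dig a = Aux (to_nat a)"

text \<open>By the default value a blank cell counts as an unmarked zero, so a carry past the left
  end creates a new digit.\<close>

definition dec_dig :: "nat sym \<Rightarrow> digit" where
  "dec_dig s = (case s of Aux n \<Rightarrow> from_nat n | _ \<Rightarrow> (False, False, False))"

lemma dec_dig [simp]: "dec_dig (dig a) = a" "dec_dig Blank = (False, False, False)"
  and dig_not_Blank [simp]: "dig a \<noteq> Blank"
  by (simp_all add: dig_def dec_dig_def)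

text \<open>The flag of \<open>Ret\<close> tells whether the marked digits have overflowed.
  \<open>Sim\<close> carries a flag for the final, printing run and the state of \<open>M\<close>.
  The flag of \<open>Undo1\<close> and \<open>Undo2\<close> is the verdict of the run; those of
  \<open>Inc\<close> are the carries of the two counts and the overflow so far.
  \<open>Left_End\<close> and \<open>Print\<close> treat the count of accepting runs under
  \<open>False\<close> and that of all runs under \<open>True\<close>.\<close>

datatype phase =
    Setup1 | Setup2 | Ret bool | Sim bool nat | Undo1 bool | Undo2 bool
  | Inc bool bool bool | Left_End bool | Print bool | Accept | Reject

instance phase :: countable by countable_datatype

fun rdir :: "dir \<Rightarrow> dir" where
  "rdir Move_L = Move_R"
| "rdir Stay = Stay"
| "rdir Move_R = Move_L"

definition valid_entry :: "(nat, nat) tm \<Rightarrow> entry \<Rightarrow> bool" where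
  "valid_entry M e \<longleftrightarrow> length e = tapes M \<and> fst ` set e \<subseteq> alphabet M"

fun sim_action :: "bool \<Rightarrow> bool \<Rightarrow> nat sym list \<Rightarrow> nat sym list \<Rightarrow> (nat, nat) action \<Rightarrow> (phase, nat) action" where
  "sim_action pr print sm [e, d, r, l, c] (q, as) =
    (Sim pr q, pack as [stay e, stay d, if print then (Bit False, Move_R) else stay r,
       (ent (zip sm (map snd as)), Move_R), stay c])"
| "sim_action pr print sm _ (q, as) = (Reject, [])"

text \<open>\<open>wf_tm\<close> speaks about all states and scanned symbols, reachable or not; the
  guards that lead to \<open>Reject\<close> keep the actions well formed there. An action writes
  before it moves, so undoing one takes two steps: move back, then write the old symbol.\<close>

definition phase_step ::
  "(nat, nat) tm \<Rightarrow> phase \<Rightarrow> nat sym list \<Rightarrow> nat sym \<Rightarrow> nat sym \<Rightarrow> nat sym \<Rightarrow> nat sym \<Rightarrow> nat sym \<Rightarrow>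
    (phase, nat) transition" where
  "phase_step M st sm e d r l c = (case st of
     Setup1 \<Rightarrow> Det (Setup2, pack (map stay sm)
       [stay e, stay d, stay r, stay l, (dig (False, False, True), Move_L)])
   | Setup2 \<Rightarrow>
       if e = Bit True then Det (Ret False, pack (map stay sm)
         [stay e, stay d, stay r, stay l, (dig (False, False, True), Stay)])
       else Det (Setup1, pack (map stay sm)
         [(e, Move_R), stay d, stay r, stay l, (dig (False, False, True), Move_L)])
   | Ret ov \<Rightarrow>
       if c \<noteq> Blank then Det (Ret ov, pack (map stay sm)
         [stay e, stay d, stay r, stay l, (c, Move_R)])
       else if ov \<and> d = Bit True then Det (Left_End False, pack (map stay sm)
         [stay e, stay d, stay r, stay l, (Blank, Move_L)])
       else Det (Sim False (start M), pack (map stay sm)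
         [stay e, if ov then (d, Move_R) else stay d, stay r, stay l, (Blank, Move_L)])
   | Sim pr q \<Rightarrow>
       if q = accept M \<or> q = reject M then
         if pr then Det (Left_End True, pack (map stay sm)
           [stay e, stay d, (Slash, Move_R), stay l, (c, Move_L)])
         else Det (Undo1 (q = accept M), pack (map stay sm)
           [stay e, stay d, stay r, (l, Move_L), stay c])
       else if q \<in> states M \<and> set sm \<subseteq> alphabet M then
         (case delta M q sm of
            Det a \<Rightarrow> Det (sim_action pr False sm [e, d, r, l, c] a)
          | Choice a0 a1 \<Rightarrow> Choice (sim_action pr pr sm [e, d, r, l, c] a0)
              (sim_action pr pr sm [e, d, r, l, c] a1))
       else Det (Reject, pack (map stay sm) [stay e, stay d, stay r, stay l, stay c])
   | Undo1 a \<Rightarrow>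
       if l = Blank then Det (Inc a True False, pack (map stay sm)
         [stay e, stay d, stay r, (Blank, Move_R), stay c])
       else if valid_entry M (dec_ent l) then Det (Undo2 a, pack (zip sm (map (rdir \<circ> snd) (dec_ent l)))
         [stay e, stay d, stay r, stay l, stay c])
       else Det (Reject, pack (map stay sm) [stay e, stay d, stay r, stay l, stay c])
   | Undo2 a \<Rightarrow>
       if valid_entry M (dec_ent l) then Det (Undo1 a, pack (map (stay \<circ> fst) (dec_ent l))
         [stay e, stay d, stay r, (Blank, Move_L), stay c])
       else Det (Reject, pack (map stay sm) [stay e, stay d, stay r, stay l, stay c])
   | Inc cx cd ov \<Rightarrow>
       if \<not> cx \<and> \<not> cd then Det (Ret ov, pack (map stay sm)
         [stay e, stay d, stay r, stay l, (c, Move_R)])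
       else (case dec_dig c of (x, y, m) \<Rightarrow>
         Det (Inc (x \<and> cx) (y \<and> cd) (ov \<or> cd \<and> \<not> m), pack (map stay sm)
           [stay e, stay d, stay r, stay l, (dig (x \<noteq> cx, y \<noteq> cd, m), Move_L)]))
   | Left_End f \<Rightarrow>
       if c \<noteq> Blank then Det (Left_End f, pack (map stay sm)
         [stay e, stay d, stay r, stay l, (c, Move_L)])
       else Det (Print f, pack (map stay sm)
         [stay e, stay d, stay r, stay l, (Blank, Move_R)])
   | Print f \<Rightarrow>
       if c \<noteq> Blank then Det (Print f, pack (map stay sm)
         [stay e, stay d, (Bit (if f then fst (snd (dec_dig c)) else fst (dec_dig c)), Move_R), stay l,
          (c, Move_R)])
       else Det (if f then Accept else Sim True (start M), pack (map stay sm)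
         [stay e, stay d, stay r, stay l, stay c])
   | _ \<Rightarrow> Det (Reject, pack (map stay sm) [stay e, stay d, stay r, stay l, stay c]))"

definition sampler :: "(nat, nat) tm \<Rightarrow> (phase, nat) tm" where
  "sampler M = \<lparr>tapes = tapes M + 5,
     states = {Setup1, Setup2, Accept, Reject} \<union> range Ret \<union> case_prod Sim ` (UNIV \<times> states M) \<union>
       range Undo1 \<union> range Undo2 \<union> (\<Union>cx cd. range (Inc cx cd)) \<union> range Left_End \<union> range Print,
     alphabet = alphabet M \<union> ent ` {e. valid_entry M e} \<union> range dig,
     start = Setup1, accept = Accept, reject = Reject,
     delta = (\<lambda>st ss. phase_step M st (hd ss # drop 6 ss) (ss ! 1) (ss ! 2) (ss ! 3) (ss ! 4) (ss ! 5))\<rparr>"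

lemma sampler_sel:
  "accept (sampler M) = Accept" "reject (sampler M) = Reject" "start (sampler M) = Setup1"
  "tapes (sampler M) = tapes M + 5"
  by (simp_all add: sampler_def)

lemma finite_valid_entries:
  assumes "finite (alphabet M)"
  shows "finite {e. valid_entry M e}"
proof -
  have "(UNIV :: dir set) = {Move_L, Stay, Move_R}"
    using dir.exhaust by auto
  then have "finite (UNIV :: dir set)" by (metis finite.emptyI finite.insertI)
  then have "finite {e. set e \<subseteq> alphabet M \<times> (UNIV :: dir set) \<and> length e = tapes M}"
    using assms by (intro finite_lists_length_eq) simp
  then show ?thesis
    by (rule rev_finite_subset) (auto simp: valid_entry_def)
qed

lemma wf_sampler:
  assumes wf: "wf_tm M" and m: "tapes M \<ge> 1"
  shows "wf_tm (sampler M)"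
proof -
  let ?N = "sampler M"
  have fin: "finite (states M)" "finite (alphabet M)" and st: "{start M, accept M, reject M} \<subseteq> states M"
    and syms: "{Blank, Bit False, Bit True, Point, Slash} \<subseteq> alphabet M"
    and M: "\<And>q ss q' as. q \<in> states M \<Longrightarrow> length ss = tapes M \<Longrightarrow> set ss \<subseteq> alphabet M \<Longrightarrow>
      (q', as) \<in> actions (delta M q ss) \<Longrightarrow> q' \<in> states M \<and> length as = tapes M \<and> fst ` set as \<subseteq> alphabet M"
    using wf wf_tm_action[OF wf] by (auto simp: wf_tm_def)
  let ?A = "alphabet ?N" and ?Q = "states ?N"
  have finite: "finite ?Q" "finite ?A"
    using fin finite_valid_entries[OF fin(2)] by (auto simp: sampler_def)
  have A: "alphabet M \<subseteq> ?A" "\<And>a. dig a \<in> ?A" "\<And>e. valid_entry M e \<Longrightarrow> ent e \<in> ?A"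
    by (auto simp: sampler_def)
  have B: "Blank \<in> ?A" "Bit b \<in> ?A" "Slash \<in> ?A" "Point \<in> ?A" for b
    using A(1) syms by (cases b; auto)+
  have Q: "Setup1 \<in> ?Q" "Setup2 \<in> ?Q" "Accept \<in> ?Q" "Reject \<in> ?Q" "Ret b \<in> ?Q" "Undo1 b \<in> ?Q"
    "Undo2 b \<in> ?Q" "Inc b b' b'' \<in> ?Q" "Left_End b \<in> ?Q" "Print b \<in> ?Q"
    "Sim b (start M) \<in> ?Q" for b b' b''
    using st by (auto simp: sampler_def image_iff)
  define G where "G acts \<longleftrightarrow> length acts = tapes M + 5 \<and> fst ` set acts \<subseteq> ?A" for acts :: "(nat sym \<times> dir) list"
  have G: "G (pack am [ae, ad, ar, al, ac])"
    if "length am = tapes M" "fst ` set am \<subseteq> ?A" "fst ae \<in> ?A" "fst ad \<in> ?A" "fst ar \<in> ?A"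
      "fst al \<in> ?A" "fst ac \<in> ?A" for am ae ad ar al ac
  proof -
    have "am \<noteq> []" using that m by auto
    then show ?thesis using that by (auto simp: length_pack set_pack G_def)
  qed
  have good: "st' \<in> ?Q \<and> G acts"
    if sm: "length sm = tapes M" "set sm \<subseteq> ?A" and u: "set [e, d, r, l, c] \<subseteq> ?A" and "st \<in> ?Q"
      and act: "(st', acts) \<in> actions (phase_step M st sm e d r l c)" for sm e d r l c st st' acts
  proof -
    have simp_stay: "fst (stay s) = s" for s by (simp add: stay_def)
    have "fst ` set (map stay sm) \<subseteq> ?A"
      using sm by (auto simp: simp_stay)
    then have stays: "G (pack (map stay sm) [ae, ad, ar, al, ac])"
      if "fst ae \<in> ?A" "fst ad \<in> ?A" "fst ar \<in> ?A" "fst al \<in> ?A" "fst ac \<in> ?A" for ae ad ar al ac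
      using that sm by (intro G) simp_all
    have u': "e \<in> ?A" "d \<in> ?A" "r \<in> ?A" "l \<in> ?A" "c \<in> ?A" using u by auto
    note rules = stays u' A B Q simp_stay
    show ?thesis
    proof (cases st)
      case (Sim pr q)
      show ?thesis
      proof (cases "\<not> (q = accept M \<or> q = reject M) \<and> q \<in> states M \<and> set sm \<subseteq> alphabet M")
        case True
        have sa: "st' \<in> ?Q \<and> G acts"
          if "a \<in> actions (delta M q sm)" "(st', acts) = sim_action pr print sm [e, d, r, l, c] a"
          for a print
        proof -
          obtain q' as where a: "a = (q', as)" by (cases a)
          then have as: "q' \<in> states M" "length as = tapes M" "fst ` set as \<subseteq> alphabet M"
            using M[of q sm q' as] that sm True by auto
          have "valid_entry M (zip sm (map snd as))"
            using as sm True by (auto simp: valid_entry_def dest: set_zip_leftD)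
          moreover have "Sim pr q' \<in> ?Q" using as by (auto simp: sampler_def)
          moreover have "fst ` set as \<subseteq> ?A" using as A(1) by blast
          ultimately show ?thesis
            using that(2) as(2) u' A(3) B by (simp add: a simp_stay G)
        qed
        have "\<exists>a \<in> actions (delta M q sm). \<exists>print.
            (st', acts) = sim_action pr print sm [e, d, r, l, c] a"
          using act True unfolding Sim phase_step_def
          by (cases "delta M q sm") (auto simp del: sim_action.simps)
        then show ?thesis using sa by blast
      next
        case False
        then show ?thesis
          using act unfolding Sim phase_step_def by (auto simp: rules split: if_splits)
      qed
    next
      case (Undo1 a)
      have "G (pack (zip sm (map (rdir \<circ> snd) (dec_ent l))) [stay e, stay d, stay r, stay l, stay c])"
        if "valid_entry M (dec_ent l)"
        using that sm u' by (intro G) (auto simp: valid_entry_def simp_stay dest: set_zip_leftD)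
      then show ?thesis
        using act unfolding Undo1 phase_step_def by (auto simp: rules split: if_splits)
    next
      case (Undo2 a)
      have "G (pack (map (stay \<circ> fst) (dec_ent l)) [stay e, stay d, stay r, (Blank, Move_L), stay c])"
        if "valid_entry M (dec_ent l)"
        using that A(1) B u' by (intro G) (auto simp: valid_entry_def simp_stay stay_def image_subset_iff)
      then show ?thesis
        using act unfolding Undo2 phase_step_def by (auto simp: rules split: if_splits)
    qed (use act in \<open>auto simp: phase_step_def rules split: if_splits prod.splits\<close>)
  qed
  have "length acts = tapes ?N \<and> q' \<in> ?Q \<and> fst ` set acts \<subseteq> ?A"
    if "q \<in> ?Q" "length ss = tapes ?N" "set ss \<subseteq> ?A" "(q', acts) \<in> actions (delta ?N q ss)" for q ss q' acts
  proof -
    have len: "length ss = tapes M + 5" using that by (simp add: sampler_def)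
    then have "ss \<noteq> []" by auto
    have "length (hd ss # drop 6 ss) = tapes M" using len m by simp
    moreover have "set (hd ss # drop 6 ss) \<subseteq> ?A"
      using that(3) \<open>ss \<noteq> []\<close> by (auto dest: in_set_dropD)
    moreover have "set [ss ! 1, ss ! 2, ss ! 3, ss ! 4, ss ! 5] \<subseteq> ?A"
      using that(3) len m by (auto intro!: subsetD[OF that(3)])
    ultimately show ?thesis
      using good[of "hd ss # drop 6 ss"] that by (simp add: sampler_def G_def)
  qed
  moreover have "{start ?N, accept ?N, reject ?N} \<subseteq> ?Q" "accept ?N \<noteq> reject ?N"
    using Q by (simp_all add: sampler_def)
  ultimately show ?thesis
    using finite B unfolding wf_tm_def by blast
qed

section \<open>Runs of the sampling machine\<close>

abbreviation conf ::
  "phase \<Rightarrow> nat tape list \<Rightarrow> nat tape \<Rightarrow> nat tape \<Rightarrow> nat tape \<Rightarrow> nat tape \<Rightarrow> nat tape \<Rightarrow> (phase, nat) config" where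
  "conf st ms eT dT rT lT cT \<equiv> (st, pack ms [eT, dT, rT, lT, cT])"

abbreviation sampler_path where
  "sampler_path M \<equiv> comp_path (sampler M)"

lemma transition_at_sampler:
  assumes "ms \<noteq> []"
  shows "transition_at (sampler M) (conf st ms eT dT rT lT cT) =
    phase_step M st (map scan ms) (scan eT) (scan dT) (scan rT) (scan lT) (scan cT)"
proof -
  obtain t ts where "ms = t # ts" using assms by (cases ms) auto
  then show ?thesis
    by (simp add: transition_at_scan sampler_def pack_def numeral_eq_Suc)
qed

lemma apply_action_pack:
  assumes "ms \<noteq> []" "length am = length ms"
  shows "apply_action (st', pack am [ae, ad, ar, al, ac]) (conf st ms eT dT rT lT cT) =
    conf st' (map2 act_tape am ms) (act_tape ae eT) (act_tape ad dT) (act_tape ar rT)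
      (act_tape al lT) (act_tape ac cT)"
  using assms by (simp add: map2_pack)

lemma not_halted_sampler: "st \<noteq> Accept \<Longrightarrow> st \<noteq> Reject \<Longrightarrow> \<not> halted (sampler M) (st, ts)"
  by (simp add: halted_def sampler_sel)

abbreviation step_at where
  "step_at M st ms eT dT rT lT cT \<equiv>
    phase_step M st (map scan ms) (scan eT) (scan dT) (scan rT) (scan lT) (scan cT)"

lemma sampler_det:
  assumes "step_at M st ms eT dT rT lT cT =
      Det (st', pack am [ae, ad, ar, al, ac])"
    and "st \<noteq> Accept" "st \<noteq> Reject" "ms \<noteq> []" "length am = length ms"
    and "sampler_path M (conf st' (map2 act_tape am ms) (act_tape ae eT) (act_tape ad dT)
      (act_tape ar rT) (act_tape al lT) (act_tape ac cT)) bs t c'"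
  shows "sampler_path M (conf st ms eT dT rT lT cT) bs (Suc t) c'"
proof (rule comp_path.det)
  show "\<not> halted (sampler M) (conf st ms eT dT rT lT cT)"
    using assms by (simp add: not_halted_sampler)
  show "transition_at (sampler M) (conf st ms eT dT rT lT cT) = Det (st', pack am [ae, ad, ar, al, ac])"
    using assms by (simp add: transition_at_sampler)
  show "sampler_path M
    (apply_action (st', pack am [ae, ad, ar, al, ac]) (conf st ms eT dT rT lT cT)) bs t c'"
    using assms by (subst apply_action_pack)
qed

lemma sampler_stay:
  assumes "step_at M st ms eT dT rT lT cT =
      Det (st', pack (idle ms) [ae, ad, ar, al, ac])"
    and "st \<noteq> Accept" "st \<noteq> Reject" "ms \<noteq> []"
    and "sampler_path M (conf st' ms (act_tape ae eT) (act_tape ad dT)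
      (act_tape ar rT) (act_tape al lT) (act_tape ac cT)) bs t c'"
  shows "sampler_path M (conf st ms eT dT rT lT cT) bs (Suc t) c'"
  using assms by (intro sampler_det[OF assms(1)]) (simp_all del: map_map)

section \<open>Logged simulation and its reversal\<close>

fun un_act :: "'a sym \<times> dir \<Rightarrow> 'a tape \<Rightarrow> 'a tape" where
  "un_act (s, d) t = act_tape (s, Stay) (act_tape (scan t, rdir d) t)"

text \<open>Entries are listed newest first, the order in which the log is read back.\<close>

fun unwind :: "entry list \<Rightarrow> nat tape list \<Rightarrow> nat tape list" where
  "unwind [] ms = ms"
| "unwind (e # es) ms = unwind es (map2 un_act e ms)"

lemma unwind_append: "unwind (es @ es') ms = unwind es' (unwind es ms)"
  by (induction es arbitrary: ms) auto

lemma un_act_act: "un_act (scan t, d) (act_tape (s, d) t) = t"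
  by (cases t; cases d) (auto simp: scan_def act_tape.simps)

lemma map2_un_act:
  "length as = length ts \<Longrightarrow>
    map2 un_act (zip (map scan ts) (map snd as)) (map2 act_tape as ts) = ts"
proof (induction as ts rule: list_induct2)
  case (Cons a as t ts)
  then show ?case by (cases a) (simp add: un_act_act del: un_act.simps)
qed simp

lemma map2_two_steps:
  "length e = length ms \<Longrightarrow>
    map2 act_tape (map (stay \<circ> fst) e)
      (map2 act_tape (zip (map scan ms) (map (rdir \<circ> snd) e)) ms) = map2 un_act e ms"
proof (induction e ms rule: list_induct2)
  case (Cons a as t ts)
  then show ?case by (cases a) (simp add: stay_def)
qed simp

lemma fst_zip_subset: "fst ` set (zip xs ys) \<subseteq> set xs"
  by (auto dest: set_zip_leftD)

text \<open>The mode \<open>pr\<close> and all other tapes are universally quantified, so that one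
  induction along the path of \<open>M\<close> serves the sampling runs and the printing run. With
  the newest entry first, \<open>es\<close> is the left part of the log tape just as
  \<open>zt\<close> lists it.\<close>

definition simulates ::
  "(nat, nat) tm \<Rightarrow> (nat, nat) config \<Rightarrow> bool list \<Rightarrow> nat \<Rightarrow> (nat, nat) config \<Rightarrow> entry list \<Rightarrow> bool" where
  "simulates M c bs t c' es \<longleftrightarrow>
    unwind es (snd c') = snd c \<and> length es = t \<and> list_all (valid_entry M) es \<and> config_ok M c' \<and>
    (\<forall>pr eT dT k out h lg cT. sampler_path M
      (conf (Sim pr (fst c)) (snd c) eT dT (zt k out []) (zt h lg []) cT) bs t
      (conf (Sim pr (fst c')) (snd c') eT dT
        (if pr then zt (k + int (length bs)) (replicate (length bs) (Bit False) @ out) [] else zt k out [])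
        (zt (h + int t) (map ent es @ lg) []) cT))"

lemma simulates_path:
  assumes "simulates M (q, ms) bs t (q', ms') es"
  shows "sampler_path M
      (conf (Sim pr q) ms eT dT (zt k out []) (zt 0 [] []) cT) bs t
      (conf (Sim pr q') ms' eT dT
        (if pr then zt (k + int (length bs)) (replicate (length bs) (Bit False) @ out) [] else zt k out [])
        (zt (int t) (map ent es) []) cT)"
proof -
  have "sampler_path M
      (conf (Sim pr q) ms eT dT (zt k out []) (zt 0 [] []) cT) bs t
      (conf (Sim pr q') ms' eT dT
        (if pr then zt (k + int (length bs)) (replicate (length bs) (Bit False) @ out) [] else zt k out [])
        (zt (0 + int t) (map ent es @ []) []) cT)"
    using assms unfolding simulates_def fst_conv snd_conv by blast
  then show ?thesis by simp
qed

lemma simulate_step: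
  assumes wf: "wf_tm M" "tapes M \<ge> 1" and ok: "config_ok M c" and nh: "\<not> halted M c"
    and tr: "transition_at M c = Det a \<and> bs' = [] \<or>
      (\<exists>a0 a1 b. transition_at M c = Choice a0 a1 \<and> a = (if b then a1 else a0) \<and> bs' = [b])"
    and sim: "simulates M (apply_action a c) bs t c' es"
  shows "\<exists>es. simulates M c (bs' @ bs) (Suc t) c' es"
proof -
  obtain q ts where c: "c = (q, ts)" by (cases c)
  obtain q' as where a: "a = (q', as)" by (cases a)
  have act: "a \<in> actions (transition_at M c)" using tr by auto
  let ?e = "zip (map scan ts) (map snd as)"
  have len: "length as = length ts" "length ts = tapes M" "ts \<noteq> []"
    using config_ok_action(2)[OF wf(1) ok act] ok wf(2) by (auto simp: a c config_ok_def)
  have q: "q \<noteq> accept M" "q \<noteq> reject M" "q \<in> states M" "set (map scan ts) \<subseteq> alphabet M"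
    using nh ok config_ok_scan[OF ok] by (auto simp: c halted_def config_ok_def)
  have "sampler_path M (conf (Sim pr q) ts eT dT (zt k out []) (zt h lg []) cT) (bs' @ bs) (Suc t)
      (conf (Sim pr (fst c')) (snd c') eT dT
        (if pr then zt (k + int (length (bs' @ bs))) (replicate (length (bs' @ bs)) (Bit False) @ out) []
         else zt k out [])
        (zt (h + int (Suc t)) (map ent (es @ [?e]) @ lg) []) cT)" for pr eT dT k out h lg cT
  proof -
    let ?a = "\<lambda>print. sim_action pr print (map scan ts) [scan eT, scan dT, scan (zt k out []), scan (zt h lg []), scan cT]"
    let ?c = "conf (Sim pr q) ts eT dT (zt k out []) (zt h lg []) cT"
    have tr': "transition_at (sampler M) ?c = (case delta M q (map scan ts) of
        Det a \<Rightarrow> Det (?a False a) | Choice a0 a1 \<Rightarrow> Choice (?a pr a0) (?a pr a1))"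
      using q by (subst transition_at_sampler[OF len(3)]) (simp add: phase_step_def split: transition.split)
    have app: "apply_action (?a print a) ?c = conf (Sim pr q') (map2 act_tape as ts) eT dT
      (if print then zt (k + 1) (Bit False # out) [] else zt k out []) (zt (h + 1) (ent ?e # lg) []) cT" for print
      unfolding a sim_action.simps by (subst apply_action_pack[OF len(3,1)]) (simp add: act_zt)
    have rest: "sampler_path M
      (conf (Sim pr q') (map2 act_tape as ts) eT dT (zt k' out' []) (zt (h + 1) (ent ?e # lg) []) cT) bs t
      (conf (Sim pr (fst c')) (snd c') eT dT
        (if pr then zt (k' + int (length bs)) (replicate (length bs) (Bit False) @ out') [] else zt k' out' [])
        (zt (h + int (Suc t)) (map ent (es @ [?e]) @ lg) []) cT)" for k' out'
    proof -
      have "h + 1 + int t = h + int (Suc t)" "map ent es @ ent ?e # lg = map ent (es @ [?e]) @ lg" by simp_all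
      then show ?thesis using sim by (simp only: simulates_def a c apply_action.simps fst_conv snd_conv) metis
    qed
    from tr show ?thesis
    proof (elim disjE exE conjE)
      assume "transition_at M c = Det a" and bs': "bs' = []"
      then have "delta M q (map scan ts) = Det a" by (simp add: transition_at_scan c)
      then have "transition_at (sampler M) ?c = Det (?a False a)" by (simp add: tr')
      note step = comp_path.det[OF not_halted_sampler this]
      show ?thesis
        using step[unfolded app] rest[of k out] by (cases pr) (simp_all add: bs' del: map_append)
    next
      fix a0 a1 b
      assume ch: "transition_at M c = Choice a0 a1" and ab: "a = (if b then a1 else a0)" and bs': "bs' = [b]"
      then have "delta M q (map scan ts) = Choice a0 a1" by (simp add: transition_at_scan c)
      then have "transition_at (sampler M) ?c = Choice (?a pr a0) (?a pr a1)" by (simp add: tr')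
      note step = comp_path.choice[OF not_halted_sampler this, of b]
      have ab': "(if b then ?a pr a1 else ?a pr a0) = ?a pr a" by (simp add: ab)
      show ?thesis
        using step[unfolded ab' app] rest[of "if pr then k + 1 else k" "if pr then Bit False # out else out"]
        by (cases pr) (simp_all add: bs' algebra_simps replicate_app_Cons_same del: map_append)
    qed
  qed
  moreover have "valid_entry M ?e"
    using len q(4) fst_zip_subset[of "map scan ts" "map snd as"] by (simp add: valid_entry_def)
  \<comment> \<open>The step added here is the first of the path, so its entry is undone
    last.\<close>
  ultimately have "simulates M c (bs' @ bs) (Suc t) c' (es @ [?e])"
    using sim len by (simp add: simulates_def unwind_append a c map2_un_act)
  then show ?thesis ..
qed

lemma simulate_run:
  assumes wf: "wf_tm M" "tapes M \<ge> 1"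
  shows "comp_path M c bs t c' \<Longrightarrow> config_ok M c \<Longrightarrow> \<exists>es. simulates M c bs t c' es"
proof (induction rule: comp_path.induct)
  case (refl c)
  then have "simulates M c [] 0 c []" by (simp add: simulates_def comp_path.refl)
  then show ?case ..
next
  case (det c a bs t c')
  have "config_ok M (apply_action a c)"
    by (rule config_ok_action(1)[OF wf(1) det.prems]) (simp add: det.hyps)
  from det.IH[OF this] obtain es where "simulates M (apply_action a c) bs t c' es" ..
  from simulate_step[OF wf det.prems det.hyps(1) _ this, of "[]"] det.hyps(2) show ?case by simp
next
  case (choice c a0 a1 b bs t c')
  have "config_ok M (apply_action (if b then a1 else a0) c)"
    by (rule config_ok_action(1)[OF wf(1) choice.prems]) (simp add: choice.hyps)
  from choice.IH[OF this] obtain es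
    where "simulates M (apply_action (if b then a1 else a0) c) bs t c' es" ..
  from simulate_step[OF wf choice.prems choice.hyps(1) _ this, of "[b]"] choice.hyps(2)
  show ?case by simp
qed

text \<open>The log head starts on the newest entry. Each entry takes two steps, and a last step
  moves the head from the blank cell -1 to cell 0, so that the log tape is again exactly as before
  the run.\<close>

lemma undo_run:
  assumes m: "tapes M \<ge> 1"
  shows "length ms = tapes M \<Longrightarrow> list_all (valid_entry M) es \<Longrightarrow>
    sampler_path M
      (conf (Undo1 a) ms eT dT rT (zt (int (length es) - 1) (tl (map ent es)) [hdb (map ent es)]) cT) []
      (2 * length es + 1)
      (conf (Inc a True False) (unwind es ms) eT dT rT (zt 0 [] []) cT)"
proof (induction es arbitrary: ms)
  case Nil
  have "ms \<noteq> []" using Nil m by auto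
  then show ?case
    by (auto simp: act_zt phase_step_def intro!: sampler_stay comp_path.refl)
next
  case (Cons e es)
  have ne: "ms \<noteq> []" using Cons.prems m by auto
  have e: "valid_entry M e" "length e = length ms"
    using Cons.prems by (auto simp: valid_entry_def)
  let ?lT = "zt (int (length es)) (map ent es) [ent e]"
  let ?ms = "map2 act_tape (zip (map scan ms) (map (rdir \<circ> snd) e)) ms"
  have len: "length (map2 un_act e ms) = tapes M" "length ?ms = length ms" "?ms \<noteq> []"
    using e Cons.prems ne by auto
  have 1: "step_at M (Undo1 a) ms eT dT rT ?lT cT =
    Det (Undo2 a, pack (zip (map scan ms) (map (rdir \<circ> snd) e))
      [keep eT, keep dT, keep rT, keep ?lT, keep cT])"
    using e by (simp add: phase_step_def)
  have 2: "step_at M (Undo2 a) ?ms eT dT rT ?lT cT =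
    Det (Undo1 a, pack (map (stay \<circ> fst) e)
      [keep eT, keep dT, keep rT, (Blank, Move_L), keep cT])"
    using e by (simp add: phase_step_def)
  have "sampler_path M (conf (Undo1 a) ms eT dT rT ?lT cT) [] (Suc (Suc (2 * length es + 1)))
      (conf (Inc a True False) (unwind es (map2 un_act e ms)) eT dT rT (zt 0 [] []) cT)"
    apply (rule sampler_det[OF 1])
    using ne e apply simp_all[4]
    apply (simp only: act_stay_scan)
    apply (rule sampler_det[OF 2])
    using ne e len apply simp_all[4]
    apply (simp only: act_stay_scan map2_two_steps[OF e(2)])
    using Cons.IH[OF len(1)] Cons.prems by (simp add: act_zt)
  then show ?case by simp
qed

section \<open>The counter\<close>

fun inc :: "bool \<Rightarrow> bool \<Rightarrow> digit list \<Rightarrow> digit list" where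
  "inc cx cd [] = (if cx \<or> cd then [(cx, cd, False)] else [])"
| "inc cx cd ((x, d, m) # l) = (x \<noteq> cx, d \<noteq> cd, m) # inc (x \<and> cx) (d \<and> cd) l"

text \<open>Lists begin with the least significant digit. This is the flag that \<open>Inc\<close>
  accumulates: the carry of the number of runs has entered an unmarked cell or passed the end of the
  list.\<close>

fun ovf :: "bool \<Rightarrow> digit list \<Rightarrow> bool" where
  "ovf cd [] = cd"
| "ovf cd ((x, d, m) # l) = (if m then ovf (d \<and> cd) l else cd \<or> ovf (d \<and> cd) l)"

lemma inc_no_carry [simp]: "inc False False l = l"
  by (induction l) auto

lemma ovf_no_carry [simp]: "ovf False l = False"
  by (induction l) (auto split: if_splits)

text \<open>The least significant digit is in cell 0 and the number grows to the left.
  \<open>l\<close> runs leftwards from the scanned cell, and \<open>R\<close> holds the lower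
  digits, nearest first. If \<open>l\<close> is empty, the head is on the blank cell beyond the left
  end.\<close>

definition counter :: "digit list \<Rightarrow> digit list \<Rightarrow> nat tape" where
  "counter l R = zt (- int (length R)) (map dig (tl l)) (hdb (map dig l) # map dig R)"

lemma scan_counter [simp]: "scan (counter l R) = hdb (map dig l)"
  by (simp add: counter_def)

lemma hdb_map_dig_eq_Blank [simp]: "hdb (map dig l) = Blank \<longleftrightarrow> l = []" "Blank = hdb (map dig l) \<longleftrightarrow> l = []"
  by (cases l; simp add: dig_not_Blank[symmetric])+

lemma zt_cong: "h = h' \<Longrightarrow> zt h L R = zt h' L R"
  by simp

lemma act_counter:
  "act_tape (dig a', Move_L) (counter (a # l) R) = counter l (a' # R)"
  "act_tape (dig a', Move_L) (counter [] R) = counter [] (a' # R)"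
  "act_tape (hdb (map dig l), Move_R) (counter l (r # R)) = counter (r # l) R"
  "l \<noteq> [] \<Longrightarrow> act_tape (hdb (map dig l), Move_R) (counter l []) = zt 1 (map dig l) []"
  "act_tape (Blank, Move_L) (zt 1 (map dig l) []) = counter l []"
proof -
  show "act_tape (dig a', Move_L) (counter (a # l) R) = counter l (a' # R)"
    by (cases l) (auto simp: counter_def act_zt intro!: zt_cong)
  show "act_tape (dig a', Move_L) (counter [] R) = counter [] (a' # R)"
    by (auto simp: counter_def act_zt intro!: zt_cong)
  show "act_tape (hdb (map dig l), Move_R) (counter l (r # R)) = counter (r # l) R"
    by (cases l) (auto simp: counter_def act_zt intro!: zt_cong)
  show "act_tape (hdb (map dig l), Move_R) (counter l []) = zt 1 (map dig l) []" if "l \<noteq> []"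
    using that by (cases l) (auto simp: counter_def act_zt intro!: zt_cong)
  show "act_tape (Blank, Move_L) (zt 1 (map dig l) []) = counter l []"
    by (cases l) (auto simp: counter_def act_zt intro!: zt_cong)
qed

lemma return_counter:
  assumes "ms \<noteq> []" "l \<noteq> []"
  shows "sampler_path M (conf (Ret ov) ms eT dT rT lT (counter l R)) [] (Suc (length R))
    (conf (Ret ov) ms eT dT rT lT (zt 1 (map dig (rev R @ l)) []))"
  using assms(2)
proof (induction R arbitrary: l)
  case Nil
  show ?case
    apply (rule sampler_stay)
    apply (simp add: phase_step_def Nil)
    using assms Nil by (simp_all add: act_counter comp_path.refl)
next
  case (Cons r R)
  show ?case
    apply (rule sampler_stay)
    apply (simp add: phase_step_def Cons.prems)
    using assms Cons.IH[of "r # l"] by (simp_all add: act_counter)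
qed

lemma stop_counter:
  assumes "ms \<noteq> []" "R \<noteq> []"
  shows "sampler_path M (conf (Inc False False ov) ms eT dT rT lT (counter l R)) [] (Suc (length R))
    (conf (Ret ov) ms eT dT rT lT (zt 1 (map dig (rev R @ l)) []))"
proof -
  obtain r R' where R: "R = r # R'" using assms by (cases R) auto
  show ?thesis
    apply (rule sampler_stay)
    apply (simp add: phase_step_def)
    using assms return_counter[OF assms(1), of "r # l" M ov eT dT rT lT R'] act_counter(3)[of l r R']
    by (simp_all add: R)
qed

lemma carry_counter:
  assumes "ms \<noteq> []"
  shows "R \<noteq> [] \<or> cx \<or> cd \<Longrightarrow> \<exists>t \<le> 2 * length l + length R + 4.
    sampler_path M (conf (Inc cx cd ov) ms eT dT rT lT (counter l R)) [] t
      (conf (Ret (ov \<or> ovf cd l)) ms eT dT rT lT (zt 1 (map dig (rev R @ inc cx cd l)) []))"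
proof (induction l arbitrary: R cx cd ov)
  case Nil
  show ?case
  proof (cases "cx \<or> cd")
    case False
    then show ?thesis
      using stop_counter[OF assms, of R M ov eT dT rT lT "[]"] Nil
      by (intro exI[of _ "Suc (length R)"]) auto
  next
    case True
    \<comment> \<open>The digit created beyond the left end is unmarked, so a carry of the second
      count into it is an overflow.\<close>
    have "sampler_path M (conf (Inc cx cd ov) ms eT dT rT lT (counter [] R)) [] (Suc (Suc (Suc (length R))))
      (conf (Ret (ov \<or> cd)) ms eT dT rT lT (zt 1 (map dig (rev ((cx, cd, False) # R))) []))"
      apply (rule sampler_stay[of M _ ms eT dT rT lT _ "Inc False False (ov \<or> cd)"
          "keep eT" "keep dT" "keep rT" "keep lT" "(dig (cx, cd, False), Move_L)"])
      using True apply (auto simp: phase_step_def)[1]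
      using assms stop_counter[OF assms, of "(cx, cd, False) # R" M "ov \<or> cd" eT dT rT lT "[]"]
      by (simp_all add: act_counter)
    then show ?thesis using True by (intro exI[of _ "Suc (Suc (Suc (length R)))"]) auto
  qed
next
  case (Cons a l)
  obtain x d m where a: "a = (x, d, m)" by (cases a)
  show ?case
  proof (cases "cx \<or> cd")
    case False
    then show ?thesis
      using stop_counter[OF assms, of R M ov eT dT rT lT "a # l"] Cons.prems
      by (intro exI[of _ "Suc (length R)"]) auto
  next
    case True
    let ?a = "(x \<noteq> cx, d \<noteq> cd, m)"
    obtain t where t: "t \<le> 2 * length l + length (?a # R) + 4" "sampler_path M
      (conf (Inc (x \<and> cx) (d \<and> cd) (ov \<or> cd \<and> \<not> m)) ms eT dT rT lT (counter l (?a # R))) [] t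
      (conf (Ret ((ov \<or> cd \<and> \<not> m) \<or> ovf (d \<and> cd) l)) ms eT dT rT lT
        (zt 1 (map dig (rev (?a # R) @ inc (x \<and> cx) (d \<and> cd) l)) []))"
      using Cons.IH[of "?a # R"] by blast
    have *: "((ov \<or> cd \<and> \<not> m) \<or> ovf (d \<and> cd) l) = (ov \<or> ovf cd (a # l))"
      by (auto simp: a)
    have "sampler_path M (conf (Inc cx cd ov) ms eT dT rT lT (counter (a # l) R)) [] (Suc t)
      (conf (Ret (ov \<or> ovf cd (a # l))) ms eT dT rT lT (zt 1 (map dig (rev R @ inc cx cd (a # l))) []))"
     apply (rule sampler_stay[of M _ ms eT dT rT lT _ "Inc (x \<and> cx) (d \<and> cd) (ov \<or> cd \<and> \<not> m)"
          "keep eT" "keep dT" "keep rT" "keep lT" "(dig ?a, Move_L)"])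
      using True apply (auto simp: phase_step_def a)[1]
      using assms t(2)[unfolded *] by (simp_all add: act_counter a)
    then show ?thesis using t by (intro exI[of _ "Suc t"]) auto
  qed
qed

lemma setup_digit:
  fixes f :: "int \<Rightarrow> nat sym"
  assumes "ms \<noteq> []" and a: "a = (False, False, True)"
    and "step_at M Setup2 ms (f, int i) dT rT lT (zt (- 2 * int i - 1) [] (Blank # replicate (2 * i + 1) (dig a))) =
      Det (st, pack (idle ms) [ae, keep dT, keep rT, keep lT, ac])"
    and "sampler_path M (conf st ms (act_tape ae (f, int i)) dT rT lT
      (act_tape ac (zt (- 2 * int i - 1) [] (Blank # replicate (2 * i + 1) (dig a))))) [] t c"
  shows "sampler_path M
    (conf Setup1 ms (f, int i) dT rT lT (zt (- 2 * int i) [] (Blank # replicate (2 * i) (dig a)))) []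
    (Suc (Suc t)) c"
proof -
  let ?E = "(f, int i)" and ?C = "zt (- 2 * int i) [] (Blank # replicate (2 * i) (dig a))"
  have 1: "step_at M Setup1 ms ?E dT rT lT ?C =
    Det (Setup2, pack (idle ms) [keep ?E, keep dT, keep rT, keep lT, (dig a, Move_L)])"
    by (simp add: phase_step_def a)
  have C: "act_tape (dig a, Move_L) ?C = zt (- 2 * int i - 1) [] (Blank # replicate (2 * i + 1) (dig a))"
    by (simp add: act_zt)
  show ?thesis
    apply (rule sampler_stay[OF 1])
       apply (use assms in simp_all)[3]
    unfolding act_stay_scan C
    apply (rule sampler_stay[OF assms(3)])
       apply (use assms in simp_all)[3]
    unfolding act_stay_scan by (rule assms(4))
qed

text \<open>Each of the cells 0 to \<open>j\<close> of \<epsilon> contributes two marked digits, 2 j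
  + 2 in all; this is where the factor 4^(j + 1) in the number of runs comes from.\<close>

lemma setup_run:
  fixes f :: "int \<Rightarrow> nat sym"
  assumes "ms \<noteq> []" and j: "f (int j) = Bit True" "\<And>i. i < j \<Longrightarrow> f (int i) \<noteq> Bit True"
    and a: "a = (False, False, True)"
  shows "i \<le> j \<Longrightarrow> sampler_path M
    (conf Setup1 ms (f, int i) dT rT lT (zt (- 2 * int i) [] (Blank # replicate (2 * i) (dig a)))) []
    (2 * (j - i) + 2)
    (conf (Ret False) ms (f, int j) dT rT lT (counter [a] (replicate (2 * j + 1) a)))"
proof (induction rule: inc_induct)
  case base
  have E: "scan (f, int j) = Bit True" using j by (simp add: scan_def)
  have "act_tape (dig a, Stay) (zt (- 2 * int j - 1) [] (Blank # replicate (2 * j + 1) (dig a))) =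
      counter [a] (replicate (2 * j + 1) a)"
    by (auto simp: act_zt counter_def algebra_simps intro!: zt_cong)
  then have "sampler_path M
    (conf Setup1 ms (f, int j) dT rT lT (zt (- 2 * int j) [] (Blank # replicate (2 * j) (dig a)))) [] (Suc (Suc 0))
    (conf (Ret False) ms (f, int j) dT rT lT (counter [a] (replicate (2 * j + 1) a)))"
    using E act_stay_scan[of "(f, int j)", unfolded E] by (intro setup_digit[where ae = "keep (f, int j)" and ac = "(dig a, Stay)" and st = "Ret False"])
      (simp_all add: assms(1) a phase_step_def comp_path.refl)
  then show ?case by simp
next
  case (step i)
  have E: "scan (f, int i) \<noteq> Bit True" using j step by (simp add: scan_def)
  have C: "act_tape (dig a, Move_L) (zt (- 2 * int i - 1) [] (Blank # replicate (2 * i + 1) (dig a))) =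
      zt (- 2 * int (Suc i)) [] (Blank # replicate (2 * Suc i) (dig a))"
    by (auto simp: act_zt algebra_simps intro!: zt_cong)
  have "sampler_path M
    (conf Setup1 ms (f, int i) dT rT lT (zt (- 2 * int i) [] (Blank # replicate (2 * i) (dig a)))) []
    (Suc (Suc (2 * (j - Suc i) + 2)))
    (conf (Ret False) ms (f, int j) dT rT lT (counter [a] (replicate (2 * j + 1) a)))"
    apply (rule setup_digit[where ae = "(scan (f, int i), Move_R)" and ac = "(dig a, Move_L)" and st = Setup1])
    using assms(1) a apply simp_all[2]
    using E apply (simp add: phase_step_def a)
    unfolding C using step.IH by (simp add: act_move_scan add.commute)
  moreover have "Suc (Suc (2 * (j - Suc i) + 2)) = 2 * (j - i) + 2"
    using step by simp
  ultimately show ?case by simp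
qed

section \<open>Printing and evaluating the counter\<close>

lemma left_end_run:
  assumes "ms \<noteq> []"
  shows "sampler_path M
    (conf (Left_End f) ms eT dT rT lT (zt h (map dig l) (map dig (r # R)))) [] (length l + 2)
    (conf (Print f) ms eT dT rT lT (zt (h - int (length l)) [] (map dig (rev l @ r # R))))"
proof (induction l arbitrary: h r R)
  case Nil
  let ?C = "zt h [] (map dig (r # R))" and ?C' = "zt (h - 1) [] (Blank # map dig (r # R))"
  have 1: "step_at M (Left_End f) ms eT dT rT lT ?C =
    Det (Left_End f, pack (idle ms)
      [keep eT, keep dT, keep rT, keep lT, (scan ?C, Move_L)])"
    by (simp add: phase_step_def)
  have 2: "step_at M (Left_End f) ms eT dT rT lT ?C' =
    Det (Print f, pack (idle ms)
      [keep eT, keep dT, keep rT, keep lT, (Blank, Move_R)])"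
    by (simp add: phase_step_def)
  have C: "act_tape (scan ?C, Move_L) ?C = ?C'" "act_tape (Blank, Move_R) ?C' = ?C"
    by (simp_all add: act_zt)
  have "sampler_path M (conf (Left_End f) ms eT dT rT lT ?C) [] (Suc (Suc 0))
      (conf (Print f) ms eT dT rT lT ?C)"
    apply (rule sampler_stay[OF 1])
     apply (use assms in simp_all)[3]
    unfolding act_stay_scan C
    apply (rule sampler_stay[OF 2])
     apply (use assms in simp_all)[3]
    unfolding act_stay_scan C by (rule comp_path.refl)
  then show ?case by simp
next
  case (Cons a l)
  let ?C = "zt h (map dig (a # l)) (map dig (r # R))"
  have 1: "step_at M (Left_End f) ms eT dT rT lT ?C =
    Det (Left_End f, pack (idle ms)
      [keep eT, keep dT, keep rT, keep lT, (scan ?C, Move_L)])"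
    by (simp add: phase_step_def)
  have C: "act_tape (scan ?C, Move_L) ?C = zt (h - 1) (map dig l) (map dig (a # r # R))"
    by (simp add: act_zt)
  have "sampler_path M (conf (Left_End f) ms eT dT rT lT ?C) [] (Suc (length l + 2))
      (conf (Print f) ms eT dT rT lT (zt (h - 1 - int (length l)) [] (map dig (rev l @ a # r # R))))"
    apply (rule sampler_stay[OF 1])
     apply (use assms in simp_all)[3]
    unfolding act_stay_scan C by (rule Cons.IH)
  then show ?case by (simp add: algebra_simps)
qed

definition digit_of :: "bool \<Rightarrow> digit \<Rightarrow> bool" where
  "digit_of f a = (if f then fst (snd a) else fst a)"

lemma print_run:
  assumes "ms \<noteq> []"
  shows "sampler_path M
    (conf (Print f) ms eT dT (zt k out []) lT (zt h L (map dig R))) [] (length R)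
    (conf (Print f) ms eT dT (zt (k + int (length R)) (rev (map (Bit \<circ> digit_of f) R) @ out) []) lT
      (zt (h + int (length R)) (rev (map dig R) @ L) []))"
proof (induction R arbitrary: k out h L)
  case Nil
  then show ?case by (simp add: comp_path.refl)
next
  case (Cons r R)
  let ?C = "zt h L (map dig (r # R))"
  have 1: "step_at M (Print f) ms eT dT (zt k out []) lT ?C =
    Det (Print f, pack (idle ms)
      [keep eT, keep dT, (Bit (digit_of f r), Move_R), keep lT, (dig r, Move_R)])"
    by (simp add: phase_step_def digit_of_def)
  have C: "act_tape (dig r, Move_R) ?C = zt (h + 1) (dig r # L) (map dig R)"
    "act_tape (Bit (digit_of f r), Move_R) (zt k out []) = zt (k + 1) (Bit (digit_of f r) # out) []"
    by (simp_all add: act_zt)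
  show ?case
    unfolding length_Cons
    apply (rule sampler_stay[OF 1])
     apply (use assms in simp_all)[3]
    unfolding act_stay_scan C
    using Cons.IH[of "k + 1" "Bit (digit_of f r) # out" "h + 1" "dig r # L"]
    by (simp add: algebra_simps)
qed

abbreviation xval :: "digit list \<Rightarrow> nat" where
  "xval l \<equiv> horner_sum of_bool 2 (map (digit_of False) l)"

abbreviation dval :: "digit list \<Rightarrow> nat" where
  "dval l \<equiv> horner_sum of_bool 2 (map (digit_of True) l)"

lemma xval_inc: "xval (inc cx cd l) = xval l + of_bool cx"
  by (induction cx cd l rule: inc.induct) (auto simp: digit_of_def)

lemma dval_inc: "dval (inc cx cd l) = dval l + of_bool cd"
  by (induction cx cd l rule: inc.induct) (auto simp: digit_of_def)

text \<open>An increment adds at most one digit, never a marked one. The bound on the counter length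
  that follows is linear in the number of runs; this is crude, but the number of runs is itself
  polynomially bounded.\<close>

lemma marks_inc:
  "map (snd \<circ> snd) l = replicate W True @ replicate n False \<Longrightarrow>
    \<exists>n' \<le> Suc n. map (snd \<circ> snd) (inc cx cd l) = replicate W True @ replicate n' False"
proof (induction cx cd l arbitrary: W n rule: inc.induct)
  case (1 cx cd)
  then have "W = 0" by (cases W) auto
  then show ?case by (intro exI[of _ "of_bool (cx \<or> cd)"]) (auto simp: of_bool_def)
next
  case (2 cx cd x d m l)
  show ?case
  proof (cases W)
    case (Suc W')
    then have m: "m" "map (snd \<circ> snd) l = replicate W' True @ replicate n False"
      using "2.prems" by (auto simp: o_def)
    then show ?thesis using "2.IH"[OF m(2)] Suc by (auto simp: o_def)
  next
    case 0
    then obtain n0 where n: "n = Suc n0" using "2.prems" by (cases n) auto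
    then have "\<not> m" "map (snd \<circ> snd) l = replicate 0 True @ replicate n0 False"
      using "2.prems" 0 by (auto simp: o_def)
    then obtain n' where "n' \<le> Suc n0"
      "map (snd \<circ> snd) (inc (x \<and> cx) (d \<and> cd) l) = replicate 0 True @ replicate n' False"
      using "2.IH"[of 0 n0] by blast
    then show ?thesis using 0 n \<open>\<not> m\<close> by (intro exI[of _ "Suc n'"]) (auto simp: o_def)
  qed
qed

text \<open>A carry passes the \<open>W\<close> marked low digits iff all of them are 1, that is,
  iff the number is -1 modulo 2^W.\<close>

lemma ovf_iff:
  "map (snd \<circ> snd) l = replicate W True @ replicate n False \<Longrightarrow>
    ovf cd l \<longleftrightarrow> cd \<and> 2 ^ W dvd dval l + 1"
proof (induction cd l arbitrary: W n rule: ovf.induct)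
  case (1 cd)
  then have "W = 0" by (cases W) auto
  then show ?case by simp
next
  case (2 cd x d m l)
  show ?case
  proof (cases W)
    case (Suc W')
    then have m: "m" "map (snd \<circ> snd) l = replicate W' True @ replicate n False"
      using "2.prems" by (auto simp: o_def)
    have "2 ^ W dvd dval ((x, d, m) # l) + 1 \<longleftrightarrow> d \<and> 2 ^ W' dvd dval l + 1"
    proof (cases d)
      case True
      then have "dval ((x, d, m) # l) + 1 = 2 * (dval l + 1)" by (simp add: digit_of_def)
      then show ?thesis using True Suc by (simp only: power_Suc nat_mult_dvd_cancel_disj) simp
    next
      case False
      then have "odd (dval ((x, d, m) # l) + 1)" by (simp add: digit_of_def)
      moreover have "even (2 ^ W :: nat)" using Suc by simp
      ultimately show ?thesis using False dvd_trans by blast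
    qed
    then show ?thesis using m "2.IH"(1)[OF m] by auto
  next
    case 0
    then have "\<not> m" using "2.prems" by (cases n) auto
    then show ?thesis using 0 by (cases cd) auto
  qed
qed

section \<open>Sampling on a fixed input\<close>

locale sampling =
  fixes M :: "(nat, nat) tm" and x :: "bool list" and p T :: nat
    and final :: "bool list \<Rightarrow> (nat, nat) config"
  assumes wf: "wf_tm M" and tapes: "tapes M \<ge> 1"
    and complete: "\<And>bs. length bs = p \<Longrightarrow>
      \<exists>t\<le>T. comp_path M (input_config M x) bs t (final bs) \<and> halted M (final bs)"
begin

definition accepting :: "bool list set" where
  "accepting = {bs. fst (final bs) = accept M}"

definition ms0 :: "nat tape list" where
  "ms0 = snd (input_config M x)"

lemma fst_input: "input_config M x = (start M, ms0)"
  by (simp add: ms0_def input_config_def init_config_def)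

lemma length_ms0: "length ms0 = tapes M"
  using tapes by (simp add: ms0_def input_config_def init_config_def)

lemma ms0_ne: "ms0 \<noteq> []"
  using length_ms0 tapes by auto

lemma input_ok: "config_ok M (input_config M x)"
  unfolding input_config_def
  by (rule config_ok_init) (use wf tapes in \<open>auto simp: word_tape_alphabet\<close>)

abbreviation blank_tape :: "nat tape" where
  "blank_tape \<equiv> zt 0 [] []"

abbreviation base :: "phase \<Rightarrow> nat tape \<Rightarrow> nat tape \<Rightarrow> nat tape \<Rightarrow> (phase, nat) config" where
  "base st eT dT cT \<equiv> conf st ms0 eT dT blank_tape blank_tape cT"

lemma simulate_input:
  assumes "length bs = p"
  obtains t q ts es where "t \<le> T" "q = accept M \<or> q = reject M" "bs \<in> accepting \<longleftrightarrow> q = accept M"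
    "unwind es ts = ms0" "length es = t" "list_all (valid_entry M) es" "length ts = tapes M" "ts \<noteq> []"
    "simulates M (start M, ms0) bs t (q, ts) es"
proof -
  obtain t where t: "t \<le> T" "comp_path M (input_config M x) bs t (final bs)" "halted M (final bs)"
    using complete[OF assms] by blast
  obtain q ts where fin: "final bs = (q, ts)" by (cases "final bs")
  obtain es where es: "simulates M (start M, ms0) bs t (q, ts) es"
    using simulate_run[OF wf tapes t(2) input_ok] unfolding fst_input fin by blast
  show ?thesis
    by (rule that[OF t(1) _ _ _ _ _ _ _ es])
      (use t(3) es tapes in \<open>auto simp: fin halted_def accepting_def simulates_def config_ok_def\<close>)
qed

text \<open>Undoing restores \<open>ms0\<close> and the blank log, so runs can be chained. The bound
  adds \<open>T\<close> for simulation, 2 T + 2 for undoing and 2 length l + 4 for counting.\<close>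

lemma sample_run:
  assumes "length bs = p"
  shows "\<exists>t \<le> 3 * T + 2 * length l + 6. sampler_path M
    (base (Sim False (start M)) eT dT (counter l [])) bs t
    (base (Ret (ovf True l)) eT dT       (zt 1 (map dig (inc (bs \<in> accepting) True l)) []))"
proof -
  obtain t q ts es where t: "t \<le> T" "q = accept M \<or> q = reject M"
    and acc: "bs \<in> accepting \<longleftrightarrow> q = accept M"
    and es: "unwind es ts = ms0" "length es = t" "list_all (valid_entry M) es"
    and len: "length ts = tapes M" "ts \<noteq> []"
    and sim: "simulates M (start M, ms0) bs t (q, ts) es"
    by (rule simulate_input[OF assms]) (rule that; assumption)
  have 1: "sampler_path M
        (base (Sim False (start M)) eT dT (counter l [])) bs t
        (conf (Sim False q) ts eT dT blank_tape (zt (int t) (map ent es) []) (counter l []))"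
    using simulates_path[OF sim, of False eT dT 0 "[]"] by simp
  let ?L = "zt (int t) (map ent es) []"
  have ps: "step_at M (Sim False q) ts eT dT blank_tape ?L (counter l []) =
    Det (Undo1 (q = accept M), pack (idle ts)
      [keep eT, keep dT, keep blank_tape, (Blank, Move_L), keep (counter l [])])"
    using t(2) by (auto simp: phase_step_def)
  have L: "act_tape (Blank, Move_L) ?L = zt (int (length es) - 1) (tl (map ent es)) [hdb (map ent es)]"
    using es(2) by (simp add: act_zt)
  have 2: "sampler_path M (conf (Sim False q) ts eT dT blank_tape ?L (counter l [])) []
      (Suc (2 * length es + 1))
      (base (Inc (q = accept M) True False) eT dT (counter l []))"
    apply (rule sampler_stay[OF ps])
     apply (use len in simp_all)[3]
    unfolding act_stay_scan L
    using undo_run[OF tapes len(1) es(3), of "q = accept M" eT dT blank_tape "counter l []"]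
    by (simp add: es)
  obtain t' where t': "t' \<le> 2 * length l + 4"
    "sampler_path M (base (Inc (q = accept M) True False) eT dT (counter l [])) [] t'
      (base (Ret (ovf True l)) eT dT (zt 1 (map dig (inc (q = accept M) True l)) []))"
    using carry_counter[OF ms0_ne, of "[]" "q = accept M" True l M False eT dT blank_tape blank_tape] by auto
  then show ?thesis
    using acc comp_path_trans[OF 1 comp_path_trans[OF 2 t'(2)]] t t' es(2)
    by (intro exI[of _ "t + (Suc (2 * length es + 1) + t')"]) auto
qed

lemma next_sample:
  assumes "\<not> ov \<or> scan dT \<noteq> Bit True" "l \<noteq> []"
  shows "sampler_path M (base (Ret ov) eT dT (zt 1 (map dig l) [])) [] 1
    (base (Sim False (start M)) eT (if ov then (fst dT, snd dT + 1) else dT)       (counter l []))"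
proof -
  let ?C = "zt 1 (map dig l) []"
  have ps: "step_at M (Ret ov) ms0 eT dT blank_tape blank_tape ?C =
    Det (Sim False (start M), pack (idle ms0)
      [keep eT, if ov then (scan dT, Move_R) else keep dT, keep blank_tape,
       keep blank_tape, (Blank, Move_L)])"
    using assms by (auto simp: phase_step_def)
  show ?thesis
    unfolding One_nat_def
    apply (rule sampler_stay[OF ps])
     apply (use ms0_ne in simp_all)[3]
    unfolding act_stay_scan act_counter
    by (cases ov) (simp_all add: act_move_scan comp_path.refl)
qed

lemma last_sample:
  assumes "scan dT = Bit True" "l \<noteq> []"
  shows "sampler_path M (base (Ret True) eT dT (zt 1 (map dig l) [])) [] 1
    (base (Left_End False) eT dT (counter l []))"
proof -
  let ?C = "zt 1 (map dig l) []"
  have ps: "step_at M (Ret True) ms0 eT dT blank_tape blank_tape ?C =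
    Det (Left_End False, pack (idle ms0)
      [keep eT, keep dT, keep blank_tape, keep blank_tape, (Blank, Move_L)])"
    using assms by (auto simp: phase_step_def)
  show ?thesis
    unfolding One_nat_def
    apply (rule sampler_stay[OF ps])
     apply (use ms0_ne in simp_all)[3]
    unfolding act_stay_scan act_counter by (rule comp_path.refl)
qed

text \<open>The head on the tape of \<delta> advances once per 2^W runs, which is the invariant
  \<open>dval l div 2 ^ W\<close>. Sampling stops at the first overflow that finds it on a 1, that
  is, on cell \<open>J\<close> after (J + 1) 2^W runs. The assumption n \<le> dval l bounds the
  length of the counter.\<close>

lemma sample_loop:
  fixes g :: "int \<Rightarrow> nat sym"
  assumes J: "g (int J) = Bit True" "\<And>i. i < J \<Longrightarrow> g (int i) \<noteq> Bit True"
    and K: "K = (J + 1) * 2 ^ W"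
  shows "length bs = r * p \<Longrightarrow> r \<noteq> 0 \<Longrightarrow> dval l + r = K \<Longrightarrow> l \<noteq> [] \<Longrightarrow>
    map (snd \<circ> snd) l = replicate W True @ replicate n False \<Longrightarrow> n \<le> dval l \<Longrightarrow>
    \<exists>t l'. t \<le> r * (3 * T + 2 * (W + K) + 7) \<and> length l' \<le> W + K \<and> l' \<noteq> [] \<and>
      dval l' = K \<and> xval l' = xval l + hits accepting p r bs \<and>
      sampler_path M
        (base (Sim False (start M)) eT (g, int (dval l div 2 ^ W)) (counter l [])) bs t
        (base (Left_End False) eT (g, int J) (counter l' []))"
proof (induction r arbitrary: bs l n)
  case (Suc r)
  let ?u = "dval l div 2 ^ W" and ?b = "take p bs \<in> accepting"
  let ?l = "inc ?b True l"
  have len: "length l = W + n"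
    using Suc.prems(5) by (metis length_append length_map length_replicate)
  have pl: "length (take p bs) = p" "length (drop p bs) = r * p"
    using Suc.prems(1) by auto
  obtain t where t: "t \<le> 3 * T + 2 * length l + 6" "sampler_path M
    (base (Sim False (start M)) eT (g, int ?u) (counter l [])) (take p bs) t
    (base (Ret (ovf True l)) eT (g, int ?u) (zt 1 (map dig ?l) []))"
    using sample_run[OF pl(1), of l eT "(g, int ?u)"] by blast
  have ovf: "ovf True l \<longleftrightarrow> 2 ^ W dvd dval l + 1"
    using ovf_iff[OF Suc.prems(5)] by simp
  obtain n' where n': "n' \<le> Suc n" "map (snd \<circ> snd) ?l = replicate W True @ replicate n' False"
    using marks_inc[OF Suc.prems(5)] by blast
  have len': "length ?l = W + n'"
    using n'(2) by (metis length_append length_map length_replicate)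
  have ne: "?l \<noteq> []" using Suc.prems(4) by (cases l) auto
  have dv: "dval ?l = dval l + 1" by (simp add: dval_inc)
  have xv: "xval ?l + hits accepting p r (drop p bs) = xval l + hits accepting p (Suc r) bs"
    by (simp add: xval_inc)
  have nK: "n' \<le> K" "n \<le> K" using n'(1) Suc.prems(3,6) by auto
  have div: "(dval l + 1) div 2 ^ W = (if ovf True l then ?u + 1 else ?u)"
    using ovf div_Suc[of "dval l" "2 ^ W"] by (simp add: dvd_eq_mod_eq_0)
  have step: "t + 1 \<le> 3 * T + 2 * (W + K) + 7" using t(1) len nK by simp
  show ?case
  proof (cases "r = 0")
    case True
    then have K': "dval l + 1 = K" using Suc.prems(3) by simp
    then have o: "ovf True l" using ovf K by simp
    have "Suc ?u = J + 1" using div o K' K by simp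
    then have uJ: "?u = J" by simp
    then have "scan (g, int ?u) = Bit True" using J by (simp add: scan_def)
    from last_sample[OF this ne, of eT] comp_path_trans[OF t(2)] o
    have "sampler_path M
      (base (Sim False (start M)) eT (g, int ?u) (counter l [])) (take p bs) (t + 1)
      (base (Left_End False) eT (g, int J) (counter ?l []))"
      using uJ by fastforce
    moreover have "take p bs = bs" using Suc.prems(1) True by simp
    ultimately show ?thesis
      using step ne dv K' xv True len' nK by (intro exI[of _ "t + 1"] exI[of _ ?l]) auto
  next
    case False
    have "dval l + 1 < K" using Suc.prems(3) False by simp
    then have "(dval l + 1) div 2 ^ W < J + 1"
      unfolding K by (simp add: div_less_iff_less_mult)
    \<comment> \<open>If this run overflows, the new quotient ?u + 1 is at most \<open>J\<close>, so
      the scanned cell ?u lies before the first 1 and sampling goes on.\<close>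
    then have "ovf True l \<Longrightarrow> ?u < J" using div by simp
    then have c: "\<not> ovf True l \<or> scan (g, int ?u) \<noteq> Bit True"
      using J by (auto simp: scan_def)
    have d: "(if ovf True l then (fst (g, int ?u), snd (g, int ?u) + 1) else (g, int ?u)) =
      (g, int (dval ?l div 2 ^ W))"
      using div dv by simp
    obtain t' l' where t': "t' \<le> r * (3 * T + 2 * (W + K) + 7)" "length l' \<le> W + K" "l' \<noteq> []"
      "dval l' = K" "xval l' = xval ?l + hits accepting p r (drop p bs)"
      "sampler_path M
        (base (Sim False (start M)) eT (g, int (dval ?l div 2 ^ W)) (counter ?l [])) (drop p bs) t'
        (base (Left_End False) eT (g, int J) (counter l' []))"
      using Suc.IH[OF pl(2) False _ ne n'(2)] Suc.prems(3,6) dv n'(1) by auto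
    have "sampler_path M
        (base (Sim False (start M)) eT (g, int ?u) (counter l []))
        (take p bs @ [] @ drop p bs) (t + (1 + t'))
        (base (Left_End False) eT (g, int J) (counter l' []))"
      by (rule comp_path_trans[OF t(2) comp_path_trans[OF next_sample[OF c ne, unfolded d] t'(6)]])
    then show ?thesis
      using t' xv step by (intro exI[of _ "t + (1 + t')"] exI[of _ l']) auto
  qed
qed simp

text \<open>The bits \<open>bs\<close> drive the printing run. Its verdict is ignored and its steps
  are not undone, so the final tapes of \<open>M\<close> and the log are left unspecified.\<close>

lemma output_run:
  assumes "length bs = p" "l \<noteq> []"
  shows "\<exists>t ms lT cT. t \<le> T + 4 * length l + 5 \<and> ms \<noteq> [] \<and> sampler_path M
    (base (Left_End False) eT dT (counter l [])) bs t
    (conf Accept ms eT dT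
      (zt (int (2 * length l + p + 1))
        (rev (map Bit (map (digit_of False) (rev l) @ replicate p False) @ Slash #
          map Bit (map (digit_of True) (rev l)))) []) lT cT)"
proof -
  obtain r R where l: "l = r # R" using assms by (cases l) auto
  have C: "counter l [] = zt 0 (map dig R) (map dig [r])" by (simp add: counter_def l)
  have 1: "sampler_path M
    (base (Left_End False) eT dT (counter l [])) [] (length R + 2)
    (base (Print False) eT dT (zt (- int (length R)) [] (map dig (rev l))))"
    using left_end_run[OF ms0_ne, of M False eT dT blank_tape blank_tape 0 R r "[]"] unfolding C by (simp add: l)
  let ?o1 = "rev (map (Bit \<circ> digit_of False) (rev l))"
  let ?R1 = "zt (int (length l)) ?o1 []"
  have 2: "sampler_path M
    (base (Print False) eT dT (zt (- int (length R)) [] (map dig (rev l)))) []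
      (length l)
    (conf (Print False) ms0 eT dT ?R1 blank_tape (zt 1 (map dig l) []))"
    using print_run[OF ms0_ne, of M False eT dT 0 "[]" blank_tape "- int (length R)" "[]" "rev l"]
    by (simp add: rev_map l)
  have ps: "step_at M (Print False) ms0 eT dT ?R1 blank_tape (zt 1 (map dig l) []) =
    Det (Sim True (start M), pack (idle ms0)
      [keep eT, keep dT, keep ?R1, keep blank_tape, keep (zt 1 (map dig l) [])])"
    by (simp add: phase_step_def)
  have 3: "sampler_path M
    (conf (Print False) ms0 eT dT ?R1 blank_tape (zt 1 (map dig l) [])) [] (Suc 0)
    (conf (Sim True (start M)) ms0 eT dT ?R1 blank_tape (zt 1 (map dig l) []))"
    apply (rule sampler_stay[OF ps])
     apply (use ms0_ne in simp_all)[3]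
    unfolding act_stay_scan by (rule comp_path.refl)
  obtain t q ts es where t: "t \<le> T" "q = accept M \<or> q = reject M" and len: "ts \<noteq> []"
    and sim: "simulates M (start M, ms0) bs t (q, ts) es"
    by (rule simulate_input[OF assms(1)]) (rule that; assumption)
  let ?o2 = "replicate p (Bit False) @ ?o1"
  let ?R2 = "zt (int (length l + p)) ?o2 []" and ?L = "zt (int t) (map ent es) []"
  have 4: "sampler_path M
        (conf (Sim True (start M)) ms0 eT dT ?R1 blank_tape (zt 1 (map dig l) [])) bs t
        (conf (Sim True q) ts eT dT ?R2 ?L (zt 1 (map dig l) []))"
    using simulates_path[OF sim, of True eT dT "int (length l)" ?o1] assms(1) by simp
  have ps: "step_at M (Sim True q) ts eT dT ?R2 ?L (zt 1 (map dig l) []) =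
    Det (Left_End True, pack (idle ts)
      [keep eT, keep dT, (Slash, Move_R), keep ?L, (Blank, Move_L)])"
    using t(2) by (auto simp: phase_step_def)
  let ?R3 = "zt (int (length l + p) + 1) (Slash # ?o2) []"
  have R3: "act_tape (Slash, Move_R) ?R2 = ?R3" by (simp add: act_zt)
  have 5: "sampler_path M (conf (Sim True q) ts eT dT ?R2 ?L (zt 1 (map dig l) [])) []
      (Suc (length R + 2))
      (conf (Print True) ts eT dT ?R3 ?L (zt (- int (length R)) [] (map dig (rev l))))"
    apply (rule sampler_stay[OF ps])
     apply (use len in simp_all)[3]
    unfolding act_stay_scan act_counter C R3
    using left_end_run[OF len, of M True eT dT ?R3 ?L 0 R r "[]"] by (simp add: l)
  let ?o4 = "rev (map (Bit \<circ> digit_of True) (rev l)) @ Slash # ?o2"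
  let ?R4 = "zt (int (2 * length l + p + 1)) ?o4 []"
  have 6: "sampler_path M
    (conf (Print True) ts eT dT ?R3 ?L (zt (- int (length R)) [] (map dig (rev l)))) []
      (length l)
    (conf (Print True) ts eT dT ?R4 ?L (zt 1 (map dig l) []))"
    using print_run[OF len, of M True eT dT "int (length l + p) + 1" "Slash # ?o2" ?L "- int (length R)" "[]" "rev l"]
    by (simp add: rev_map l algebra_simps)
  have ps: "step_at M (Print True) ts eT dT ?R4 ?L (zt 1 (map dig l) []) =
    Det (Accept, pack (idle ts)
      [keep eT, keep dT, keep ?R4, keep ?L, keep (zt 1 (map dig l) [])])"
    by (simp add: phase_step_def)
  have 7: "sampler_path M
    (conf (Print True) ts eT dT ?R4 ?L (zt 1 (map dig l) [])) [] (Suc 0)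
    (conf Accept ts eT dT ?R4 ?L (zt 1 (map dig l) []))"
    apply (rule sampler_stay[OF ps])
     apply (use len in simp_all)[3]
    unfolding act_stay_scan by (rule comp_path.refl)
  have o4: "?o4 = rev (map Bit (map (digit_of False) (rev l) @ replicate p False) @ Slash #
          map Bit (map (digit_of True) (rev l)))"
    by (simp add: rev_map)
  note all = comp_path_trans[OF 1 comp_path_trans[OF 2 comp_path_trans[OF 3 comp_path_trans[OF 4
    comp_path_trans[OF 5 comp_path_trans[OF 6 7]]]]]]
  show ?thesis
    using all len t(1) unfolding o4
    by (intro exI[of _ "length R + 2 + (length l + (Suc 0 + (t + (Suc (length R + 2) + (length l + Suc 0)))))"]
        exI[of _ ts] exI[of _ ?L] exI[of _ "zt 1 (map dig l) []"]) (simp add: l)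
qed

end

section \<open>Accuracy and running time of sampling\<close>

text \<open>If r \<ge> 1, the expansion begins with a 1 and j = 0. Otherwise cell 0 holds the point,
  cell i the i-th fractional digit, and j is least with r 2^j \<ge> 1; minimality gives 2^j \<le> 2
  / r. The summand 1 in the last bound covers the case j = 0.\<close>

lemma real_tape_first_one:
  assumes "r > 0"
  shows "\<exists>j. (real_tape r (int j) :: 'a sym) = Bit True \<and>
    (\<forall>i<j. (real_tape r (int i) :: 'a sym) \<noteq> Bit True) \<and> 1 / 2 ^ j \<le> r \<and> 2 ^ j \<le> 1 + 2 / r"
proof -
  define m where "m = (LEAST m. r < 2 ^ m)"
  obtain m0 where "r < 2 ^ m0"
    using real_arch_pow[of 2 r] by auto
  then have m: "r < 2 ^ m" unfolding m_def by (rule LeastI)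
  have m_least: "2 ^ i \<le> r" if "i < m" for i
    using not_less_Least[of i "\<lambda>m. r < 2 ^ m"] that by (auto simp: m_def)
  have tape: "real_tape r i = (if i < 0 then Blank else if i < int m then Bit (binary_digit r (int m - 1 - i))
      else if i = int m then Point else Bit (binary_digit r (int m - i)))" for i
    unfolding real_tape_def Let_def m_def by simp
  show ?thesis
  proof (cases "m = 0")
    case False
    then obtain m' where m': "m = Suc m'" by (cases m) auto
    have "\<lfloor>r / 2 ^ m'\<rfloor> = 1"
      using m m_least[of m'] by (auto simp: m' floor_eq_iff field_simps)
    then have "real_tape r (int 0) = Bit True"
      by (simp add: tape m' binary_digit_def)
    moreover have "1 \<le> r" using m_least[of 0] False by simp
    ultimately show ?thesis using assms by (intro exI[of _ 0]) simp
  next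
    case True
    then have "r < 1" using m by simp
    obtain j0 where "1 / r < 2 ^ j0" using real_arch_pow[of 2 "1 / r"] by auto
    then have ex: "1 \<le> r * 2 ^ j0" using assms by (simp add: field_simps)
    define j where "j = (LEAST j. 1 \<le> r * 2 ^ j)"
    have j: "1 \<le> r * 2 ^ j" unfolding j_def using ex by (rule LeastI)
    have j_least: "r * 2 ^ i < 1" if "i < j" for i
      using not_less_Least[of i "\<lambda>j. 1 \<le> r * 2 ^ j"] that by (auto simp: j_def)
    have "j \<noteq> 0" using j \<open>r < 1\<close> by (intro notI) simp
    then obtain j' where j': "j = Suc j'" by (cases j) auto
    have digit: "real_tape r (int i) = (if i = 0 then Point else Bit (odd \<lfloor>r * 2 ^ i\<rfloor>))" for i
      by (simp add: tape True binary_digit_def power_int_minus divide_inverse)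
    have "r * 2 ^ j' < 1" using j_least[of j'] j' by simp
    then have "\<lfloor>r * 2 ^ j\<rfloor> = 1" using j by (auto simp: floor_eq_iff j')
    then have "real_tape r (int j) = Bit True"
      using \<open>j \<noteq> 0\<close> by (simp add: digit)
    moreover have "real_tape r (int i) \<noteq> Bit True" if "i < j" for i
    proof -
      have "\<lfloor>r * 2 ^ i\<rfloor> = 0" using j_least[OF that] assms by (auto simp: floor_eq_iff)
      then show ?thesis by (simp add: digit)
    qed
    moreover have "2 ^ j \<le> 1 + 2 / r"
    proof -
      have "2 ^ j * r \<le> 2" using \<open>r * 2 ^ j' < 1\<close> by (simp add: j' algebra_simps)
      then have "2 ^ j \<le> 2 / r" using assms by (simp add: field_simps)
      then show ?thesis by simp
    qed
    moreover have "1 / 2 ^ j \<le> r" using j by (simp add: field_simps)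
    ultimately show ?thesis by blast
  qed
qed

lemma fst_zt_word: "fst (zt (int (length w)) (rev w) []) = word_tape w"
proof
  fix i
  show "fst (zt (int (length w)) (rev w) []) i = word_tape w i"
    by (auto simp: zt_def word_tape_def cells_def rev_nth nat_less_iff intro!: arg_cong[where f = "(!) w"])
qed

lemma hits_append: "length u = k * p \<Longrightarrow> hits A p k (u @ v) = hits A p k u"
  by (induction k arbitrary: u) auto

text \<open>The \<open>n\<close> additional bits will be those of the printing run.\<close>

lemma hits_binomial_prefix:
  "map_pmf (hits A p k) (bits (k * p + n)) = binomial_pmf k (card {bs \<in> A. length bs = p} / 2 ^ p)"
proof -
  have "map_pmf (hits A p k) (bits (k * p + n)) =
      bind_pmf (bits (k * p)) (\<lambda>u. map_pmf (\<lambda>v. hits A p k (u @ v)) (bits n))"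
    by (simp add: bits_add map_bind_pmf pmf.map_comp o_def)
  also have "\<dots> = bind_pmf (bits (k * p)) (\<lambda>u. map_pmf (\<lambda>v. hits A p k u) (bits n))"
    by (intro bind_pmf_cong HOL.refl map_pmf_cong) (auto simp: set_bits hits_append)
  also have "\<dots> = map_pmf (hits A p k) (bits (k * p))"
    by (simp add: map_pmf_def)
  finally show ?thesis by (simp add: hits_binomial)
qed

text \<open>For deviation q / 2^j Hoeffding's exponent is 2 K (q / 2^j)^2 = 8 (J + 1) q^2, at least
  2 (J + 1) because q^2 \<ge> 1/4; the last factor 4 of \<open>K\<close> pays for this 1/4. As exp
  (-2) \<le> 1/2, the two tails together have probability at most 2 / 2^(J + 1).\<close>

lemma binomial_relative_error:
  assumes q: "1 / 2 \<le> q" "q \<le> 1" and K: "K = (J + 1) * 2 ^ (2 * j + 2)"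
  shows "measure_pmf.prob (binomial_pmf K q) {X. \<bar>real X / real K - q\<bar> \<ge> q / 2 ^ j} \<le> 1 / 2 ^ J"
proof -
  have "binomial_distribution q" using q by unfold_locales auto
  then have bound: "measure_pmf.prob (binomial_pmf K q) {X. \<bar>real X / real K - q\<bar> \<ge> q / 2 ^ j} \<le>
      2 * exp (- 2 * real K * (q / 2 ^ j)\<^sup>2)"
    using binomial_distribution.prob_abs_ge'[of q K "q / 2 ^ j"] q K by simp
  have eq: "real K * (q / 2 ^ j)\<^sup>2 = 4 * (real J + 1) * q\<^sup>2"
    by (simp add: K power_add power_mult power_divide field_simps power2_eq_square power_mult_distrib[symmetric])
  have "- 2 * real K * (q / 2 ^ j)\<^sup>2 = - 2 * (real K * (q / 2 ^ j)\<^sup>2)" by simp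
  also have "\<dots> = - 8 * (real J + 1) * q\<^sup>2" unfolding eq by (simp add: algebra_simps)
  also have "\<dots> \<le> - 2 * (real J + 1)"
  proof -
    have "(1 / 2)\<^sup>2 \<le> q\<^sup>2" using q by (intro power_mono) auto
    then have "(real J + 1) * 1 \<le> (real J + 1) * (4 * q\<^sup>2)"
      by (intro mult_left_mono) (auto simp: power2_eq_square)
    then show ?thesis by (simp add: algebra_simps)
  qed
  finally have le: "- 2 * real K * (q / 2 ^ j)\<^sup>2 \<le> - 2 * (real J + 1)" .
  have "2 * exp (- 2 * (real J + 1)) \<le> 1 / 2 ^ J"
  proof -
    have "exp (- 2 * (real J + 1)) = exp (- 2) ^ Suc J"
      by (subst exp_of_nat_mult[symmetric]) (simp add: algebra_simps)
    also have "\<dots> \<le> (1 / 2) ^ Suc J"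
    proof (rule power_mono)
      have "(2 :: real) \<le> exp 2" using exp_ge_add_one_self[of 2] by simp
      then show "exp (- 2 :: real) \<le> 1 / 2" by (simp add: exp_minus field_simps)
    qed simp
    finally show ?thesis by (simp add: power_divide)
  qed
  then show ?thesis using bound le by (smt (verit) exp_le_cancel_iff)
qed

text \<open>Up to the first run 4 j + 5 steps, then \<open>K\<close> rounds, then the output, with 2
  j + 2 + K bounding the length of the counter throughout.\<close>

definition sampler_steps :: "nat \<Rightarrow> nat \<Rightarrow> nat \<Rightarrow> nat" where
  "sampler_steps j K T =
    4 * j + 5 + K * (3 * T + 2 * (2 * j + 2 + K) + 7) + T + 4 * (2 * j + 2 + K) + 5"

context sampling
begin

lemma approx_config_sampler:
  "approx_config (sampler M) x \<epsilon> \<delta> =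
    conf Setup1 ms0 (real_tape \<epsilon>, 0) (real_tape \<delta>, 0) blank_tape blank_tape blank_tape"
proof -
  obtain m where "tapes M = Suc m" using tapes by (cases "tapes M") auto
  then show ?thesis
    by (simp add: approx_config_def init_config_def sampler_sel ms0_def input_config_def pack_def
        numeral_eq_Suc zt_blank)
qed

abbreviation estimate :: "nat \<Rightarrow> bool list \<Rightarrow> real" where
  "estimate K bs \<equiv> real (hits accepting p K bs * 2 ^ p) / real K"

lemma sampler_run:
  assumes j: "real_tape \<epsilon> (int j) = (Bit True :: nat sym)"
      "\<And>i. i < j \<Longrightarrow> real_tape \<epsilon> (int i) \<noteq> (Bit True :: nat sym)"
    and J: "real_tape \<delta> (int J) = (Bit True :: nat sym)"
      "\<And>i. i < J \<Longrightarrow> real_tape \<delta> (int i) \<noteq> (Bit True :: nat sym)"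
    and W: "W = 2 * j + 2" and K: "K = (J + 1) * 2 ^ W"
    and len: "length bs = K * p + p"
  shows "\<exists>t c. t \<le> sampler_steps j K T \<and>
    sampler_path M (approx_config (sampler M) x \<epsilon> \<delta>) bs t c \<and> fst c = Accept \<and>
    returns c (estimate K bs)"
proof -
  let ?a = "(False, False, True)" and ?E = "(real_tape \<epsilon>, int j)"
  let ?l = "replicate W ?a"
  define u where "u = take (K * p) bs"
  define v where "v = drop (K * p) bs"
  have uv: "bs = u @ v" "length u = K * p" "length v = p"
    using len by (auto simp: u_def v_def)
  have 1: "sampler_path M (approx_config (sampler M) x \<epsilon> \<delta>) [] (2 * j + 2)
    (base (Ret False) ?E (real_tape \<delta>, 0)       (counter [?a] (replicate (2 * j + 1) ?a)))"
    using setup_run[of ms0 "real_tape \<epsilon>" j ?a 0, OF ms0_ne j HOL.refl] by (simp add: approx_config_sampler)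
  have 2: "sampler_path M (base (Ret False) ?E (real_tape \<delta>, 0)       (counter [?a] (replicate (2 * j + 1) ?a))) [] (2 * j + 2)
    (base (Ret False) ?E (real_tape \<delta>, 0) (zt 1 (map dig ?l) []))"
  proof -
    have "rev (replicate (2 * j + 1) ?a) @ [?a] = ?l"
      by (simp add: W replicate_append_same)
    then show ?thesis
      using return_counter[OF ms0_ne, of "[?a]" M False ?E "(real_tape \<delta>, 0)" blank_tape blank_tape
          "replicate (2 * j + 1) ?a"] by simp
  qed
  have ne: "?l \<noteq> []" by (simp add: W)
  have 3: "sampler_path M (base (Ret False) ?E (real_tape \<delta>, 0)       (zt 1 (map dig ?l) [])) [] 1
    (base (Sim False (start M)) ?E (real_tape \<delta>, 0) (counter ?l []))"
    using next_sample[of False "(real_tape \<delta>, 0)" ?l ?E] ne by simp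
  have zero: "horner_sum of_bool 2 (replicate n False) = (0 :: nat)" for n
    by (induction n) auto
  have l0: "dval ?l = 0" "xval ?l = 0"
    by (simp_all add: map_replicate_const[symmetric] digit_of_def zero)
  have "K \<noteq> 0" by (simp add: K)
  obtain t l' where t: "t \<le> K * (3 * T + 2 * (W + K) + 7)" "length l' \<le> W + K" "l' \<noteq> []"
    "dval l' = K" "xval l' = hits accepting p K u"
    and 4: "sampler_path M
        (base (Sim False (start M)) ?E (real_tape \<delta>, 0) (counter ?l [])) u t
        (base (Left_End False) ?E (real_tape \<delta>, int J) (counter l' []))"
    using sample_loop[of "real_tape \<delta>" J, OF J K uv(2) \<open>K \<noteq> 0\<close> _ ne, of 0 ?E] l0 by auto
  obtain t' ms lT cT where t': "t' \<le> T + 4 * length l' + 5" "ms \<noteq> []"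
    and 5: "sampler_path M
    (base (Left_End False) ?E (real_tape \<delta>, int J) (counter l' [])) v t'
    (conf Accept ms ?E (real_tape \<delta>, int J)
      (zt (int (2 * length l' + p + 1))
        (rev (map Bit (map (digit_of False) (rev l') @ replicate p False) @ Slash #
          map Bit (map (digit_of True) (rev l')))) []) lT cT)"
    using output_run[OF uv(3) t(3)] by blast
  define us where "us = map (digit_of False) (rev l') @ replicate p False"
  define vs where "vs = map (digit_of True) (rev l')"
  define w :: "nat sym list" where "w = map Bit us @ Slash # map Bit vs"
  define c where "c = conf Accept ms ?E (real_tape \<delta>, int J) (zt (int (2 * length l' + p + 1)) (rev w) []) lT cT"
  have lw: "length w = 2 * length l' + p + 1" by (simp add: w_def us_def vs_def)
  have path: "sampler_path M (approx_config (sampler M) x \<epsilon> \<delta>) ([] @ [] @ [] @ u @ v)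
      (2 * j + 2 + (2 * j + 2 + (1 + (t + t')))) c"
    by (rule comp_path_trans[OF 1 comp_path_trans[OF 2 comp_path_trans[OF 3 comp_path_trans[OF 4]]]])
      (use 5 in \<open>simp only: c_def w_def us_def vs_def\<close>)
  have "snd c ! 3 = zt (int (length w)) (rev w) []"
    unfolding lw by (simp add: c_def pack_def numeral_eq_Suc)
  then have tape: "fst (snd c ! 3) = word_tape w" by (simp add: fst_zt_word)
  \<comment> \<open>The most significant digit is printed first, so the \<open>p\<close> trailing
    zeros shift the number by \<open>p\<close> places.\<close>
  have "binary_value us = 2 ^ p * xval l'"
    by (simp add: binary_value_def us_def rev_map horner_sum_append zero)
  then have us: "binary_value us = hits accepting p K bs * 2 ^ p"
    using t(5) uv by (simp add: hits_append)
  have vs: "binary_value vs = K"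
    using t(4) by (simp add: binary_value_def vs_def rev_map)
  have "returns c (estimate K bs)"
    unfolding returns_def tape Let_def
    using \<open>K \<noteq> 0\<close> us vs by (intro exI[of _ us] exI[of _ vs]) (simp add: w_def)
  moreover have "fst c = Accept" by (simp add: c_def)
  ultimately show ?thesis
    using path t t' uv(1) by (intro exI[of _ "2 * j + 2 + (2 * j + 2 + (1 + (t + t')))"] exI[of _ c]) (auto simp: W sampler_steps_def)
qed

end

lemma approx_config_enc:
  "approx_config (enc_tm N) x \<epsilon> \<delta> =
    (to_nat (fst (approx_config N x \<epsilon> \<delta>)), snd (approx_config N x \<epsilon> \<delta>))"
  by (simp add: approx_config_def init_config_def enc_tm_def)

lemma enc_sel: "accept (enc_tm N) = to_nat (accept N)" "reject (enc_tm N) = to_nat (reject N)"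
  "tapes (enc_tm N) = tapes N" "start (enc_tm N) = to_nat (start N)"
  by (simp_all add: enc_tm_def)

lemma returns_snd: "snd c = snd c' \<Longrightarrow> returns c r \<longleftrightarrow> returns c' r"
  by (simp add: returns_def)

context sampling
begin

abbreviation N :: "(nat, nat) tm" where
  "N \<equiv> enc_tm (sampler M)"

lemma sampler_outcome:
  assumes "\<epsilon> > 0" "\<delta> > 0"
  obtains j J K F where "1 / 2 ^ j \<le> \<epsilon>" "2 ^ j \<le> 1 + 2 / \<epsilon>" "1 / 2 ^ J \<le> \<delta>" "2 ^ J \<le> 1 + 2 / \<delta>"
    "K = (J + 1) * 2 ^ (2 * j + 2)"
    "halts_within N (approx_config N x \<epsilon> \<delta>)
      (sampler_steps j K T)"
    "outcome N (approx_config N x \<epsilon> \<delta>) =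
      map_pmf F (bits (K * p + p))"
    "\<And>bs. length bs = K * p + p \<Longrightarrow> returns (F bs) (estimate K bs)"
proof -
  obtain j where j: "real_tape \<epsilon> (int j) = (Bit True :: nat sym)"
      "\<And>i. i < j \<Longrightarrow> real_tape \<epsilon> (int i) \<noteq> (Bit True :: nat sym)" "1 / 2 ^ j \<le> \<epsilon>" "2 ^ j \<le> 1 + 2 / \<epsilon>"
    using real_tape_first_one[OF assms(1)] by blast
  obtain J where J: "real_tape \<delta> (int J) = (Bit True :: nat sym)"
      "\<And>i. i < J \<Longrightarrow> real_tape \<delta> (int i) \<noteq> (Bit True :: nat sym)" "1 / 2 ^ J \<le> \<delta>" "2 ^ J \<le> 1 + 2 / \<delta>"
    using real_tape_first_one[OF assms(2)] by blast
  define K where "K = (J + 1) * 2 ^ (2 * j + 2)"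
  let ?S = "sampler_steps j K T"
  let ?c = "approx_config (sampler M) x \<epsilon> \<delta>"
  have "\<exists>c. length bs = K * p + p \<longrightarrow> (\<exists>t \<le> ?S. sampler_path M ?c bs t c \<and> halted (sampler M) c) \<and>
    returns c (estimate K bs)" for bs
    using sampler_run[of \<epsilon> j \<delta> J, OF j(1,2) J(1,2) HOL.refl K_def, of bs]
    unfolding halted_def sampler_sel by blast
  then obtain G where G: "\<And>bs. length bs = K * p + p \<Longrightarrow>
    (\<exists>t \<le> ?S. sampler_path M ?c bs t (G bs) \<and> halted (sampler M) (G bs)) \<and> returns (G bs) (estimate K bs)"
    by metis
  define F where "F bs = (to_nat (fst (G bs)), snd (G bs))" for bs
  have F: "\<exists>t\<le>?S. comp_path N (approx_config N x \<epsilon> \<delta>) bs t (F bs) \<and> halted N (F bs)"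
    if "length bs = K * p + p" for bs
    unfolding F_def approx_config_enc using G[OF that] by (intro enc_paths) blast
  have ret: "returns (F bs) (estimate K bs)" if "length bs = K * p + p" for bs
    using G[OF that] returns_snd[of "F bs" "G bs"] by (auto simp: F_def)
  note complete = complete_paths[of "K * p + p" ?S N "approx_config N x \<epsilon> \<delta>" F, OF F]
  have "outcome N (approx_config N x \<epsilon> \<delta>) = map_pmf F (bits (K * p + p))"
    using outcome_eq_run[OF complete(1)] complete(3)[OF _ order.refl] by simp
  then show ?thesis
    using that[OF j(3,4) J(3,4) K_def complete(1)] ret by blast
qed

lemma sampler_correct:
  assumes "\<epsilon> > 0" "\<delta> > 0" and a: "a = card {bs \<in> accepting. length bs = p}"
    and half: "a = 0 \<or> real a \<ge> 1 / 2 * 2 ^ p"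
  shows "measure_pmf.prob (outcome N (approx_config N x \<epsilon> \<delta>))
      {c. \<exists>r. returns c r \<and> (1 - \<epsilon>) * real a \<le> r \<and> r \<le> (1 + \<epsilon>) * real a} \<ge> 1 - \<delta>"
    and "a = 0 \<Longrightarrow> measure_pmf.prob (outcome N (approx_config N x \<epsilon> \<delta>))
      {c. returns c 0} = 1"
proof -
  obtain j J K F where j: "1 / 2 ^ j \<le> \<epsilon>" and J: "1 / 2 ^ J \<le> \<delta>"
    and K: "K = (J + 1) * 2 ^ (2 * j + 2)"
    and out: "outcome N (approx_config N x \<epsilon> \<delta>) =
      map_pmf F (bits (K * p + p))"
    and F: "\<And>bs. length bs = K * p + p \<Longrightarrow> returns (F bs) (estimate K bs)"
    by (rule sampler_outcome[OF assms(1,2)]) (rule that; assumption)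
  define q where "q = real a / 2 ^ p"
  have dist: "map_pmf (hits accepting p K) (bits (K * p + p)) = binomial_pmf K q"
    unfolding hits_binomial_prefix q_def a by simp
  have a_q: "real a = q * 2 ^ p" by (simp add: q_def)
  have "a \<le> 2 ^ p"
    using card_mono[OF finite_bit_lists[of p], of "{bs \<in> accepting. length bs = p}"] card_bit_lists[of p] a
    by auto
  then have q: "0 \<le> q" "q \<le> 1"
    using of_nat_mono[of a "2 ^ p", where 'a = real] by (simp_all add: q_def)
  have "K \<noteq> 0" by (simp add: K)
  \<comment> \<open>For q = 0 the binomial distribution is concentrated at 0, which makes the answer
    0 certain and not merely likely.\<close>
  have zero: "hits accepting p K bs = 0" if "a = 0" "length bs = K * p + p" for bs
  proof -
    have "hits accepting p K bs \<in> set_pmf (binomial_pmf K q)"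
      unfolding dist[symmetric] using that by (simp add: set_bits)
    moreover have "q = 0" using that by (simp add: q_def)
    ultimately show ?thesis by (simp add: set_pmf_binomial_0)
  qed
  show 2: "measure_pmf.prob (outcome N (approx_config N x \<epsilon> \<delta>))
      {c. returns c 0} = 1" if "a = 0"
  proof -
    have "AE c in outcome N (approx_config N x \<epsilon> \<delta>). returns c 0"
      unfolding out AE_measure_pmf_iff
      using F zero[OF that] by (fastforce simp: set_bits)
    then show ?thesis
      by (subst measure_pmf.prob_eq_1) auto
  qed
  show "measure_pmf.prob (outcome N (approx_config N x \<epsilon> \<delta>))
      {c. \<exists>r. returns c r \<and> (1 - \<epsilon>) * real a \<le> r \<and> r \<le> (1 + \<epsilon>) * real a} \<ge> 1 - \<delta>"
    (is "measure_pmf.prob ?O ?A \<ge> _")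
  proof (cases "a = 0")
    case True
    have "measure_pmf.prob ?O {c. returns c 0} \<le> measure_pmf.prob ?O ?A"
      using True by (intro measure_pmf.finite_measure_mono) auto
    then show ?thesis using 2[OF True] assms(2) by simp
  next
    case False
    then have q2: "1 / 2 \<le> q" using half by (simp add: q_def field_simps)
    let ?B = "{X. \<bar>real X / real K - q\<bar> \<ge> q / 2 ^ j}"
    have "returns (F bs) (estimate K bs) \<and>
      (1 - \<epsilon>) * real a \<le> estimate K bs \<and>
      estimate K bs \<le> (1 + \<epsilon>) * real a"
      if "length bs = K * p + p" "hits accepting p K bs \<notin> ?B" for bs
    proof -
      let ?X = "real (hits accepting p K bs)"
      have "\<bar>?X / real K - q\<bar> < q / 2 ^ j" using that by auto
      also have "\<dots> \<le> \<epsilon> * q" using j q mult_right_mono[of "1 / 2 ^ j" \<epsilon> q] by simp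
      finally have "(1 - \<epsilon>) * q \<le> ?X / real K" "?X / real K \<le> (1 + \<epsilon>) * q"
        by (simp_all add: algebra_simps abs_less_iff)
      from this[THEN mult_right_mono, of "2 ^ p"] show ?thesis
        using F[OF that(1)] by (simp add: a_q mult.assoc)
    qed
    \<comment> \<open>\<open>F\<close> is specified only on strings of the right length, so the
      event has to be restricted to the support of \<open>bits\<close>.\<close>
    then have sub: "{bs. length bs = K * p + p} \<inter> hits accepting p K -` (- ?B) \<subseteq> F -` ?A"
      by blast
    have "1 - \<delta> \<le> 1 - 1 / 2 ^ J" using J by simp
    also have "\<dots> \<le> 1 - measure_pmf.prob (binomial_pmf K q) ?B"
      using binomial_relative_error[OF q2 q(2) K] by simp
    also have "\<dots> = measure_pmf.prob (binomial_pmf K q) (- ?B)"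
      using measure_pmf.prob_compl[of ?B "binomial_pmf K q"] by (simp add: Compl_eq_Diff_UNIV)
    also have "\<dots> = measure_pmf.prob (bits (K * p + p)) (hits accepting p K -` (- ?B))"
      by (simp add: dist[symmetric])
    also have "\<dots> = measure_pmf.prob (bits (K * p + p))
        ({bs. length bs = K * p + p} \<inter> hits accepting p K -` (- ?B))"
      by (subst measure_Int_set_pmf[symmetric]) (simp add: set_bits Int_commute)
    also have "\<dots> \<le> measure_pmf.prob (bits (K * p + p)) (F -` ?A)"
      using sub by (intro measure_pmf.finite_measure_mono) auto
    also have "\<dots> = measure_pmf.prob ?O ?A" by (simp add: out)
    finally show ?thesis .
  qed
qed

end

section \<open>Time bound and the first inclusion\<close>

lemma nptm_sampling:
  assumes "nptm M p" "\<And>x. halts_within M (input_config M x) (T (length x))"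
  obtains final where "sampling M x (p (length x)) (T (length x)) final"
    "acc M x = card {bs. fst (final bs) = accept M \<and> length bs = p (length x)}"
proof -
  let ?p = "p (length x)" and ?T = "T (length x)"
  have wf: "wf_tm M" "tapes M \<ge> 1"
    and len: "\<And>bs t c. comp_path M (input_config M x) bs t c \<Longrightarrow> halted M c \<Longrightarrow> length bs = ?p"
    using assms(1) unfolding nptm_def by blast+
  have "\<exists>t\<le>?T. \<exists>c. comp_path M (input_config M x) bs t c \<and> halted M c" if "length bs = ?p" for bs
    by (rule nptm_paths_complete[OF assms(2) len that])
  then have "\<exists>c. length bs = ?p \<longrightarrow> (\<exists>t\<le>?T. comp_path M (input_config M x) bs t c \<and> halted M c)" for bs
    by blast
  then obtain final where final: "\<And>bs. length bs = ?p \<Longrightarrow>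
      \<exists>t\<le>?T. comp_path M (input_config M x) bs t (final bs) \<and> halted M (final bs)"
    by metis
  have "sampling M x ?p ?T final"
    using wf final by unfold_locales
  moreover have "acc M x = card {bs. fst (final bs) = accept M \<and> length bs = ?p}"
    by (rule acc_eq_card[OF final])
  ultimately show ?thesis using that by blast
qed

lemma log_bound:
  fixes \<delta> :: real
  assumes "\<delta> > 0" "2 ^ J \<le> 1 + 2 / \<delta>"
  shows "real J \<le> 2 + max 0 (log 2 (1 / \<delta>))"
proof -
  let ?m = "max 1 (1 / \<delta>)"
  \<comment> \<open>The left side is at most 3 times the maximum; rounding 3 up to 4 makes the
    logarithm of the constant equal to 2.\<close>
  have "(2 :: real) ^ J \<le> 4 * ?m" using assms(2) by auto
  then have "log 2 (2 ^ J) \<le> log 2 (4 * ?m)"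
    by (subst log_le_cancel_iff) auto
  also have "log 2 (4 * ?m) = 2 + log 2 ?m"
    using log_pow_cancel[of 2 2] by (subst log_mult) auto
  also have "log 2 ?m = max 0 (log 2 (1 / \<delta>))"
    using assms(1) by (cases "1 / \<delta> \<le> 1") (auto simp: max_def)
  finally show ?thesis by simp
qed

text \<open>With z = 1 + n + 1 / \<epsilon> + max 0 (log 2 (1 / \<delta>)) one has 2^j \<le> 2 z and
  J + 1 \<le> 3 z, hence K is at most 3 z times 16 z^2, that is 48 z^3. The polynomial results from
  inserting these bounds into \<open>sampler_steps\<close>.\<close>

lemma sampler_time:
  assumes T: "\<And>n. real (T n) = poly P (real n)"
  shows "\<exists>Q. \<forall>n \<epsilon> \<delta> j J K. \<epsilon> > 0 \<longrightarrow> \<delta> > 0 \<longrightarrow> (2 :: real) ^ j \<le> 1 + 2 / \<epsilon> \<longrightarrow> (2 :: real) ^ J \<le> 1 + 2 / \<delta> \<longrightarrow>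
    K = (J + 1) * 2 ^ (2 * j + 2) \<longrightarrow>
    real (sampler_steps j K (T n)) \<le>
      poly Q (real n + 1 / \<epsilon> + max 0 (log 2 (1 / \<delta>)))"
proof -
  obtain C e where C: "C \<ge> 0" "\<And>u y. 0 \<le> u \<Longrightarrow> u \<le> y \<Longrightarrow> poly P u \<le> C * (1 + y) ^ e"
    using poly_growth[of P] by blast
  define Z :: "real poly" where "Z = [:1, 1:]"
  let ?K = "[:48:] * Z ^ 3" and ?T = "[:C:] * Z ^ e"
  let ?Q = "[:8:] * Z + [:5:] + ?K * ([:3:] * ?T + [:2:] * ([:6:] * Z + ?K) + [:7:]) + ?T +
    [:4:] * ([:6:] * Z + ?K) + [:5:]"
  show ?thesis
  proof (intro exI[of _ ?Q] allI impI)
    fix n :: nat and \<epsilon> \<delta> :: real and j J K :: nat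
    assume \<epsilon>: "\<epsilon> > 0" and \<delta>: "\<delta> > 0" and j: "(2 :: real) ^ j \<le> 1 + 2 / \<epsilon>"
      and J: "(2 :: real) ^ J \<le> 1 + 2 / \<delta>" and K: "K = (J + 1) * 2 ^ (2 * j + 2)"
    let ?L = "max 0 (log 2 (1 / \<delta>))"
    let ?y = "real n + 1 / \<epsilon> + ?L"
    define z where "z = 1 + ?y"
    have z: "1 \<le> z" using \<epsilon> by (simp add: z_def)
    have pow: "(2 :: real) ^ j \<le> 2 * z" using j \<epsilon> by (simp add: z_def)
    have "real j \<le> 2 ^ j" using of_nat_less_two_power[of j, where 'a = real] by simp
    then have jz: "real j \<le> 2 * z" using pow by linarith
    have "real J \<le> 2 + ?L" using log_bound[OF \<delta> J] .
    moreover have "1 + ?L \<le> z" using \<epsilon> by (simp add: z_def)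
    ultimately have Jz: "real (J + 1) \<le> 3 * z" by simp
    have "(2 :: real) ^ (2 * j + 2) = 4 * (2 ^ j) ^ 2"
      by (simp add: power_add power_mult[symmetric] mult.commute)
    also have "\<dots> \<le> 4 * (2 * z) ^ 2" using pow by (intro mult_left_mono power_mono) auto
    finally have "(2 :: real) ^ (2 * j + 2) \<le> 16 * z ^ 2" by (simp add: power2_eq_square)
    then have "real K \<le> (3 * z) * (16 * z ^ 2)"
      unfolding K of_nat_mult using Jz z by (intro mult_mono) auto
    then have Kz: "real K \<le> 48 * z ^ 3" by (simp add: power2_eq_square power3_eq_cube)
    have Tz: "real (T n) \<le> C * z ^ e"
      unfolding T z_def using \<epsilon> by (intro C(2)) auto
    have j4: "4 * real j \<le> 8 * z" using jz by simp
    have W: "real (2 * j + 2) \<le> 6 * z" using jz z by simp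
    have "real (sampler_steps j K (T n)) =
      4 * real j + 5 + real K * (3 * real (T n) + 2 * (real (2 * j + 2) + real K) + 7) + real (T n) +
        4 * (real (2 * j + 2) + real K) + 5" by (simp add: sampler_steps_def)
    also have "\<dots> \<le> 8 * z + 5 + (48 * z ^ 3) * (3 * (C * z ^ e) + 2 * (6 * z + 48 * z ^ 3) + 7) + C * z ^ e +
        4 * (6 * z + 48 * z ^ 3) + 5"
      by (intro add_mono j4 Kz Tz W mult_mono order.refl) (use jz z C(1) in auto)
    also have "\<dots> = poly ?Q ?y" by (simp add: z_def Z_def)
    finally show "real (sampler_steps j K (T n)) \<le>
      poly ?Q ?y" .
  qed
qed

lemma sharpRP1_subset_FPRAS': "sharpRP1 \<subseteq> FPRAS'"
proof
  fix f assume "f \<in> sharpRP1"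
  then obtain M p where f: "f \<in> sharpP" and M: "nptm M p" "\<And>x. f x = acc M x"
    and half: "\<And>x. acc M x = 0 \<or> real (acc M x) > 1 / 2 * 2 ^ p (length x)"
    by (auto simp: sharpRP1_def MR_def)
  obtain T P where T: "\<And>x. halts_within M (input_config M x) (T (length x))"
    and P: "\<And>n. real (T n) = poly P (real n)"
    using M(1) unfolding nptm_def is_polynomial_def by blast
  let ?N = "enc_tm (sampler M)"
  have wf: "wf_tm M" "tapes M \<ge> 1" using M(1) by (auto simp: nptm_def)
  have N: "wf_tm ?N" "tapes ?N \<ge> 4"
    using wf_enc[OF wf_sampler[OF wf]] wf by (simp_all add: enc_sel sampler_sel)
  obtain Q where Q: "\<And>n \<epsilon> \<delta> j J K. \<epsilon> > 0 \<Longrightarrow> \<delta> > 0 \<Longrightarrow> (2 :: real) ^ j \<le> 1 + 2 / \<epsilon> \<Longrightarrow>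
    (2 :: real) ^ J \<le> 1 + 2 / \<delta> \<Longrightarrow> K = (J + 1) * 2 ^ (2 * j + 2) \<Longrightarrow>
    real (sampler_steps j K (T n)) \<le>
      poly Q (real n + 1 / \<epsilon> + max 0 (log 2 (1 / \<delta>)))"
    using sampler_time[of T P, OF P] by blast
  have time: "\<exists>S. halts_within ?N (approx_config ?N x \<epsilon> \<delta>) S \<and>
      real S \<le> poly Q (real (length x) + 1 / \<epsilon> + max 0 (log 2 (1 / \<delta>)))"
    if "\<epsilon> > 0 \<and> \<delta> > 0" for x \<epsilon> \<delta>
  proof -
    obtain final where "sampling M x (p (length x)) (T (length x)) final"
      using nptm_sampling[OF M(1) T] by blast
    moreover have "\<epsilon> > 0" "\<delta> > 0" using that by auto
    ultimately show ?thesis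
      by (rule sampling.sampler_outcome) (use Q that in blast)
  qed
  have correct: "measure_pmf.prob (outcome ?N (approx_config ?N x \<epsilon> \<delta>))
      {c. \<exists>r. returns c r \<and> (1 - \<epsilon>) * real (f x) \<le> r \<and> r \<le> (1 + \<epsilon>) * real (f x)} \<ge> 1 - \<delta>"
      (is "?P x \<epsilon> \<delta>")
    "f x = 0 \<Longrightarrow> measure_pmf.prob (outcome ?N (approx_config ?N x \<epsilon> \<delta>)) {c. returns c 0} = 1"
      (is "_ \<Longrightarrow> ?Q x \<epsilon> \<delta>")
    if "\<epsilon> > 0 \<and> \<delta> > 0" for x \<epsilon> \<delta>
  proof -
    obtain final where s: "sampling M x (p (length x)) (T (length x)) final"
      and "acc M x = card {bs. fst (final bs) = accept M \<and> length bs = p (length x)}"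
      using nptm_sampling[OF M(1) T] by blast
    then have a: "f x = card {bs \<in> sampling.accepting M final. length bs = p (length x)}"
      by (simp add: M(2) sampling.accepting_def[OF s])
    have h: "f x = 0 \<or> real (f x) \<ge> 1 / 2 * 2 ^ p (length x)"
      using half[of x] by (auto simp: M(2))
    show "?P x \<epsilon> \<delta>" "f x = 0 \<Longrightarrow> ?Q x \<epsilon> \<delta>"
      using sampling.sampler_correct[OF s _ _ a h, of \<epsilon> \<delta>] that by auto
  qed
  have "approximates ?N f"
    unfolding approximates_def using N time correct(1) by blast
  then show "f \<in> FPRAS'"
    unfolding FPRAS'_def FPRAS_def using f correct(2) by blast
qed

section \<open>The deciding machine\<close>

text \<open>A clock of \<open>d\<close> tapes counts to \<open>(n + 2) ^ d - 1\<close>: the head positions are the digits of a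
  number to base \<open>n + 2\<close>, and the digits alternate in direction as in a reflected Gray code,
  so that every tick moves a single head by one cell. The cells \<open>0\<close> and \<open>n + 1\<close> are marked
  by \<open>Slash\<close> and \<open>Point\<close>.\<close>

fun tick :: "bool list \<Rightarrow> 'a sym list \<Rightarrow> (bool list \<times> dir list) option" where
  "tick (d # ds) (s # ss) =
    (if s = (if d then Point else Slash) then
       map_option (\<lambda>(ds', mv). ((\<not> d) # ds', Stay # mv)) (tick ds ss)
     else Some (d # ds, (if d then Move_R else Move_L) # replicate (length ds) Stay))"
| "tick _ _ = None"

definition clock_tape :: "nat \<Rightarrow> nat \<Rightarrow> nat tape" where
  "clock_tape n p = (\<lambda>i. if i = 0 then Slash else if i = int n + 1 then Point else Blank, int p)"

text \<open>The number whose digits to base n + 2 are the distances of the heads from the ends they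
  move to. Reversing an exhausted digit sets its distance to n + 1, just as borrowing does in a
  decrement.\<close>

fun ticks_left :: "nat \<Rightarrow> bool list \<Rightarrow> nat list \<Rightarrow> nat" where
  "ticks_left n (d # ds) (p # ps) = (if d then n + 1 - p else p) + (n + 2) * ticks_left n ds ps"
| "ticks_left n _ _ = 0"

lemma length_tick:
  "tick ds ss = Some (ds', mv) \<Longrightarrow> length ss = length ds \<Longrightarrow>
    length ds' = length ds \<and> length mv = length ds"
proof (induction ds ss arbitrary: ds' mv rule: tick.induct)
  case (1 d ds s ss)
  then show ?case by (fastforce split: if_splits)
qed auto

lemma scan_clock_tape: "scan (clock_tape n p) = (if p = 0 then Slash else if p = n + 1 then Point else Blank)"
  by (auto simp: clock_tape_def scan_def)

lemma act_clock_tape: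
  "act_tape (scan (clock_tape n p), Stay) (clock_tape n p) = clock_tape n p"
  "act_tape (scan (clock_tape n p), Move_R) (clock_tape n p) = clock_tape n (Suc p)"
  "p \<noteq> 0 \<Longrightarrow> act_tape (scan (clock_tape n p), Move_L) (clock_tape n p) = clock_tape n (p - 1)"
  by (auto simp: clock_tape_def scan_def act_tape.simps)

abbreviation marks :: "nat \<Rightarrow> nat list \<Rightarrow> nat sym list" where
  "marks n ps \<equiv> map (scan \<circ> clock_tape n) ps"

abbreviation in_range :: "nat \<Rightarrow> nat list \<Rightarrow> bool" where
  "in_range n ps \<equiv> \<forall>p\<in>set ps. p \<le> n + 1"

lemma tick_None:
  "length ds = length ps \<Longrightarrow> in_range n ps \<Longrightarrow> ticks_left n ds ps = 0 \<Longrightarrow>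
    tick ds (marks n ps) = None"
  by (induction ds ps rule: list_induct2) (auto simp: scan_clock_tape split: if_splits)

lemma tick_Some:
  "length ds = length ps \<Longrightarrow> in_range n ps \<Longrightarrow> ticks_left n ds ps = Suc r \<Longrightarrow>
    \<exists>ds' mv ps'. tick ds (marks n ps) = Some (ds', mv) \<and>
      length ds' = length ps' \<and> length ps' = length ps \<and> length mv = length ps \<and>
      (in_range n ps') \<and> ticks_left n ds' ps' = r \<and>
      map2 act_tape (zip (marks n ps) mv) (map (clock_tape n) ps) =
        map (clock_tape n) ps'"
proof (induction ds ps arbitrary: r rule: list_induct2)
  case (Cons d ds p ps)
  have stays: "map2 act_tape (zip (marks n ps) (replicate (length ps) Stay))
      (map (clock_tape n) ps) = map (clock_tape n) ps"
    by (induction ps) (simp_all add: act_clock_tape)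
  show ?case
  proof (cases "p = (if d then n + 1 else 0)")
    case False
    have "scan (clock_tape n p) \<noteq> (if d then Point else Slash)"
      using False Cons.prems(1) by (cases d) (auto simp: scan_clock_tape)
    moreover have "act_tape (scan (clock_tape n p), if d then Move_R else Move_L) (clock_tape n p) =
        clock_tape n (if d then Suc p else p - 1)"
      using False by (cases d) (auto simp: act_clock_tape)
    ultimately show ?thesis
      using False Cons.prems Cons.hyps stays[unfolded o_def]
      by (intro exI[of _ "d # ds"] exI[of _ "(if d then Move_R else Move_L) # replicate (length ds) Stay"]
          exI[of _ "(if d then Suc p else p - 1) # ps"])
        (auto simp: o_def split: if_splits)
  next
    case True
    then have eq: "(n + 2) * ticks_left n ds ps = Suc r"
      using Cons.prems by (auto split: if_splits)
    then obtain r' where r': "ticks_left n ds ps = Suc r'"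
      by (cases "ticks_left n ds ps") auto
    have "in_range n ps" using Cons.prems(1) by simp
    from Cons.IH[OF this r'] obtain ds' mv ps' where *: "tick ds (marks n ps) = Some (ds', mv)"
      "length ds' = length ps'" "length ps' = length ps" "length mv = length ps"
      "in_range n ps'" "ticks_left n ds' ps' = r'"
      "map2 act_tape (zip (marks n ps) mv) (map (clock_tape n) ps) = map (clock_tape n) ps'"
      by blast
    have "r = n + 1 + (n + 2) * r'" using eq r' by simp
    moreover have "scan (clock_tape n p) = (if d then Point else Slash)"
      using True by (simp add: scan_clock_tape)
    ultimately show ?thesis
      using *[unfolded o_def] True Cons.prems(1)
      by (intro exI[of _ "(\<not> d) # ds'"] exI[of _ "Stay # mv"] exI[of _ "p # ps'"])
        (auto simp: act_clock_tape(1)[of n p] o_def simp del: act_clock_tape(1) split: if_splits;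
          use act_clock_tape(1)[of n p] in simp)
  qed
qed simp

text \<open>When the count ends, every head has reached the end it moved to, so reversing all
  directions makes the clock full again. Thus one clock times first the writing of the expansions
  and then the simulation, without being reset.\<close>

lemma ticks_left_full:
  "length ds = length ps \<Longrightarrow> in_range n ps \<Longrightarrow> ticks_left n ds ps = 0 \<Longrightarrow>
    Suc (ticks_left n (map Not ds) ps) = (n + 2) ^ length ps"
proof (induction ds ps rule: list_induct2)
  case (Cons d ds p ps)
  then have "Suc (ticks_left n (map Not ds) ps) = (n + 2) ^ length ps" by auto
  moreover have "Suc (ticks_left n (map Not (d # ds)) (p # ps)) =
      (n + 2) * Suc (ticks_left n (map Not ds) ps)"
    using Cons.prems by auto
  ultimately show ?case by simp
qed simp

lemma ticks_left_initial:
  "Suc (ticks_left n (replicate d True) (replicate d 0)) = (n + 2) ^ d"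
proof -
  have "ticks_left n (replicate d False) (replicate d 0) = 0" by (induction d) auto
  then show ?thesis using ticks_left_full[of "replicate d False" "replicate d 0" n] by simp
qed

text \<open>\<open>Clock0\<close> to \<open>Clock2\<close> mark the clock tapes on a walk over the
  input and back. The \<open>Fill\<close> stages write the expansion of 1/2, and
  \<open>Rewind\<close> returns to its point. Lists of truth values are the directions of the clock
  heads. \<open>Home\<close> leads the output head to cell 0, and \<open>Scan\<close> inspects the
  numerator.\<close>

datatype stage =
    Clock0 | Clock1 | Clock2 | Fill0 | Fill1 | Fill "bool list" | Rewind "bool list"
  | Simul nat "bool list" | Home | Scan | Yes | No

instance stage :: countable by countable_datatype

text \<open>Besides the tapes of the simulated machine the decider has a shadow tape, whose head
  follows that of the output tape, and the clock. Within reach the shadow tape is blank exactly to the left of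
  cell 0, so that the head on the output tape can be led back to cell 0.\<close>

definition pad_action :: "'a sym \<times> dir \<Rightarrow> 'a sym list \<Rightarrow> ('a sym \<times> dir) list" where
  "pad_action a sm = stay (hd sm) # a # a # map stay (drop 3 sm)"

definition out_action :: "'a sym \<times> dir \<Rightarrow> 'a sym list \<Rightarrow> ('a sym \<times> dir) list" where
  "out_action a sm = map stay (take 3 sm) @ a # map stay (drop 4 sm)"

fun simul_action :: "bool list \<Rightarrow> nat sym \<Rightarrow> (nat sym \<times> dir) list \<Rightarrow> (nat, nat) action \<Rightarrow> (stage, nat) action" where
  "simul_action ds s ka (q, as) = (Simul q ds, as @ (s, snd (as ! 3)) # ka)"

text \<open>The shadow tape receives the same expansion of 1/2 as tapes 1 and 2: its
  \<open>Point\<close> marks cell 0, and the digits right of it are nonblank. In \<open>Home\<close>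
  the scanned shadow symbol therefore tells the direction to cell 0.\<close>

definition stage_step ::
  "(nat, nat) tm \<Rightarrow> nat \<Rightarrow> stage \<Rightarrow> nat sym list \<Rightarrow> nat sym \<Rightarrow> nat sym list \<Rightarrow> (stage, nat) transition" where
  "stage_step M d st sm s ks = (case st of
     Clock0 \<Rightarrow> Det (Clock1, map stay sm @ stay s # map (\<lambda>k. (Slash, Move_R)) ks)
   | Clock1 \<Rightarrow>
       if hd sm = Blank then
         Det (Clock2, (Blank, Move_L) # map stay (tl sm) @ stay s # map (\<lambda>k. (Point, Move_L)) ks)
       else Det (Clock1, (hd sm, Move_R) # map stay (tl sm) @ stay s # map (\<lambda>k. (k, Move_R)) ks)
   | Clock2 \<Rightarrow>
       if hd ks = Slash then
         Det (Fill0, (hd sm, Move_R) # map stay (tl sm) @ stay s # map stay ks)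
       else Det (Clock2, (hd sm, Move_L) # map stay (tl sm) @ stay s # map (\<lambda>k. (k, Move_L)) ks)
   | Fill0 \<Rightarrow> Det (Fill1, pad_action (Point, Move_R) sm @ (Point, Move_R) # map stay ks)
   | Fill1 \<Rightarrow> Det (Fill (replicate d True),
       pad_action (Bit True, Move_R) sm @ (Bit True, Move_R) # map stay ks)
   | Fill ds \<Rightarrow> (case tick ds ks of
         None \<Rightarrow> Det (Rewind (map Not ds), pad_action (Bit False, Move_L) sm @ (Bit False, Move_L) # map stay ks)
       | Some (ds', mv) \<Rightarrow>
           Det (Fill ds', pad_action (Bit False, Move_R) sm @ (Bit False, Move_R) # zip ks mv))
   | Rewind ds \<Rightarrow>
       if s = Point then Det (Simul (start M) ds, map stay sm @ stay s # map stay ks)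
       else Det (Rewind ds, pad_action (s, Move_L) sm @ (s, Move_L) # map stay ks)
   | Simul q ds \<Rightarrow> (case tick ds ks of
         None \<Rightarrow> Det (Home, map stay sm @ stay s # map stay ks)
       | Some (ds', mv) \<Rightarrow>
           if q = accept M \<or> q = reject M then
             Choice (Simul q ds', map stay sm @ stay s # zip ks mv)
               (Simul q ds', map stay sm @ stay s # zip ks mv)
           else if q \<in> states M \<and> set sm \<subseteq> alphabet M then
             (case delta M q sm of
                Det a \<Rightarrow> Choice (simul_action ds' s (zip ks mv) a) (simul_action ds' s (zip ks mv) a)
              | Choice a0 a1 \<Rightarrow> Choice (simul_action ds' s (zip ks mv) a0) (simul_action ds' s (zip ks mv) a1))
           else Det (No, map stay sm @ stay s # map stay ks))
   | Home \<Rightarrow>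
       if s = Point then Det (Scan, map stay sm @ stay s # map stay ks)
       else (let dir = if s = Blank then Move_R else Move_L in
         Det (Home, out_action (sm ! 3, dir) sm @ (s, dir) # map stay ks))
   | Scan \<Rightarrow>
       if sm ! 3 = Bit False then Det (Scan, out_action (Bit False, Move_R) sm @ stay s # map stay ks)
       else Det (if sm ! 3 = Bit True then Yes else No, map stay sm @ stay s # map stay ks)
   | _ \<Rightarrow> Det (No, map stay sm @ stay s # map stay ks))"

definition decider :: "(nat, nat) tm \<Rightarrow> nat \<Rightarrow> (stage, nat) tm" where
  "decider M d = \<lparr>tapes = tapes M + 1 + d,
     states = {Clock0, Clock1, Clock2, Fill0, Fill1, Home, Scan, Yes, No} \<union>
       Fill ` {ds. length ds = d} \<union> Rewind ` {ds. length ds = d} \<union>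
       case_prod Simul ` (states M \<times> {ds. length ds = d}),
     alphabet = alphabet M,
     start = Clock0, accept = Yes, reject = No,
     delta = (\<lambda>st ss. stage_step M d st (take (tapes M) ss) (ss ! tapes M) (drop (Suc (tapes M)) ss))\<rparr>"

lemma decider_sel:
  "accept (decider M d) = Yes" "reject (decider M d) = No" "start (decider M d) = Clock0"
  "tapes (decider M d) = tapes M + 1 + d"
  by (simp_all add: decider_def)

lemma wf_decider:
  assumes wf: "wf_tm M" and m: "tapes M \<ge> 4" and d: "d \<ge> 1"
  shows "wf_tm (decider M d)"
proof -
  let ?N = "decider M d"
  have fin: "finite (states M)" "finite (alphabet M)" and st: "{start M, accept M, reject M} \<subseteq> states M"
    and syms: "{Blank, Bit False, Bit True, Point, Slash} \<subseteq> alphabet M"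
    using wf by (auto simp: wf_tm_def)
  let ?A = "alphabet M" and ?Q = "states ?N"
  have B: "Blank \<in> ?A" "Bit b \<in> ?A" "Slash \<in> ?A" "Point \<in> ?A" for b
    using syms by (cases b; auto)+
  have finite: "finite ?Q"
    using fin finite_bit_lists[of d] by (auto simp: decider_def)
  have Q: "Clock0 \<in> ?Q" "Clock1 \<in> ?Q" "Clock2 \<in> ?Q" "Fill0 \<in> ?Q" "Fill1 \<in> ?Q" "Home \<in> ?Q" "Scan \<in> ?Q"
    "Yes \<in> ?Q" "No \<in> ?Q" "Fill ds \<in> ?Q \<longleftrightarrow> length ds = d" "Rewind ds \<in> ?Q \<longleftrightarrow> length ds = d"
    "Simul q ds \<in> ?Q \<longleftrightarrow> q \<in> states M \<and> length ds = d" for ds q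
    by (auto simp: decider_def)
  define P where "P am \<longleftrightarrow> length am = tapes M \<and> fst ` set am \<subseteq> ?A" for am :: "(nat sym \<times> dir) list"
  define K where "K ak \<longleftrightarrow> length ak = d \<and> fst ` set ak \<subseteq> ?A" for ak :: "(nat sym \<times> dir) list"
  define G where "G acts \<longleftrightarrow> length acts = tapes M + 1 + d \<and> fst ` set acts \<subseteq> ?A" for acts :: "(nat sym \<times> dir) list"
  have G: "G (am @ a # ak)" if "P am" "fst a \<in> ?A" "K ak" for am a ak
    using that by (auto simp: G_def P_def K_def)
  have good: "st' \<in> ?Q \<and> G acts"
    if sm: "length sm = tapes M" "set sm \<subseteq> ?A" and s: "s \<in> ?A" and ks: "length ks = d" "set ks \<subseteq> ?A"
      and q: "st \<in> ?Q" and act: "(st', acts) \<in> actions (stage_step M d st sm s ks)" for sm s ks st st' acts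
  proof -
    have fs: "fst (stay x) = x" for x :: "nat sym" by (simp add: stay_def)
    have ne: "sm \<noteq> []" using sm m by auto
    then have nth: "sm ! 3 \<in> ?A" "hd sm \<in> ?A" using sm m by (auto intro!: subsetD[OF sm(2)])
    have P: "P (map stay sm)" "\<And>a. fst a \<in> ?A \<Longrightarrow> P (a # map stay (tl sm))"
      "\<And>a. fst a \<in> ?A \<Longrightarrow> P (pad_action a sm)" "\<And>a. fst a \<in> ?A \<Longrightarrow> P (out_action a sm)"
      using sm m ne nth
      by (auto simp: P_def pad_action_def out_action_def fs dest: in_set_dropD in_set_takeD list.set_sel(2))
    have K: "K (map stay ks)" "\<And>x dir. x \<in> ?A \<Longrightarrow> K (map (\<lambda>k. (x, dir)) ks)"
      "\<And>dir. K (map (\<lambda>k. (k, dir)) ks)" "\<And>mv. length mv = d \<Longrightarrow> K (zip ks mv)"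
      using ks by (auto simp: K_def fs dest: set_zip_leftD)
    note rules = G G[OF P(2), simplified] P K s nth B Q fs
    show ?thesis
    proof (cases st)
      case (Simul p ds)
      have ds: "length ds = d" "p \<in> states M" using q by (simp_all add: Simul Q)
      show ?thesis
      proof (cases "tick ds ks")
        case None
        then show ?thesis using act by (simp add: stage_step_def Simul rules)
      next
        case (Some r)
        obtain ds' mv where r: "r = (ds', mv)" by (cases r)
        have len: "length ds' = d" "length mv = d"
          using length_tick[of ds ks ds' mv] Some r ds ks by auto
        show ?thesis
        proof (cases "\<not> (p = accept M \<or> p = reject M) \<and> p \<in> states M \<and> set sm \<subseteq> alphabet M")
          case True
          have "\<exists>a \<in> actions (delta M p sm). (st', acts) = simul_action ds' s (zip ks mv) a"
            using act True Some r unfolding Simul stage_step_def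
            by (cases "delta M p sm") (auto simp del: simul_action.simps)
          then obtain q' as where as: "(q', as) \<in> actions (delta M p sm)"
            "(st', acts) = simul_action ds' s (zip ks mv) (q', as)" by auto
          have "q' \<in> states M" "length as = tapes M" "fst ` set as \<subseteq> alphabet M"
            using wf_tm_action[OF wf ds(2) sm(1) sm(2) as(1)] by auto
          then show ?thesis using as(2) s len by (simp add: G K Q P_def)
        next
          case False
          then show ?thesis using act Some r ds len by (auto simp: stage_step_def Simul rules split: if_splits)
        qed
      qed
    next
      case (Fill ds)
      have ds: "length ds = d" using q by (simp add: Fill Q)
      show ?thesis
      proof (cases "tick ds ks")
        case None
        then show ?thesis using act ds by (simp add: stage_step_def Fill rules)
      next
        case (Some r)
        obtain ds' mv where r: "r = (ds', mv)" by (cases r)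
        have len: "length ds' = d" "length mv = d"
          using length_tick[of ds ks ds' mv] Some r ds ks by auto
        then show ?thesis using act Some r ds by (simp add: stage_step_def Fill rules)
      qed
    next
      case (Rewind ds)
      then show ?thesis using act q st by (auto simp: stage_step_def rules split: if_splits)
    qed (use act in \<open>auto simp: stage_step_def rules Let_def split: if_splits\<close>)
  qed
  have "length acts = tapes ?N \<and> q' \<in> ?Q \<and> fst ` set acts \<subseteq> ?A"
    if "q \<in> ?Q" "length ss = tapes ?N" "set ss \<subseteq> ?A" "(q', acts) \<in> actions (delta ?N q ss)" for q ss q' acts
  proof -
    have len: "length ss = tapes M + 1 + d" using that by (simp add: decider_def)
    have "length (take (tapes M) ss) = tapes M" "set (take (tapes M) ss) \<subseteq> ?A" "ss ! tapes M \<in> ?A"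
      "length (drop (Suc (tapes M)) ss) = d" "set (drop (Suc (tapes M)) ss) \<subseteq> ?A"
      using len that(3) by (auto intro!: subsetD[OF that(3)] dest: in_set_takeD in_set_dropD)
    from good[OF this that(1)] that(4) show ?thesis by (simp add: decider_def G_def)
  qed
  moreover have alph: "alphabet ?N = alphabet M" by (simp add: decider_def)
  moreover have "{start ?N, accept ?N, reject ?N} \<subseteq> ?Q" "accept ?N \<noteq> reject ?N"
    by (simp_all add: decider_sel Q)
  ultimately show ?thesis
    using finite fin B unfolding wf_tm_def alph by blast
qed

section \<open>Runs of the deciding machine\<close>

abbreviation dconf ::
  "stage \<Rightarrow> nat tape list \<Rightarrow> nat tape \<Rightarrow> nat tape list \<Rightarrow> (stage, nat) config" where
  "dconf st ms sT kT \<equiv> (st, ms @ sT # kT)"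

abbreviation decider_path where
  "decider_path M d \<equiv> comp_path (decider M d)"

lemma transition_at_decider:
  assumes "length ms = tapes M"
  shows "transition_at (decider M d) (dconf st ms sT kT) =
    stage_step M d st (map scan ms) (scan sT) (map scan kT)"
  using assms by (simp add: transition_at_scan decider_def nth_append)

lemma apply_action_append:
  "length am = length ms \<Longrightarrow> apply_action (st', am @ a # ak) (dconf st ms sT kT) =
    dconf st' (map2 act_tape am ms) (act_tape a sT) (map2 act_tape ak kT)"
  by simp

lemma not_halted_decider: "st \<noteq> Yes \<Longrightarrow> st \<noteq> No \<Longrightarrow> \<not> halted (decider M d) (st, ts)"
  by (simp add: halted_def decider_sel)

lemma decider_det:
  assumes "stage_step M d st (map scan ms) (scan sT) (map scan kT) = Det (st', am @ a # ak)"
    and "st \<noteq> Yes" "st \<noteq> No" "length ms = tapes M" "length am = length ms"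
    and "map2 act_tape am ms = ms'" "act_tape a sT = sT'" "map2 act_tape ak kT = kT'"
    and "decider_path M d (dconf st' ms' sT' kT') bs t c'"
  shows "decider_path M d (dconf st ms sT kT) bs (Suc t) c'"
proof (rule comp_path.det)
  show "\<not> halted (decider M d) (dconf st ms sT kT)"
    using assms by (simp add: not_halted_decider)
  show "transition_at (decider M d) (dconf st ms sT kT) = Det (st', am @ a # ak)"
    using assms by (simp add: transition_at_decider)
  show "decider_path M d (apply_action (st', am @ a # ak) (dconf st ms sT kT)) bs t c'"
    using assms by (subst apply_action_append) simp_all
qed

lemma decider_idle:
  assumes "stage_step M d st (map scan ms) (scan sT) (map scan kT) = Det (st', idle ms @ keep sT # idle kT)"
    and "st \<noteq> Yes" "st \<noteq> No" "length ms = tapes M"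
    and "decider_path M d (dconf st' ms sT kT) bs t c'"
  shows "decider_path M d (dconf st ms sT kT) bs (Suc t) c'"
  by (rule decider_det[OF assms(1-4) _ map2_act_stay_scan act_stay_scan map2_act_stay_scan assms(5)]) simp

lemma pad_action_scan:
  "map2 act_tape (pad_action a (map scan (t # u # u # rest))) (t # u # u # rest) =
    t # act_tape a u # act_tape a u # rest"
  by (simp add: pad_action_def del: map_map)

lemma decider_pad:
  assumes "stage_step M d st (map scan (t0 # u # u # rest)) (scan u) (map scan kT) =
      Det (st', pad_action a (map scan (t0 # u # u # rest)) @ a # idle kT)"
    and "st \<noteq> Yes" "st \<noteq> No" "length rest + 3 = tapes M" "act_tape a u = u'"
    and "decider_path M d (dconf st' (t0 # u' # u' # rest) u' kT) bs t c'"
  shows "decider_path M d (dconf st (t0 # u # u # rest) u kT) bs (Suc t) c'"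
  by (rule decider_det[OF assms(1-3) _ _ pad_action_scan HOL.refl map2_act_stay_scan])
    (use assms(4-6) in \<open>simp_all add: pad_action_def\<close>)

lemma map2_const_replicate:
  "length xs = length ys \<Longrightarrow> map2 f (map (\<lambda>_. a) xs) ys = map (f a) ys"
  by (induction xs ys rule: list_induct2) simp_all

lemma map2_move_scan: "map2 act_tape (map (\<lambda>k. (k, dir)) (map scan ts)) ts = map (\<lambda>t. act_tape (scan t, dir) t) ts"
  by (induction ts) simp_all

text \<open>Each of \<open>k\<close> ticks writes a zero, and the step that finds the clock
  exhausted writes one more. The cells up to k + 2 then agree with the tape of 1/2.\<close>

definition prepared :: "nat \<Rightarrow> nat sym list" where
  "prepared k = Point # Bit True # replicate (Suc k) (Bit False)"

locale deciding =
  fixes M :: "(nat, nat) tm" and d :: nat and x :: "bool list"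
  assumes wf: "wf_tm M" and tapes: "tapes M \<ge> 4" and d: "d \<ge> 1"
begin

abbreviation n :: nat where "n \<equiv> length x"

definition ticks :: nat where "ticks = (n + 2) ^ d - 1"

lemma Suc_ticks: "Suc ticks = (n + 2) ^ d"
  by (simp add: ticks_def)

abbreviation x_tape :: "int \<Rightarrow> nat tape" where
  "x_tape h \<equiv> (word_tape (map Bit x), h)"

abbreviation blank_tape :: "nat tape" where
  "blank_tape \<equiv> zt 0 [] []"

lemma scan_x_tape: "i < n \<Longrightarrow> scan (x_tape (int i)) \<noteq> Blank" "scan (x_tape (int n)) = Blank"
  by (auto simp: scan_def word_tape_def)

definition clock_init :: "int \<Rightarrow> nat tape" where
  "clock_init p = ((\<lambda>_. Blank)(0 := Slash), p)"

lemma act_clock_init: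
  "act_tape (Slash, Move_R) blank_tape = clock_init 1"
  "p > 0 \<Longrightarrow> act_tape (scan (clock_init p), Move_R) (clock_init p) = clock_init (p + 1)"
  "act_tape (Point, Move_L) (clock_init (int m + 1)) = clock_tape m m"
  by (auto simp: clock_init_def clock_tape_def act_tape.simps zt_def scan_def)

text \<open>The clock heads run one cell ahead of the input head, so the right mark is put on cell n
  + 1 when the input head meets the blank cell n.\<close>

lemma clock1_run:
  assumes "Suc (length rest) = tapes M"
  shows "i \<le> n \<Longrightarrow> decider_path M d
    (dconf Clock1 (x_tape (int i) # rest) sT (replicate d (clock_init (int i + 1)))) [] (n - i + 1)
    (dconf Clock2 (x_tape (int n - 1) # rest) sT (replicate d (clock_tape n n)))"
proof (induction rule: inc_induct)
  case base
  have "decider_path M d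
    (dconf Clock1 (x_tape (int n) # rest) sT (replicate d (clock_init (int n + 1)))) [] (Suc 0)
    (dconf Clock2 (x_tape (int n - 1) # rest) sT (replicate d (clock_tape n n)))"
    apply (rule decider_det[of M d _ _ _ _ _ "(Blank, Move_L) # idle rest" "keep sT"
        "map (\<lambda>k. (Point, Move_L)) (map scan (replicate d (clock_init (int n + 1))))"])
     apply (simp add: stage_step_def scan_x_tape)
     apply simp_all[2]
     apply (use assms in \<open>simp_all del: map_map\<close>)[2]
     apply (use scan_x_tape(2) in \<open>simp add: act_tape.simps scan_def fun_upd_idem del: map_map\<close>)
     apply simp
     apply (simp add: map2_const_replicate act_clock_init del: map_map)
    by (rule comp_path.refl)
  then show ?case by simp
next
  case (step i)
  have "decider_path M d
    (dconf Clock1 (x_tape (int i) # rest) sT (replicate d (clock_init (int i + 1)))) [] (Suc (n - Suc i + 1))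
    (dconf Clock2 (x_tape (int n - 1) # rest) sT (replicate d (clock_tape n n)))"
    apply (rule decider_det[of M d _ _ _ _ _ "(scan (x_tape (int i)), Move_R) # idle rest" "keep sT"
        "map (\<lambda>k. (k, Move_R)) (map scan (replicate d (clock_init (int i + 1))))"])
     apply (use step in \<open>simp add: stage_step_def scan_x_tape\<close>)
     apply simp_all[2]
     apply (use assms in \<open>simp_all del: map_map\<close>)[2]
     apply (simp add: act_move_scan del: map_map)
     apply simp
     apply (simp only: map2_move_scan)
     apply (simp add: act_clock_init)
    using step.IH by (simp add: algebra_simps)
  then show ?case using step by (simp add: Suc_diff_Suc)
qed

lemma clock2_run:
  assumes "Suc (length rest) = tapes M"
  shows "i \<le> n \<Longrightarrow> decider_path M d
    (dconf Clock2 (x_tape (int i - 1) # rest) sT (replicate d (clock_tape n i))) [] (Suc i)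
    (dconf Fill0 (x_tape 0 # rest) sT (replicate d (clock_tape n 0)))"
proof (induction i)
  case 0
  show ?case
    apply (rule decider_det[of M d _ _ _ _ _ "(scan (x_tape (int 0 - 1)), Move_R) # idle rest" "keep sT"
        "idle (replicate d (clock_tape n 0))"])
     apply (use d in \<open>simp add: stage_step_def hd_map hd_replicate scan_clock_tape\<close>)
     apply simp_all[2]
     apply (use assms in \<open>simp_all del: map_map\<close>)[2]
     apply (simp add: act_move_scan del: map_map)
     apply simp
     apply (simp only: map2_act_stay_scan)
    by (rule comp_path.refl)
next
  case (Suc i)
  show ?case
    apply (rule decider_det[of M d _ _ _ _ _ "(scan (x_tape (int (Suc i) - 1)), Move_L) # idle rest" "keep sT"
        "map (\<lambda>k. (k, Move_L)) (map scan (replicate d (clock_tape n (Suc i))))"])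
     apply (use d Suc.prems in \<open>simp add: stage_step_def hd_map hd_replicate scan_clock_tape\<close>)
     apply simp_all[2]
     apply (use assms in \<open>simp_all del: map_map\<close>)[2]
     apply (simp add: act_tape.simps scan_def del: map_map)
     apply simp
     apply (simp only: map2_move_scan)
     apply (simp add: act_clock_tape)
    using Suc by (simp add: algebra_simps)
qed

abbreviation clocks :: "nat list \<Rightarrow> nat tape list" where
  "clocks ps \<equiv> map (clock_tape n) ps"

abbreviation padded ::
  "stage \<Rightarrow> nat tape \<Rightarrow> nat tape list \<Rightarrow> nat tape \<Rightarrow> nat tape list \<Rightarrow> (stage, nat) config" where
  "padded st t rest u kT \<equiv> dconf st (t # u # u # rest) u kT"

lemma fill_run:
  assumes "length rest + 3 = tapes M"
  shows "length ds = length ps \<Longrightarrow> in_range n ps \<Longrightarrow> ticks_left n ds ps = r \<Longrightarrow>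
    \<exists>ds' ps'. length ds' = length ps' \<and> length ps' = length ps \<and> (in_range n ps') \<and>
      Suc (ticks_left n ds' ps') = (n + 2) ^ length ps \<and> decider_path M d
        (padded (Fill ds) t rest (zt h L []) (clocks ps)) [] (Suc r)
        (let u = act_tape (Bit False, Move_L) (zt (h + int r) (replicate r (Bit False) @ L) []) in
          padded (Rewind ds') t rest u (clocks ps'))"
proof (induction r arbitrary: ds ps h L)
  case 0
  let ?u = "act_tape (Bit False, Move_L) (zt h L [])"
  have "decider_path M d
      (padded (Fill ds) t rest (zt h L []) (clocks ps)) [] (Suc 0)
      (padded (Rewind (map Not ds)) t rest ?u (clocks ps))"
    apply (rule decider_pad[where a = "(Bit False, Move_L)"])
     apply (use tick_None[OF 0] in \<open>simp add: stage_step_def o_def\<close>)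
     apply simp_all[2]
     apply (rule assms)
     apply (rule HOL.refl)
    by (rule comp_path.refl)
  then show ?case
    using ticks_left_full[OF 0] 0 by (intro exI[of _ "map Not ds"] exI[of _ ps]) (simp add: Let_def)
next
  case (Suc r)
  obtain ds1 mv ps1 where 1: "tick ds (marks n ps) = Some (ds1, mv)"
      "length ds1 = length ps1" "length ps1 = length ps" "length mv = length ps"
      "in_range n ps1" "ticks_left n ds1 ps1 = r"
      "map2 act_tape (zip (marks n ps) mv) (clocks ps) = clocks ps1"
    using tick_Some[OF Suc.prems] by blast
  let ?z = "zt (h + 1) (Bit False # L) []"
  let ?u = "act_tape (Bit False, Move_L) (zt (h + 1 + int r) (replicate r (Bit False) @ Bit False # L) [])"
  obtain ds' ps' where 2: "length ds' = length ps'" "length ps' = length ps1" "in_range n ps'"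
    "Suc (ticks_left n ds' ps') = (n + 2) ^ length ps1"
    "decider_path M d (padded (Fill ds1) t rest ?z (clocks ps1)) [] (Suc r)
      (padded (Rewind ds') t rest ?u (clocks ps'))"
    using Suc.IH[OF 1(2,5,6), of "h + 1" "Bit False # L"] unfolding Let_def by blast
  have z: "act_tape (Bit False, Move_R) (zt h L []) = ?z" by (simp add: act_zt)
  have "decider_path M d
      (padded (Fill ds) t rest (zt h L []) (clocks ps)) [] (Suc (Suc r))
      (padded (Rewind ds') t rest ?u (clocks ps'))"
    apply (rule decider_det[of M d _ _ _ _ _
        "pad_action (Bit False, Move_R) (map scan (t # zt h L [] # zt h L [] # rest))" "(Bit False, Move_R)"
        "zip (marks n ps) mv"])
     apply (use 1(1) in \<open>simp add: stage_step_def o_def\<close>)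
     apply simp_all[2]
     apply (use assms in \<open>simp_all add: pad_action_def\<close>)[2]
     apply (rule pad_action_scan)
     apply (rule HOL.refl)
     apply (rule 1(7))
    unfolding z by (rule 2(5))
  moreover have "h + 1 + int r = h + int (Suc r)"
    "replicate r (Bit False) @ Bit False # L = replicate (Suc r) (Bit False) @ L"
    by (simp_all add: replicate_app_Cons_same)
  ultimately show ?case
    using 2 1(3) by (intro exI[of _ ds'] exI[of _ ps']) (simp add: Let_def)
qed

lemma rewind_run:
  assumes "length rest + 3 = tapes M"
  shows "Point \<notin> set A \<Longrightarrow> s \<noteq> Point \<Longrightarrow> decider_path M d
      (dconf (Rewind ds) (t # zt h (A @ [Point]) (s # R) # zt h (A @ [Point]) (s # R) # rest)
        (zt h (A @ [Point]) (s # R)) kT) [] (length A + 2)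
      (let u = zt (h - int (length A) - 1) [] (Point # rev A @ s # R) in
        padded (Simul (start M) ds) t rest u kT)"
proof (induction A arbitrary: h s R)
  case Nil
  let ?z = "zt h [Point] (s # R)" and ?u = "zt (h - 1) [] (Point # s # R)"
  have z: "act_tape (s, Move_L) ?z = ?u" by (simp add: act_zt)
  have "decider_path M d (padded (Rewind ds) t rest ?z kT) [] (Suc (Suc 0))
      (padded (Simul (start M) ds) t rest ?u kT)"
    apply (rule decider_pad[where a = "(s, Move_L)"])
     apply (use Nil in \<open>simp add: stage_step_def\<close>)
     apply simp_all[2]
     apply (rule assms)
     apply (rule z)
    apply (rule decider_idle)
     apply (simp add: stage_step_def)
     apply simp_all[2]
     apply (use assms in \<open>simp_all add: pad_action_def\<close>)[1]
    by (rule comp_path.refl)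
  then show ?case by (simp add: Let_def)
next
  case (Cons a A)
  let ?z = "zt h ((a # A) @ [Point]) (s # R)" and ?u = "zt (h - 1) (A @ [Point]) (a # s # R)"
  let ?v = "zt (h - 1 - int (length A) - 1) [] (Point # rev A @ a # s # R)"
  have z: "act_tape (s, Move_L) ?z = ?u" by (simp add: act_zt)
  have IH: "decider_path M d (padded (Rewind ds) t rest ?u kT) [] (length A + 2)
      (padded (Simul (start M) ds) t rest ?v kT)"
    using Cons.IH[of a "h - 1" "s # R"] Cons.prems by (auto simp: Let_def)
  have "decider_path M d (padded (Rewind ds) t rest ?z kT) [] (Suc (length A + 2))
      (padded (Simul (start M) ds) t rest ?v kT)"
    apply (rule decider_pad[where a = "(s, Move_L)"])
     apply (use Cons.prems in \<open>simp add: stage_step_def\<close>)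
     apply simp_all[2]
     apply (rule assms)
     apply (rule z)
    by (rule IH)
  then show ?case by (simp add: Let_def algebra_simps)
qed

lemma preparation_run:
  "\<exists>ds ps. length ds = length ps \<and> length ps = d \<and> (in_range n ps) \<and>
    ticks_left n ds ps = ticks \<and>
    decider_path M d (input_config (decider M d) x) [] (2 * n + 2 * ticks + 8)
      (dconf (Simul (start M) ds)
        (x_tape 0 # zt 0 [] (prepared ticks) # zt 0 [] (prepared ticks) # replicate (tapes M - 3) blank_tape)
        (zt 0 [] (prepared ticks)) (clocks ps))"
proof -
  let ?rest = "replicate (tapes M - 3) blank_tape"
  let ?b = "blank_tape"
  have rest: "length ?rest + 3 = tapes M" "Suc (length (?b # ?b # ?rest)) = tapes M" using tapes by auto
  define m where "m = tapes M - 3"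
  have m: "tapes M = Suc (Suc (Suc m))" using tapes by (simp add: m_def)
  have "replicate (m + Suc d) b = replicate m b @ b # replicate d b" for b :: "nat tape"
    by (simp only: replicate_add replicate_Suc)
  then have init: "input_config (decider M d) x = padded Clock0 (x_tape 0) ?rest ?b (replicate d ?b)"
    by (simp add: input_config_def init_config_def decider_sel zt_blank m)
  have 1: "decider_path M d (input_config (decider M d) x) [] (Suc 0)
      (dconf Clock1 (x_tape (int 0) # ?b # ?b # ?rest) ?b (replicate d (clock_init (int 0 + 1))))"
    unfolding init
    apply (rule decider_det[of M d _ _ _ _ _
        "idle (x_tape 0 # ?b # ?b # ?rest)" "keep ?b"
        "map (\<lambda>k. (Slash, Move_R)) (map scan (replicate d ?b))"])
     apply (simp add: stage_step_def)
     apply simp_all[2]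
     apply (use rest in simp_all)[2]
     apply (rule map2_act_stay_scan)
     apply (rule act_stay_scan)
     apply (subst map2_const_replicate, simp, simp add: act_clock_init(1))
    by (simp add: comp_path.refl)
  have 2: "decider_path M d
      (dconf Clock1 (x_tape (int 0) # ?b # ?b # ?rest) ?b (replicate d (clock_init (int 0 + 1)))) [] (n - 0 + 1)
      (dconf Clock2 (x_tape (int n - 1) # ?b # ?b # ?rest) ?b (replicate d (clock_tape n n)))"
    by (rule clock1_run) (use rest in auto)
  have 3: "decider_path M d
      (dconf Clock2 (x_tape (int n - 1) # ?b # ?b # ?rest) ?b (replicate d (clock_tape n n))) [] (Suc n)
      (padded Fill0 (x_tape 0) ?rest ?b (replicate d (clock_tape n 0)))"
    by (rule clock2_run) (use rest in auto)
  let ?b1 = "zt 1 [Point] []" and ?b2 = "zt 2 [Bit True, Point] []"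
  let ?ds = "replicate d True" and ?ps = "replicate d (0 :: nat)"
  have b: "act_tape (Point, Move_R) ?b = ?b1" "act_tape (Bit True, Move_R) ?b1 = ?b2"
    by (simp_all add: act_zt)
  have 4: "decider_path M d
      (padded Fill0 (x_tape 0) ?rest ?b (replicate d (clock_tape n 0))) [] (Suc (Suc 0))
      (padded (Fill ?ds) (x_tape 0) ?rest ?b2 (clocks ?ps))"
    apply (rule decider_pad[where a = "(Point, Move_R)"])
     apply (simp add: stage_step_def)
     apply simp_all[2]
     apply (rule rest)
     apply (rule b)
    apply (rule decider_pad[where a = "(Bit True, Move_R)"])
     apply (simp add: stage_step_def)
     apply simp_all[2]
     apply (rule rest)
     apply (rule HOL.refl)
    unfolding b by (simp add: comp_path.refl)
  have tl: "ticks_left n ?ds ?ps = ticks"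
    using ticks_left_initial[of n d] by (simp add: ticks_def)
  let ?u = "act_tape (Bit False, Move_L) (zt (2 + int ticks) (replicate ticks (Bit False) @ [Bit True, Point]) [])"
  obtain ds ps where 5: "length ds = length ps" "length ps = d" "in_range n ps"
    "Suc (ticks_left n ds ps) = (n + 2) ^ d"
    "decider_path M d (padded (Fill ?ds) (x_tape 0) ?rest ?b2 (clocks ?ps)) [] (Suc ticks)
      (padded (Rewind ds) (x_tape 0) ?rest ?u (clocks ps))"
    using fill_run[OF rest(1), of ?ds ?ps ticks "x_tape 0" 2 "[Bit True, Point]"] tl
    unfolding Let_def by auto
  \<comment> \<open>The symbol nearest to the head is a zero, or the 1 if \<open>ticks\<close> is 0;
    naming it \<open>s\<close> avoids the case distinction.\<close>
  obtain s A where sA: "replicate ticks (Bit False) @ [Bit True] = s # (A :: nat sym list)"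
    by (cases "replicate ticks (Bit False) @ [Bit True] :: nat sym list") auto
  have setsA: "set (s # A) \<subseteq> {Bit False, Bit True}" unfolding sA[symmetric] by auto
  have lenA: "length A = ticks" using arg_cong[OF sA, of length] by simp
  have app: "replicate ticks (Bit False) @ [Bit True, Point] = s # A @ [Point]"
    using arg_cong[OF sA, of "\<lambda>w. w @ [Point]"] by simp
  have u: "?u = zt (1 + int ticks) (A @ [Point]) (s # [Bit False])"
    unfolding app by (simp add: act_zt)
  have "rev A @ [s] = rev (replicate ticks (Bit False) @ [Bit True])" unfolding sA by simp
  then have "Point # (rev A @ [s]) @ [Bit False] = Point # ([Bit True] @ replicate ticks (Bit False)) @ [Bit False]"
    by simp
  then have prep: "Point # rev A @ s # [Bit False] = prepared ticks"
    by (simp add: prepared_def replicate_append_same)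
  have 6: "decider_path M d
      (padded (Rewind ds) (x_tape 0) ?rest ?u (clocks ps)) [] (ticks + 2)
      (padded (Simul (start M) ds) (x_tape 0) ?rest (zt 0 [] (prepared ticks)) (clocks ps))"
    using rewind_run[OF rest(1), of A s ds "x_tape 0" "1 + int ticks" "[Bit False]" "clocks ps"] setsA
    unfolding u by (auto simp: Let_def lenA prep)
  have "decider_path M d (input_config (decider M d) x) ([] @ [] @ [] @ [] @ [] @ [])
     (Suc 0 + (n - 0 + 1 + (Suc n + (Suc (Suc 0) + (Suc ticks + (ticks + 2))))))
      (padded (Simul (start M) ds) (x_tape 0) ?rest (zt 0 [] (prepared ticks)) (clocks ps))"
    by (rule comp_path_trans[OF 1 comp_path_trans[OF 2 comp_path_trans[OF 3 comp_path_trans[OF 4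
      comp_path_trans[OF 5(5) 6]]]]])
  moreover have "Suc 0 + (n - 0 + 1 + (Suc n + (Suc (Suc 0) + (Suc ticks + (ticks + 2))))) = 2 * n + 2 * ticks + 8"
    by simp
  moreover have "ticks_left n ds ps = ticks" using 5(4) Suc_ticks by simp
  ultimately show ?thesis
    using 5(1-3) by (intro exI[of _ ds] exI[of _ ps]) (simp only: append_Nil)
qed

end

section \<open>One bit per step, and simulation on truncated tapes\<close>

definition mstep :: "('q, 'a) tm \<Rightarrow> bool \<Rightarrow> ('q, 'a) config \<Rightarrow> ('q, 'a) config" where
  "mstep M b c = (if halted M c then c else case transition_at M c of
     Det a \<Rightarrow> apply_action a c | Choice a0 a1 \<Rightarrow> apply_action (if b then a1 else a0) c)"

fun mrun :: "('q, 'a) tm \<Rightarrow> bool list \<Rightarrow> ('q, 'a) config \<Rightarrow> ('q, 'a) config" where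
  "mrun M [] c = c"
| "mrun M (b # bs) c = mrun M bs (mstep M b c)"

lemma mrun_halted: "halted M c \<Longrightarrow> mrun M bs c = c"
  by (induction bs) (auto simp: mstep_def)

text \<open>\<open>mrun\<close> takes a bit in every step, even if the step is deterministic or the
  machine has halted. Ignored bits do not change the distribution, and this is the way the decider
  spends its choices.\<close>

lemma run_eq_mrun: "run M t c = map_pmf (\<lambda>bs. mrun M bs c) (bits t)"
proof (induction t arbitrary: c)
  case (Suc t)
  show ?case
  proof (cases "halted M c")
    case True
    then show ?thesis by (simp add: mrun_halted mstep_def map_bind_pmf pmf.map_comp o_def)
  next
    case False
    then show ?thesis
      by (cases "transition_at M c")
        (simp_all add: Suc mstep_def map_bind_pmf pmf.map_comp o_def)
  qed
qed simp

lemma fst_act_tape: "fst (act_tape a t) i = (if i = snd t then fst a else fst t i)"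
  by (cases a; cases t) (simp add: act_tape.simps)

lemma snd_act_tape: "snd (act_tape a t) = snd t + (case snd a of Move_L \<Rightarrow> - 1 | Stay \<Rightarrow> 0 | Move_R \<Rightarrow> 1)"
  by (cases a; cases t) (auto simp: act_tape.simps split: dir.splits)

lemma act_tape_shadow: "snd t = h \<Longrightarrow> act_tape (scan (S, h), snd a) (S, h) = (S, snd (act_tape a t))"
  by (auto simp: act_tape.simps snd_act_tape scan_def split: dir.splits)

text \<open>\<open>window R k ts ts'\<close> relates the tapes \<open>ts\<close> of the machine after \<open>k\<close> steps to their copies
  \<open>ts'\<close>, on which the infinite expansions on tapes 1 and 2 are cut off beyond cell \<open>R + 1\<close>.\<close>

definition window :: "nat \<Rightarrow> nat \<Rightarrow> 'a tape list \<Rightarrow> 'a tape list \<Rightarrow> bool" where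
  "window R k ts ts' \<longleftrightarrow> length ts' = length ts \<and>
     (\<forall>j<length ts. snd (ts' ! j) = snd (ts ! j) \<and> \<bar>snd (ts ! j)\<bar> \<le> int k \<and>
       (\<forall>i. i \<le> int R + 1 \<or> j \<noteq> 1 \<and> j \<noteq> 2 \<longrightarrow> fst (ts' ! j) i = fst (ts ! j) i)) \<and>
     (\<forall>i \<ge> int k. fst (ts ! 3) i = Blank)"

text \<open>After \<open>k\<close> steps the heads are within \<open>k\<close> cells of their
  origin, where the truncated expansions still agree with the infinite ones.\<close>

lemma window_scan:
  assumes "window R k ts ts'" "k \<le> R"
  shows "map scan ts' = map scan ts"
proof (rule nth_equalityI)
  fix j assume "j < length (map scan ts')"
  then have j: "j < length ts" "snd (ts' ! j) = snd (ts ! j)" "snd (ts ! j) \<le> int R + 1"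
    "length ts' = length ts"
    using assms by (fastforce simp: window_def)+
  then have "fst (ts' ! j) (snd (ts ! j)) = fst (ts ! j) (snd (ts ! j))"
    using assms(1) by (simp add: window_def)
  then show "map scan ts' ! j = map scan ts ! j"
    using j by (simp add: scan_def)
qed (use assms in \<open>simp add: window_def\<close>)

lemma window_step:
  assumes w: "window R k ts ts'" and len: "length as = length ts" "4 \<le> length ts"
  shows "window R (Suc k) (map2 act_tape as ts) (map2 act_tape as ts')"
proof -
  have "length ts' = length ts" using w by (simp add: window_def)
  moreover have "\<bar>snd (act_tape (as ! j) (ts ! j))\<bar> \<le> int (Suc k)" if "j < length ts" for j
  proof -
    have "\<bar>snd (ts ! j)\<bar> \<le> int k" using w that by (simp add: window_def)
    then show ?thesis by (auto simp: snd_act_tape split: dir.splits)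
  qed
  moreover have "fst (act_tape (as ! 3) (ts ! 3)) i = Blank" if "int (Suc k) \<le> i" for i
  proof -
    have "\<bar>snd (ts ! 3)\<bar> \<le> int k" "fst (ts ! 3) i = Blank"
      using w len that by (auto simp: window_def)
    then show ?thesis using that by (auto simp: fst_act_tape)
  qed
  moreover have "snd (act_tape (as ! j) (ts' ! j)) = snd (act_tape (as ! j) (ts ! j))"
    if "j < length ts" for j
    using w that by (simp add: window_def snd_act_tape)
  moreover have "fst (act_tape (as ! j) (ts' ! j)) i = fst (act_tape (as ! j) (ts ! j)) i"
    if "j < length ts" "i \<le> int R + 1 \<or> j \<noteq> 1 \<and> j \<noteq> 2" for i j
  proof -
    have "snd (ts' ! j) = snd (ts ! j)" "fst (ts' ! j) i = fst (ts ! j) i"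
      using w that by (simp_all only: window_def)
    then show ?thesis by (simp add: fst_act_tape)
  qed
  ultimately show ?thesis
    using len by (simp add: window_def)
qed

lemma window_idle: "window R k ts ts' \<Longrightarrow> window R (Suc k) ts ts'"
  by (fastforce simp: window_def)

lemma real_tape_half: "real_tape (1 / 2) i =
  (if i < 0 then Blank else if i = 0 then Point else Bit (i = 1))"
proof -
  have 0: "(LEAST m. (1 / 2 :: real) < 2 ^ m) = 0"
    by (rule Least_equality) auto
  have "binary_digit (1 / 2) (- i) = (i = 1)" if "i > 0"
  proof -
    define k where "k = nat (i - 1)"
    have i: "i = int (Suc k)" using that by (simp add: k_def)
    have "2 powi (- i) = (1 / 2 ^ Suc k :: real)"
      unfolding i power_int_minus power_int_of_nat by (simp add: field_simps)
    then have "(1 / 2) / 2 powi (- i) = (2 ^ k :: real)" by simp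
    then have "\<lfloor>(1 / 2) / 2 powi (- i) :: real\<rfloor> = 2 ^ k"
      by (metis floor_of_int of_int_numeral of_int_power)
    then show ?thesis by (auto simp: binary_digit_def i)
  qed
  then show ?thesis by (simp add: real_tape_def Let_def 0)
qed

lemma prepared_tape: "fst (zt 0 [] (prepared R)) i = (if i \<le> int R + 2 then real_tape (1 / 2) i else Blank)"
proof -
  consider "i < 0" | "i = 0" | "i = 1" | "2 \<le> i" by linarith
  then show ?thesis
  proof cases
    case 4
    define k where "k = nat (i - 2)"
    have i: "nat i = Suc (Suc k)" "i = int k + 2" using 4 by (simp_all add: k_def)
    show ?thesis
      by (auto simp: zt_def prepared_def real_tape_half cells_def i nth_Cons' nth_append simp del: replicate_Suc)
  qed (auto simp: zt_def prepared_def real_tape_half cells_def)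
qed

text \<open>This is what \<open>Scan\<close> tests. It is meaningful for every tape, whether or not
  a result has been written on it.\<close>

definition numerator_pos :: "(int \<Rightarrow> 'a sym) \<Rightarrow> bool" where
  "numerator_pos f \<longleftrightarrow> (\<exists>i. f (int i) = Bit True \<and> (\<forall>i'<i. f (int i') = Bit False))"

lemma numerator_pos_iff_least:
  assumes "f (int i0) \<noteq> Bit False" "\<And>i. i < i0 \<Longrightarrow> f (int i) = Bit False"
  shows "numerator_pos f \<longleftrightarrow> f (int i0) = Bit True"
  unfolding numerator_pos_def
  using assms by (metis linorder_neqE_nat sym.inject(1))

lemma horner_sum_bits_eq_0: "horner_sum of_bool 2 bs = (0 :: nat) \<longleftrightarrow> True \<notin> set bs"
  by (induction bs) auto

text \<open>The \<open>Slash\<close> ends the first block of digits, so a 1 preceded only by zeros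
  lies in the numerator; and the quotient vanishes iff its numerator does.\<close>

lemma returns_numerator_pos:
  fixes c :: "('q, 'a) config"
  assumes "returns c r"
  shows "numerator_pos (fst (snd c ! 3)) \<longleftrightarrow> r \<noteq> 0"
proof -
  let ?f = "fst (snd c ! 3)"
  obtain us vs where tape: "\<forall>i \<in> {0..int (length (map Bit us @ Slash # map Bit vs :: 'a sym list))}.
      ?f i = word_tape (map Bit us @ Slash # map Bit vs) i"
    and v: "binary_value vs \<noteq> 0" and r: "r = real (binary_value us) / real (binary_value vs)"
    using assms unfolding returns_def Let_def by blast
  have us: "?f (int i) = (if i < length us then Bit (us ! i) else Slash)" if "i \<le> length us" for i
    using tape that by (auto simp: word_tape_def nth_append)
  have "r \<noteq> 0 \<longleftrightarrow> True \<in> set us"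
    using v by (auto simp: r binary_value_def horner_sum_bits_eq_0)
  also have "\<dots> \<longleftrightarrow> numerator_pos ?f"
  proof
    assume "True \<in> set us"
    then have ex: "\<exists>i. i < length us \<and> us ! i" by (auto simp: in_set_conv_nth)
    define i where "i = (LEAST i. i < length us \<and> us ! i)"
    have i: "i < length us \<and> us ! i" unfolding i_def using ex by (rule LeastI_ex)
    have "\<not> us ! i'" if "i' < i" for i'
      using not_less_Least[of i' "\<lambda>i. i < length us \<and> us ! i"] that i by (auto simp: i_def)
    then show "numerator_pos ?f"
      using i us unfolding numerator_pos_def by (intro exI[of _ i]) auto
  next
    assume "numerator_pos ?f"
    then obtain i where i: "?f (int i) = Bit True" "\<And>i'. i' < i \<Longrightarrow> ?f (int i') = Bit False"
      unfolding numerator_pos_def by blast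
    have "i < length us"
    proof (rule ccontr)
      assume "\<not> i < length us"
      then have "length us = i \<or> length us < i" by auto
      then show False using i us[of "length us"] by auto
    qed
    then show "True \<in> set us" using i(1) us[of i] by (auto simp: in_set_conv_nth)
  qed
  finally show ?thesis by simp
qed

lemma decider_choice:
  assumes "stage_step M d st (map scan ms) (scan sT) (map scan kT) = Choice a0 a1"
    and "st \<noteq> Yes" "st \<noteq> No" "length ms = tapes M"
    and "(if b then a1 else a0) = (st', am @ a # ak)" "length am = length ms"
    and "map2 act_tape am ms = ms'" "act_tape a sT = sT'" "map2 act_tape ak kT = kT'"
    and "decider_path M d (dconf st' ms' sT' kT') bs t c'"
  shows "decider_path M d (dconf st ms sT kT) (b # bs) (Suc t) c'"
proof (rule comp_path.choice)
  show "\<not> halted (decider M d) (dconf st ms sT kT)"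
    using assms by (simp add: not_halted_decider)
  show "transition_at (decider M d) (dconf st ms sT kT) = Choice a0 a1"
    using assms by (simp add: transition_at_decider)
  show "decider_path M d (apply_action (if b then a1 else a0) (dconf st ms sT kT)) bs t c'"
    unfolding assms(5) using assms by (subst apply_action_append) simp_all
qed

context deciding
begin

text \<open>\<open>k\<close> ticks are spent, \<open>r\<close> are left and \<open>R\<close> is
  their total. A tick simulates at most one step, so the heads stay within the window until the
  clock expires.\<close>

lemma simulation_run:
  "length ds = length ps \<Longrightarrow> in_range n ps \<Longrightarrow> ticks_left n ds ps = r \<Longrightarrow>
    length bs = r \<Longrightarrow> k + r = R \<Longrightarrow> window R k (snd c) ts' \<Longrightarrow> config_ok M c \<Longrightarrow>
    \<exists>ts'' ps''. window R R (snd (mrun M bs c)) ts'' \<and> length ts'' = tapes M \<and> decider_path M d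
      (dconf (Simul (fst c) ds) ts' (S, snd (snd c ! 3)) (clocks ps)) bs (Suc r)
      (dconf Home ts'' (S, snd (snd (mrun M bs c) ! 3)) (clocks ps''))"
proof (induction r arbitrary: ds ps bs k c ts')
  case 0
  have len: "length ts' = tapes M" using "0.prems" by (auto simp: window_def config_ok_def)
  let ?sT = "(S, snd (snd c ! 3))"
  have "decider_path M d (dconf (Simul (fst c) ds) ts' ?sT (clocks ps)) [] (Suc 0)
      (dconf Home ts' ?sT (clocks ps))"
    apply (rule decider_idle)
     apply (use tick_None[OF "0.prems"(1-3)] in \<open>simp add: stage_step_def o_def\<close>)
     apply simp_all[2]
     apply (use len in simp_all)[1]
    by (rule comp_path.refl)
  then show ?case using "0.prems" len by (intro exI[of _ ts'] exI[of _ ps]) auto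
next
  case (Suc r)
  obtain b bs' where bs: "bs = b # bs'" "length bs' = r" using Suc.prems(4) by (cases bs) auto
  obtain ds1 mv ps1 where 1: "tick ds (marks n ps) = Some (ds1, mv)"
      "length ds1 = length ps1" "length ps1 = length ps" "length mv = length ps"
      "in_range n ps1" "ticks_left n ds1 ps1 = r"
      "map2 act_tape (zip (marks n ps) mv) (clocks ps) = clocks ps1"
    using tick_Some[OF Suc.prems(1-3)] by blast
  obtain q ts where c: "c = (q, ts)" by (cases c)
  have len: "length ts = tapes M" "length ts' = tapes M" "4 \<le> length ts"
    using Suc.prems tapes by (auto simp: window_def config_ok_def c)
  have scans: "map scan ts' = map scan ts"
    using window_scan[of R k ts ts'] Suc.prems by (simp add: c)
  let ?sT = "(S, snd (ts ! 3))" and ?ka = "zip (marks n ps) mv"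
  have k1: "Suc k + r = R" using Suc.prems by simp
  show ?case
  proof (cases "halted M c")
    case True
    then have st: "mstep M b c = c" by (simp add: mstep_def)
    obtain ts'' ps'' where 2: "window R R (snd (mrun M bs' c)) ts''" "length ts'' = tapes M" "decider_path M d
      (dconf (Simul q ds1) ts' ?sT (clocks ps1)) bs' (Suc r)
      (dconf Home ts'' (S, snd (snd (mrun M bs' c) ! 3)) (clocks ps''))"
      using Suc.IH[OF 1(2,5,6) bs(2) k1 window_idle[OF Suc.prems(6)] Suc.prems(7)] by (auto simp: c)
    have "decider_path M d
      (dconf (Simul q ds) ts' ?sT (clocks ps)) (b # bs') (Suc (Suc r))
      (dconf Home ts'' (S, snd (snd (mrun M bs' c) ! 3)) (clocks ps''))"
     apply (rule decider_choice[of M d "Simul q ds" ts' ?sT "clocks ps"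
          "(Simul q ds1, idle ts' @ keep ?sT # ?ka)"
          "(Simul q ds1, idle ts' @ keep ?sT # ?ka)" b
          "Simul q ds1" "idle ts'" "keep ?sT" ?ka])
     apply (use 1(1) True in \<open>simp add: stage_step_def o_def halted_def c\<close>)
     apply simp_all[2]
     apply (use len in simp_all)[3]
     apply (rule map2_act_stay_scan)
     apply (rule act_stay_scan)
     apply (rule 1(7))
      by (rule 2(3))
    then show ?thesis using 2(1,2) st by (intro exI[of _ ts''] exI[of _ ps'']) (simp add: bs c)
  next
    case False
    define a where "a = (case transition_at M c of Det a \<Rightarrow> a | Choice a0 a1 \<Rightarrow> if b then a1 else a0)"
    have act: "a \<in> actions (transition_at M c)"
      by (cases "transition_at M c") (auto simp: a_def)
    have st: "mstep M b c = apply_action a c"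
      using False by (cases "transition_at M c") (auto simp: a_def mstep_def)
    obtain q' as where a: "a = (q', as)" by (cases a)
    note ok = config_ok_action[OF wf Suc.prems(7) act]
    have alen: "length as = length ts" using ok(2) by (simp add: a c)
    let ?c = "(q', map2 act_tape as ts)"
    have win: "window R (Suc k) (snd ?c) (map2 act_tape as ts')"
      using window_step[of R k ts ts' as] Suc.prems(6) alen len by (simp add: c)
    have cok: "config_ok M ?c" using ok(1) by (simp add: a c)
    obtain ts'' ps'' where 2: "window R R (snd (mrun M bs' ?c)) ts''" "length ts'' = tapes M" "decider_path M d
      (dconf (Simul q' ds1) (map2 act_tape as ts') (S, snd (map2 act_tape as ts ! 3)) (clocks ps1)) bs' (Suc r)
      (dconf Home ts'' (S, snd (snd (mrun M bs' ?c) ! 3)) (clocks ps''))"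
      using Suc.IH[OF 1(2,5,6) bs(2) k1 win cok] by auto
    have q: "q \<noteq> accept M" "q \<noteq> reject M" "q \<in> states M" "set (map scan ts) \<subseteq> alphabet M"
      using False Suc.prems(7) config_ok_scan[OF Suc.prems(7)] by (auto simp: c halted_def config_ok_def)
    have "\<exists>a0 a1. stage_step M d (Simul q ds) (map scan ts') (scan ?sT) (map scan (clocks ps)) = Choice a0 a1 \<and>
      (if b then a1 else a0) = simul_action ds1 (scan ?sT) ?ka a"
      using q 1(1) by (cases "transition_at M c")
        (auto simp: stage_step_def scans a_def transition_at_scan c simp del: simul_action.simps)
    then obtain a0 a1 where ch: "stage_step M d (Simul q ds) (map scan ts') (scan ?sT) (map scan (clocks ps)) = Choice a0 a1"
      "(if b then a1 else a0) = (Simul q' ds1, as @ (scan ?sT, snd (as ! 3)) # ?ka)"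
      by (auto simp: a)
    have sh: "act_tape (scan ?sT, snd (as ! 3)) ?sT = (S, snd (map2 act_tape as ts ! 3))"
      using act_tape_shadow[where t = "ts ! 3" and h = "snd (ts ! 3)" and a = "as ! 3" and S = S] alen len
      by simp
    have "decider_path M d
      (dconf (Simul q ds) ts' ?sT (clocks ps)) (b # bs') (Suc (Suc r))
      (dconf Home ts'' (S, snd (snd (mrun M bs' ?c) ! 3)) (clocks ps''))"
     apply (rule decider_choice[OF ch(1) _ _ _ ch(2)])
     apply simp_all[2]
     apply (use len alen in simp_all)[2]
     apply (rule HOL.refl)
     apply (rule sh)
     apply (rule 1(7))
      by (rule 2(3))
    then show ?thesis using 2(1,2) st by (intro exI[of _ ts''] exI[of _ ps'']) (simp add: bs c a)
  qed
qed

lemma out_action_scan: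
  "map2 act_tape (out_action a (map scan (t0 # t1 # t2 # t3 # rest))) (t0 # t1 # t2 # t3 # rest) =
    t0 # t1 # t2 # act_tape a t3 # rest"
  by (simp add: out_action_def numeral_eq_Suc del: map_map)

lemma home_run:
  fixes S :: "int \<Rightarrow> nat sym"
  assumes "length rest + 4 = tapes M" and S: "S 0 = Point" "\<And>i. i < 0 \<Longrightarrow> S i = Blank"
    "\<And>i. 0 < i \<Longrightarrow> i \<le> int R \<Longrightarrow> S i \<noteq> Point \<and> S i \<noteq> Blank"
  shows "\<bar>h\<bar> \<le> int R \<Longrightarrow> k = nat \<bar>h\<bar> \<Longrightarrow> decider_path M d
    (dconf Home (t0 # t1 # t2 # (f, h) # rest) (S, h) kT) [] (Suc k)
    (dconf Scan (t0 # t1 # t2 # (f, 0) # rest) (S, 0) kT)"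
proof (induction k arbitrary: h)
  case 0
  then have h: "h = 0" by simp
  show ?case
    unfolding h
    apply (rule decider_idle)
     apply (use S in \<open>simp add: stage_step_def scan_def\<close>)
     apply simp_all[2]
     apply (use assms in simp_all)[1]
    by (rule comp_path.refl)
next
  case (Suc k)
  define dr where "dr = (if h < 0 then Move_R else Move_L)"
  define h' where "h' = (if h < 0 then h + 1 else h - 1)"
  have h': "\<bar>h'\<bar> \<le> int R" "k = nat \<bar>h'\<bar>" using Suc.prems by (auto simp: h'_def)
  have "S h \<noteq> Point" "S h = Blank \<longleftrightarrow> h < 0"
    using S(2)[of h] S(3)[of h] Suc.prems by (cases "h < 0"; force)+
  then have step: "stage_step M d Home (map scan (t0 # t1 # t2 # (f, h) # rest)) (scan (S, h)) (map scan kT) =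
    Det (Home, out_action (scan (f, h), dr) (map scan (t0 # t1 # t2 # (f, h) # rest)) @ (scan (S, h), dr) #
      idle kT)"
    by (simp add: stage_step_def scan_def dr_def Let_def numeral_eq_Suc)
  have move: "act_tape (scan (g, h), dr) (g, h) = (g, h')" for g :: "int \<Rightarrow> nat sym"
    by (simp add: dr_def h'_def act_tape.simps scan_def)
  show ?case
    apply (rule decider_det[OF step])
     apply simp_all[2]
     apply (use assms in \<open>simp_all add: out_action_def\<close>)[2]
     apply (rule out_action_scan)
     apply (rule HOL.refl)
     apply (rule map2_act_stay_scan)
    unfolding move by (rule Suc.IH[OF h'])
qed

lemma scan_run:
  fixes f :: "int \<Rightarrow> nat sym"
  assumes "length rest + 4 = tapes M"
    and f: "f (int i0) \<noteq> Bit False" "\<And>i. i < i0 \<Longrightarrow> f (int i) = Bit False"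
  shows "i \<le> i0 \<Longrightarrow> \<exists>ts. decider_path M d
    (dconf Scan (t0 # t1 # t2 # (f, int i) # rest) sT kT) [] (Suc (i0 - i))
    (if f (int i0) = Bit True then Yes else No, ts)"
proof (induction rule: inc_induct)
  case base
  let ?ms = "t0 # t1 # t2 # (f, int i0) # rest"
  have "decider_path M d (dconf Scan ?ms sT kT) [] (Suc 0)
    (dconf (if f (int i0) = Bit True then Yes else No) ?ms sT kT)"
    apply (rule decider_idle)
     apply (use f in \<open>simp add: stage_step_def scan_def numeral_eq_Suc\<close>)
     apply simp_all[2]
     apply (use assms in simp_all)[1]
    by (rule comp_path.refl)
  then show ?case by auto
next
  case (step i)
  let ?ms = "t0 # t1 # t2 # (f, int i) # rest"
  obtain ts where IH: "decider_path M d
    (dconf Scan (t0 # t1 # t2 # (f, int (Suc i)) # rest) sT kT) [] (Suc (i0 - Suc i))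
    (if f (int i0) = Bit True then Yes else No, ts)"
    using step.IH by blast
  have fi: "f (int i) = Bit False" using f step by simp
  have move: "act_tape (Bit False, Move_R) (f, int i) = (f, int (Suc i))"
    using fi by (simp add: act_tape.simps fun_upd_idem)
  have "decider_path M d (dconf Scan ?ms sT kT) [] (Suc (Suc (i0 - Suc i)))
    (if f (int i0) = Bit True then Yes else No, ts)"
    apply (rule decider_det[of M d _ _ _ _ _
        "out_action (Bit False, Move_R) (map scan ?ms)" "keep sT" "idle kT"])
     apply (use fi in \<open>simp add: stage_step_def scan_def numeral_eq_Suc\<close>)
     apply simp_all[2]
     apply (use assms in \<open>simp_all add: out_action_def\<close>)[2]
     apply (rule out_action_scan)
     apply (rule act_stay_scan)
     apply (rule map2_act_stay_scan)
    unfolding move by (rule IH)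
  then show ?case using step by (auto simp: Suc_diff_Suc)
qed

abbreviation c0 :: "(nat, nat) config" where
  "c0 \<equiv> approx_config M x (1 / 2) (1 / 2)"

lemma c0_ok: "config_ok M c0"
  unfolding approx_config_def
  by (rule config_ok_init) (use wf tapes in \<open>auto simp: word_tape_alphabet real_tape_alphabet\<close>)

lemma decider_run:
  assumes len: "length bs = ticks"
  shows "\<exists>t c. t \<le> 2 * n + 5 * ticks + 11 \<and> decider_path M d (input_config (decider M d) x) bs t c \<and>
    fst c = (if numerator_pos (fst (snd (mrun M bs c0) ! 3)) then Yes else No)"
proof -
  let ?R = ticks
  let ?p = "zt 0 [] (prepared ?R)" and ?rest = "replicate (tapes M - 3) blank_tape"
  define S where "S = fst ?p"
  have p: "?p = (S, 0)" by (simp add: S_def zt_def)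
  let ?ts = "x_tape 0 # ?p # ?p # ?rest"
  obtain ds ps where 1: "length ds = length ps" "length ps = d" "in_range n ps"
    "ticks_left n ds ps = ticks"
    "decider_path M d (input_config (decider M d) x) [] (2 * n + 2 * ticks + 8)
      (dconf (Simul (start M) ds) ?ts ?p (clocks ps))"
    using preparation_run by blast
  have c0: "fst c0 = start M" "snd c0 = x_tape 0 # (real_tape (1 / 2), 0) # (real_tape (1 / 2), 0) # ?rest"
    using tapes by (simp_all add: approx_config_def init_config_def zt_blank)
  have win: "window ?R 0 (snd c0) ?ts"
    unfolding window_def
  proof (intro conjI allI impI)
    fix j assume "j < length (snd c0)"
    then have j: "j < tapes M" using tapes by (simp add: c0)
    have "j = 0 \<or> j = 1 \<or> j = 2 \<or> (\<exists>j' < tapes M - 3. j = Suc (Suc (Suc j')))"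
      using j by presburger
    then consider "j = 0" | "j = 1" | "j = 2" | j' where "j = Suc (Suc (Suc j'))" "j' < tapes M - 3"
      by blast
    note j_cases = this
    show "snd (?ts ! j) = snd (snd c0 ! j)"
      using j_cases by cases (simp_all add: c0 zt_blank p numeral_2_eq_2)
    show "\<bar>snd (snd c0 ! j)\<bar> \<le> int 0"
      using j_cases by cases (simp_all add: c0 zt_blank numeral_2_eq_2)
    fix i assume i: "i \<le> int ?R + 1 \<or> j \<noteq> 1 \<and> j \<noteq> 2"
    show "fst (?ts ! j) i = fst (snd c0 ! j) i"
      using j_cases by cases (use i in \<open>simp_all add: c0 prepared_tape numeral_2_eq_2\<close>)
  next
    fix i
    show "fst (snd c0 ! 3) i = Blank" using tapes by (simp add: c0 numeral_3_eq_3 zt_blank)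
  qed (simp add: c0)
  have h0: "snd (snd c0 ! 3) = 0"
    using tapes by (simp add: c0 numeral_3_eq_3 zt_blank)
  let ?c = "mrun M bs c0"
  obtain ts'' ps'' where 2: "window ?R ?R (snd ?c) ts''" and lts: "length ts'' = tapes M" and path: "decider_path M d
      (dconf (Simul (start M) ds) ?ts ?p (clocks ps)) bs (Suc ticks)
      (dconf Home ts'' (S, snd (snd ?c ! 3)) (clocks ps''))"
    using simulation_run[OF 1(1,3,4) len _ win c0_ok, where S = S] unfolding h0 c0(1) p by auto
  obtain t0 t1 t2 t3 rest where ts'': "ts'' = t0 # t1 # t2 # t3 # rest"
  proof -
    have "Suc (Suc (Suc (Suc 0))) \<le> length ts''" using lts tapes by simp
    then show ?thesis using that by (auto simp: Suc_le_length_iff)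
  qed
  have rest: "length rest + 4 = tapes M" using lts by (simp add: ts'')
  let ?f = "fst (snd ?c ! 3)" and ?h = "snd (snd ?c ! 3)"
  have l3: "3 < length (snd ?c)" using 2 lts tapes by (simp add: window_def)
  have t3: "t3 = (?f, ?h)" "\<bar>?h\<bar> \<le> int ?R"
  proof -
    have "snd (ts'' ! 3) = ?h" "\<bar>?h\<bar> \<le> int ?R" "\<And>i. fst (ts'' ! 3) i = ?f i"
      using 2 l3 by (auto simp: window_def)
    then show "t3 = (?f, ?h)" "\<bar>?h\<bar> \<le> int ?R"
      by (auto simp: ts'' numeral_3_eq_3 prod_eq_iff)
  qed
  \<comment> \<open>In \<open>ticks\<close> steps the output head cannot have written on cell
    \<open>ticks\<close>; its blank bounds the scan for the first cell that is not a zero.\<close>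
  have blank: "?f (int ?R) = Blank" using 2 by (simp add: window_def)
  have 3: "decider_path M d (dconf Home ts'' (S, ?h) (clocks ps'')) [] (Suc (nat \<bar>?h\<bar>))
    (dconf Scan (t0 # t1 # t2 # (?f, 0) # rest) (S, 0) (clocks ps''))"
    unfolding ts'' t3(1)
    by (rule home_run[OF rest _ _ _ t3(2)]) (auto simp: S_def prepared_tape real_tape_half)
  define i0 where "i0 = (LEAST i. ?f (int i) \<noteq> Bit False)"
  have ex: "?f (int ?R) \<noteq> Bit False" using blank by simp
  then have i0: "?f (int i0) \<noteq> Bit False" "i0 \<le> ?R"
    unfolding i0_def by (rule LeastI, rule Least_le)
  have before: "?f (int i) = Bit False" if "i < i0" for i
    using not_less_Least[of i "\<lambda>i. ?f (int i) \<noteq> Bit False"] that by (auto simp: i0_def)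
  obtain ts where 4: "decider_path M d
    (dconf Scan (t0 # t1 # t2 # (?f, int 0) # rest) (S, 0) (clocks ps'')) [] (Suc (i0 - 0))
    (if ?f (int i0) = Bit True then Yes else No, ts)"
    using scan_run[of rest ?f i0 0, OF rest i0(1) before] by blast
  let ?t = "2 * n + 2 * ticks + 8 + (Suc ticks + (Suc (nat \<bar>?h\<bar>) + Suc (i0 - 0)))"
  have "decider_path M d (input_config (decider M d) x) ([] @ bs @ [] @ []) ?t
    (if ?f (int i0) = Bit True then Yes else No, ts)"
    by (rule comp_path_trans[OF 1(5) comp_path_trans[OF path comp_path_trans[OF 3]]]) (use 4 in simp)
  \<comment> \<open>The distance of the output head from cell 0 and the length of the scan are both
    at most \<open>ticks\<close>; with two fillings' worth of preparation and the simulation this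
    gives five multiples.\<close>
  moreover have "?t \<le> 2 * n + 5 * ticks + 11" using t3(2) i0(2) by simp
  moreover have "numerator_pos ?f \<longleftrightarrow> ?f (int i0) = Bit True"
    using numerator_pos_iff_least[of ?f i0, OF i0(1) before] .
  ultimately show ?thesis
    by (intro exI[of _ ?t] exI[of _ "(if ?f (int i0) = Bit True then Yes else No, ts)"]) simp
qed

end

section \<open>Acceptance by the decider and the second inclusion\<close>

lemma input_config_enc:
  "input_config (enc_tm N) x = (to_nat (fst (input_config N x)), snd (input_config N x))"
  by (simp add: input_config_def init_config_def enc_tm_def)

context deciding
begin

lemma decider_accepts:
  "halts_within (enc_tm (decider M d)) (input_config (enc_tm (decider M d)) x) (2 * n + 5 * ticks + 11)"
  "comp_path (enc_tm (decider M d)) (input_config (enc_tm (decider M d)) x) bs t c \<Longrightarrow>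
    halted (enc_tm (decider M d)) c \<Longrightarrow> length bs = ticks"
  "real (acc (enc_tm (decider M d)) x) =
    measure_pmf.prob (run M ticks c0) {c. numerator_pos (fst (snd c ! 3))} * 2 ^ ticks"
proof -
  let ?N = "enc_tm (decider M d)" and ?S = "2 * n + 5 * ticks + 11"
  let ?good = "\<lambda>bs. numerator_pos (fst (snd (mrun M bs c0) ! 3))"
  have "\<exists>c. length bs = ticks \<longrightarrow> (\<exists>t \<le> ?S. decider_path M d (input_config (decider M d) x) bs t c \<and>
    halted (decider M d) c) \<and> fst c = (if ?good bs then Yes else No)" for bs
    using decider_run[of bs] unfolding halted_def decider_sel by (metis (full_types))
  then obtain G where G: "\<And>bs. length bs = ticks \<Longrightarrow>
    (\<exists>t \<le> ?S. decider_path M d (input_config (decider M d) x) bs t (G bs) \<and> halted (decider M d) (G bs)) \<and>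
      fst (G bs) = (if ?good bs then Yes else No)"
    by metis
  define F where "F bs = (to_nat (fst (G bs)), snd (G bs))" for bs
  have F: "\<exists>t\<le>?S. comp_path ?N (input_config ?N x) bs t (F bs) \<and> halted ?N (F bs)"
    if "length bs = ticks" for bs
    unfolding F_def input_config_enc using G[OF that] by (intro enc_paths) blast
  note complete = complete_paths[of ticks ?S ?N "input_config ?N x" F, OF F]
  show "halts_within ?N (input_config ?N x) ?S" by (rule complete(1))
  show "comp_path ?N (input_config ?N x) bs t c \<Longrightarrow> halted ?N c \<Longrightarrow> length bs = ticks"
    using complete(2) by blast
  have acc_F: "fst (F bs) = accept ?N \<longleftrightarrow> ?good bs" if "length bs = ticks" for bs
    using G[OF that] by (auto simp: F_def enc_tm_def decider_sel split: if_splits)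
  then have "{bs. fst (F bs) = accept ?N \<and> length bs = ticks} = {bs \<in> {bs. ?good bs}. length bs = ticks}"
    by blast
  then have "real (acc ?N x) = measure_pmf.prob (bits ticks) {bs. ?good bs} * 2 ^ ticks"
    using acc_eq_card[OF F] by (simp add: prob_bits)
  also have "measure_pmf.prob (bits ticks) {bs. ?good bs} =
      measure_pmf.prob (run M ticks c0) {c. numerator_pos (fst (snd c ! 3))}"
    by (simp add: run_eq_mrun vimage_def)
  finally show "real (acc ?N x) =
    measure_pmf.prob (run M ticks c0) {c. numerator_pos (fst (snd c ! 3))} * 2 ^ ticks" .
qed

end

lemma FPRAS'_subset_sharpRP2: "FPRAS' \<subseteq> sharpRP2"
proof
  fix f assume "f \<in> FPRAS'"
  then obtain M where f: "f \<in> sharpP" and M: "approximates M f"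
    and zero: "\<And>x \<epsilon> \<delta>. \<epsilon> > 0 \<Longrightarrow> \<delta> > 0 \<Longrightarrow> f x = 0 \<Longrightarrow>
        measure_pmf.prob (outcome M (approx_config M x \<epsilon> \<delta>)) {c. returns c 0} = 1"
    unfolding FPRAS'_def FPRAS_def by blast
  have wf: "wf_tm M" "tapes M \<ge> 4" using M by (auto simp: approximates_def)
  obtain P where P: "\<And>x \<epsilon> \<delta>. \<epsilon> > 0 \<Longrightarrow> \<delta> > 0 \<Longrightarrow>
        \<exists>T. halts_within M (approx_config M x \<epsilon> \<delta>) T \<and>
             real T \<le> poly P (real (length x) + 1 / \<epsilon> + max 0 (log 2 (1 / \<delta>)))"
    using M unfolding approximates_def by blast
  have correct: "measure_pmf.prob (outcome M (approx_config M x \<epsilon> \<delta>))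
      {c. \<exists>r. returns c r \<and> (1 - \<epsilon>) * real (f x) \<le> r \<and> r \<le> (1 + \<epsilon>) * real (f x)} \<ge> 1 - \<delta>"
    if "\<epsilon> > 0" "\<delta> > 0" for x \<epsilon> \<delta>
    using M that unfolding approximates_def by blast
  obtain C e where C: "C \<ge> 0" "\<And>u y. 0 \<le> u \<Longrightarrow> u \<le> y \<Longrightarrow> poly P u \<le> C * (1 + y) ^ e"
    using poly_growth[of P] by blast
  obtain a where a: "C < 2 ^ a" using real_arch_pow[of 2 C] by auto
  \<comment> \<open>For \<epsilon> = \<delta> = 1/2 the argument of \<open>P\<close> is n + 3. As C
    < 2^a and n + 4 \<le> (n + 2)^2, the time is at most (n + 2)^(a + 2 e); one more factor n + 2
    makes up for the 1 subtracted in \<open>p\<close>.\<close>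
  define d where "d = Suc (a + 2 * e)"
  define p where "p m = (m + 2) ^ d - 1" for m :: nat
  let ?N = "enc_tm (decider M d)"
  have dec: "deciding M d" using wf by unfold_locales (simp_all add: d_def)
  have ticks: "deciding.ticks d x = p (length x)" for x
    by (simp add: deciding.ticks_def[OF dec] p_def)
  have halts: "halts_within M (approx_config M x (1 / 2) (1 / 2)) (p (length x))" for x
  proof -
    let ?n = "real (length x)"
    obtain T where T: "halts_within M (approx_config M x (1 / 2) (1 / 2)) T" "real T \<le> poly P (?n + 3)"
      using P[of "1 / 2" "1 / 2" x] by (auto simp: add.commute)
    have "real T \<le> C * (1 + (?n + 3)) ^ e"
      using T(2) C(2)[of "?n + 3" "?n + 3"] by simp
    also have "\<dots> \<le> (?n + 2) ^ a * ((?n + 2) ^ 2) ^ e"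
    proof (intro mult_mono power_mono)
      have "(2 :: real) ^ a \<le> (?n + 2) ^ a" by (intro power_mono) auto
      then show "C \<le> (?n + 2) ^ a" using a by simp
      show "1 + (?n + 3) \<le> (?n + 2) ^ 2" by (simp add: power2_eq_square algebra_simps)
    qed auto
    also have "\<dots> = real ((length x + 2) ^ (a + 2 * e))"
      by (simp add: power_add power_mult add.commute)
    finally have "T \<le> (length x + 2) ^ (a + 2 * e)" by linarith
    also have "\<dots> \<le> p (length x)"
    proof -
      have "1 \<le> (length x + 2) ^ (a + 2 * e)" by simp
      then have "(length x + 2) ^ (a + 2 * e) + 1 \<le> 2 * (length x + 2) ^ (a + 2 * e)" by linarith
      also have "\<dots> \<le> (length x + 2) ^ d" by (simp add: d_def)
      finally show ?thesis by (simp add: p_def)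
    qed
    finally show ?thesis using T(1) by (meson halts_within_def order_trans)
  qed
  have acc: "real (acc ?N x) = measure_pmf.prob (outcome M (approx_config M x (1 / 2) (1 / 2)))
      {c. numerator_pos (fst (snd c ! 3))} * 2 ^ p (length x)" for x
    using deciding.decider_accepts(3)[OF dec, of x] outcome_eq_run[OF halts[of x]] by (simp add: ticks)
  have poly_p: "is_polynomial p"
    unfolding is_polynomial_def
    by (rule exI[of _ "[:2, 1:] ^ d - 1"]) (simp add: p_def of_nat_diff add.commute)
  have poly_T: "is_polynomial (\<lambda>m. 2 * m + 5 * p m + 11)"
  proof -
    obtain Q where "\<And>m. real (p m) = poly Q (real m)" using poly_p by (auto simp: is_polynomial_def)
    then show ?thesis
      unfolding is_polynomial_def by (intro exI[of _ "[:11, 2:] + [:5:] * Q"]) simp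
  qed
  have "wf_tm ?N" "tapes ?N \<ge> 1"
    using wf_enc[OF wf_decider[OF wf]] by (simp_all add: enc_sel decider_sel d_def)
  moreover have "\<exists>T. is_polynomial T \<and> (\<forall>x. halts_within ?N (input_config ?N x) (T (length x)))"
    using poly_T deciding.decider_accepts(1)[OF dec] by (auto simp: ticks)
  ultimately have nptm: "nptm ?N p"
    unfolding nptm_def using poly_p deciding.decider_accepts(2)[OF dec] by (auto simp: ticks)
  have "real (acc ?N x) \<ge> 1 / 2 * 2 ^ p (length x)" if "f x > 0" for x
  proof -
    let ?O = "outcome M (approx_config M x (1 / 2) (1 / 2))"
    have "1 / 2 \<le> measure_pmf.prob ?O {c. \<exists>r. returns c r \<and> (1 - 1 / 2) * real (f x) \<le> r \<and>
        r \<le> (1 + 1 / 2) * real (f x)}"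
      using correct[of "1 / 2" "1 / 2" x] by simp
    \<comment> \<open>With \<epsilon> = 1/2 an accurate result is at least f x / 2, hence
      nonzero.\<close>
    also have "\<dots> \<le> measure_pmf.prob ?O {c. numerator_pos (fst (snd c ! 3))}"
    proof (intro measure_pmf.finite_measure_mono subsetI)
      fix c assume "c \<in> {c. \<exists>r. returns c r \<and> (1 - 1 / 2) * real (f x) \<le> r \<and> r \<le> (1 + 1 / 2) * real (f x)}"
      then obtain r where "returns c r" "(1 - 1 / 2) * real (f x) \<le> r" by blast
      then have "returns c r" "r \<noteq> 0" using that by auto
      then show "c \<in> {c. numerator_pos (fst (snd c ! 3))}" by (simp add: returns_numerator_pos)
    qed simp
    finally show ?thesis unfolding acc by (intro mult_right_mono) simp_all
  qed
  moreover have "acc ?N x = 0" if "f x = 0" for x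
  proof -
    let ?O = "outcome M (approx_config M x (1 / 2) (1 / 2))"
    have "measure_pmf.prob ?O {c. returns c 0} = 1" using zero that by simp
    then have "AE c in ?O. returns c 0" by (simp add: measure_pmf.prob_eq_1)
    then have "measure_pmf.prob ?O {c. numerator_pos (fst (snd c ! 3))} = 0"
      by (subst measure_pmf.prob_eq_0) (auto simp: returns_numerator_pos elim: eventually_mono)
    then show ?thesis using acc[of x] by simp
  qed
  ultimately have "{x. f x > 0} \<in> RP"
    unfolding RP_def using nptm by blast
  then show "f \<in> sharpRP2" using f by (simp add: sharpRP2_def)
qed

theorem theorem10:
  shows "sharpRP1 \<subseteq> FPRAS' \<and> FPRAS' \<subseteq> sharpRP2"
  using sharpRP1_subset_FPRAS' FPRAS'_subset_sharpRP2 by blast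

end
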